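(* Let $1<p,q<\infty$, $\gamma>0$ and $\beta\in\mathbb{R}$, and let $\Lambda=\{\lambda_k\}_{k\in\mathbb{N}}$ be the multiplier sequence $$\lambda_k=k^{-(1/p-1/q)_+}(\ln k)^{-\gamma},\qquad k\ge 2,$$ with $\lambda_1$ an arbitrary fixed real number. Then the sequence of subspaces of trigonometric polynomials $\mathcal{T}_n$, $n=1,2,\dots$, is optimal in the sense of order for the class $\Lambda_\beta U_p$ in $L_q$; that is, $$\sup_{f\in\Lambda_\beta U_p}\ \inf_{g\in\mathcal{T}_n}\|f-g\|_q\ \asymp\ d_{2n+1}\left(\Lambda_\beta U_p,L_q\right),\qquad n\to\infty .$$
   Context: $\mathbb{T}^1$ is the unit circle (identified with $\mathbb{R}/2\pi\mathbb{Z}$) with Lebesgue measure $dx$. For $1\le p<\infty$, $L_p=L_p(\mathbb{T}^1)$ is the space of (real-valued) functions with $\|\phi\|_p=\left(\int_{\mathbb{T}^1}|\phi(x)|^p\,dx\right)^{1/p}<\infty$. For $a\in\mathbb{R}$, $(a)_+:=\max\{a,0\}$. Trigonometric polynomials: $\mathcal{T}_n:=\mathrm{lin}\{1,\cos kx,\sin kx:\ 1\le k\le n\}$, a subspace of dimension $2n+1$. Kolmogorov width: for a Banach space $X$ and a set $A\subset X$, $$d_n(A,X):=\inf_{X_n\subset X}\ \sup_{f\in A}\ \inf_{g\in X_n}\|f-g\|_X,$$ where $X_n$ runs over all linear subspaces of $X$ of dimension $\le n$. Multiplier classes: functions $\phi\in L_p$ are considered with formal Fourier series without constant term, $$\phi\sim\sum_{k=1}^\infty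 \left(a_k(\phi)\cos kx+b_k(\phi)\sin kx\right),$$ and $U_p$ is the set of such $\phi$ with $\|\phi\|_p\le 1$. For a real sequence $\Lambda=\{\lambda_k\}_{k\in\mathbb{N}}$ and $\beta\in\mathbb{R}$, the class $\Lambda_\beta U_p$ consists of all integrable functions $f$ on $\mathbb{T}^1$ whose Fourier series is $$f\sim\sum_{k=1}^\infty\lambda_k\left(a_k(\phi)\cos\left(kx-\tfrac{\beta\pi}{2}\right)+b_k(\phi)\sin\left(kx-\tfrac{\beta\pi}{2}\right)\right)$$ for some $\phi\in U_p$. (When there is $K\in L_1$ with $K\sim\sum_{k\ge1}\lambda_k\cos(kx-\beta\pi/2)$, this is, up to a constant normalization factor, the convolution class $K*U_p$.) For nonnegative sequences, $a_n\asymp b_n$ as $n\to\infty$ means that there are constants $0<C_1\le C_2<\infty$, independent of $n$ (but possibly depending on $p,q,\gamma,\beta$ and $\lambda_1$), such that $C_1 b_n\le a_n\le C_2 b_n$ for all sufficiently large $n$. *)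

theory Defs
  imports "HOL-Analysis.Analysis" "HOL-Library.Function_Algebras"
begin

text \<open>
  Functions on the circle are \<open>2\<pi>\<close>-periodic functions on the real line, integrated over one
  period. Elements of \<open>L\<^sub>p\<close> are represented by Borel functions and not by classes modulo equality
  almost everywhere; all notions below depend on such a class only.
\<close>

definition circle :: "real measure" where
  "circle = restrict_space lborel {0..2 * pi}"

definition Lp :: "real \<Rightarrow> (real \<Rightarrow> real) set" where
  "Lp p = {f. f \<in> borel_measurable borel \<and> (\<forall>x. f (x + 2 * pi) = f x)
              \<and> integrable circle (\<lambda>x. \<bar>f x\<bar> powr p)}"

text \<open>The norm is infinite outside \<open>L\<^sub>p\<close>, where the Bochner integral would be \<open>0\<close>.\<close>

definition Lp_norm :: "real \<Rightarrow> (real \<Rightarrow> real) \<Rightarrow> ennreal" where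
  "Lp_norm p f =
     (if f \<in> Lp p then ennreal ((\<integral>x. \<bar>f x\<bar> powr p \<partial>circle) powr (1 / p)) else \<infinity>)"

definition fourier_cos :: "(real \<Rightarrow> real) \<Rightarrow> nat \<Rightarrow> real" where
  "fourier_cos f k = (1 / pi) * (\<integral>x. f x * cos (real k * x) \<partial>circle)"

definition fourier_sin :: "(real \<Rightarrow> real) \<Rightarrow> nat \<Rightarrow> real" where
  "fourier_sin f k = (1 / pi) * (\<integral>x. f x * sin (real k * x) \<partial>circle)"

definition Lp_ball :: "real \<Rightarrow> (real \<Rightarrow> real) set" where
  "Lp_ball p = {\<phi> \<in> Lp p. fourier_cos \<phi> 0 = 0 \<and> Lp_norm p \<phi> \<le> 1}"

text \<open>
  Two formal Fourier series agree iff their harmonics of each frequency agree as functions.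
  The value \<open>\<Lambda> 0\<close> is not used.
\<close>

definition multiplier_class ::
  "(nat \<Rightarrow> real) \<Rightarrow> real \<Rightarrow> (real \<Rightarrow> real) set \<Rightarrow> (real \<Rightarrow> real) set" where
  "multiplier_class \<Lambda> \<beta> U =
     {f \<in> Lp 1. fourier_cos f 0 = 0 \<and>
        (\<exists>\<phi>\<in>U. \<forall>k\<ge>1. \<forall>x.
           fourier_cos f k * cos (real k * x) + fourier_sin f k * sin (real k * x) =
           \<Lambda> k * (fourier_cos \<phi> k * cos (real k * x - \<beta> * pi / 2)
                + fourier_sin \<phi> k * sin (real k * x - \<beta> * pi / 2)))}"

interpretation fun_vs: vector_space "\<lambda>(c::real) (f :: real \<Rightarrow> real) x. c * f x"
  by unfold_locales (auto simp: fun_eq_iff algebra_simps)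

definition trig_poly :: "nat \<Rightarrow> (real \<Rightarrow> real) set" where
  "trig_poly n = fun_vs.span
     ({\<lambda>x. 1} \<union> (\<lambda>k x. cos (real k * x)) ` {1..n} \<union> (\<lambda>k x. sin (real k * x)) ` {1..n})"

definition deviation ::
  "((real \<Rightarrow> real) \<Rightarrow> ennreal) \<Rightarrow> (real \<Rightarrow> real) set \<Rightarrow> (real \<Rightarrow> real) set \<Rightarrow> ennreal" where
  "deviation N A V = (SUP f\<in>A. INF g\<in>V. N (f - g))"

text \<open>
  Dimension at most \<open>n\<close> is stated by a spanning set, since \<open>fun_vs.dim\<close> is \<open>0\<close> on
  infinite-dimensional subspaces. Every subspace of dimension at most \<open>n\<close> of the space \<open>X\<close>
  modulo functions of norm \<open>0\<close> is the image of such a \<open>V\<close>.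
\<close>

definition kolmogorov_width ::
  "((real \<Rightarrow> real) \<Rightarrow> ennreal) \<Rightarrow> nat \<Rightarrow> (real \<Rightarrow> real) set \<Rightarrow> (real \<Rightarrow> real) set \<Rightarrow> ennreal" where
  "kolmogorov_width N n A X =
     (INF V\<in>{V. V \<subseteq> X \<and> fun_vs.subspace V \<and> (\<exists>B. finite B \<and> card B \<le> n \<and> V = fun_vs.span B)}.
        deviation N A V)"

text \<open>
  The relation is about nonnegative real sequences, so the terms are required to be finite
  from some index on.
\<close>

definition same_order :: "(nat \<Rightarrow> ennreal) \<Rightarrow> (nat \<Rightarrow> ennreal) \<Rightarrow> bool" where
  "same_order a b \<longleftrightarrow>
     (\<exists>C1 C2 :: real. 0 < C1 \<and> C1 \<le> C2 \<and>
        (\<forall>\<^sub>F n in sequentially. a n < \<infinity> \<and> b n < \<infinity> \<and>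
           ennreal C1 * b n \<le> a n \<and> a n \<le> ennreal C2 * b n))"

end

theory Submission
  imports Defs "HOL-Complex_Analysis.Complex_Analysis"
begin

text \<open>
  With \<open>\<alpha> = (1/p - 1/q)\<^sub>+\<close>, both sides are of the order \<open>(ln n)\<^bsup>-\<gamma>\<^esup>\<close>. The smoothing by
  \<open>k\<^bsup>-\<alpha>\<^esup>\<close> is exactly what the embedding of \<open>L\<^sub>p\<close> into \<open>L\<^sub>q\<close> costs and contributes no decay, and the
  logarithm does not distinguish \<open>n\<close> from a power \<open>n\<^sup>A\<close>. So a subspace of dimension \<open>2n+1\<close> is
  tested by polynomials of degree \<open>n\<^sup>A\<close>, in a space whose dimension is so much larger that the
  subspace is hardly noticed in it.

  Upper bound (\<open>deviation_trig_poly_le\<close>). The sequence \<open>\<Lambda>\<close> is convex from \<open>k = 2\<close> on, so two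
  summations by parts write the multiplier \<open>\<Lambda> k\<close>, \<open>k > n\<close>, continued linearly to \<open>k \<le> n\<close>, as a
  combination of Fejer means with nonnegative weights \<open>w k = k (\<Lambda> (k-1) + \<Lambda> (k+1) - 2 \<Lambda> k)\<close>; the
  continuation changes the function by a polynomial of degree \<open>n\<close> only. For \<open>q \<le> p\<close> the weights have
  total mass of order \<open>(ln n)\<^bsup>-\<gamma>\<^esup>\<close>, and Fejer means are contractions. For \<open>p < q\<close> they are at most
  \<open>(ln n)\<^bsup>-\<gamma>\<^esup> k\<^bsup>-\<alpha>-1\<^esup>\<close> up to a constant, and such a combination maps \<open>L\<^sub>p\<close> into \<open>L\<^sub>q\<close> by a
  Hardy-Littlewood-Sobolev inequality (\<open>fejer_combination_sobolev\<close>). The phase \<open>\<beta> \<pi> / 2\<close> costs a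
  constant factor by M. Riesz's theorem on conjugate functions (\<open>conjugation_bounded\<close>). All of this is
  done for trigonometric polynomials; a function of the class is reached through its Fejer means and
  Fatou's lemma.

  Lower bound (\<open>width_lower_bound\<close>). Given a subspace \<open>V\<close> of dimension at most \<open>2n+1\<close>, one looks for
  a polynomial \<open>y\<close> of degree at most \<open>N\<close>, a power of \<open>n\<close>, that annihilates \<open>V\<close>. The function of the
  class that arises from a multiple of \<open>y\<close>, its phases being rotated back, has with \<open>y\<close> the inner
  product \<open>\<Sum>k. \<Lambda> k \<bar>y k\<bar>\<^sup>2\<close> up to a factor, at least \<open>\<Lambda> N\<close> times the square of the \<open>L\<^sub>2\<close> norm of
  \<open>y\<close>, and Hoelder's inequality turns this into a distance from \<open>V\<close>. It has the right order when the
  norms of \<open>y\<close> are like those of a cosine (for \<open>q \<le> p\<close>) or of a Fejer kernel (for \<open>p < q\<close>). Such a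
  \<open>y\<close> is the part of a cosine, or of a translate of the Fejer kernel, orthogonal to \<open>V\<close>. The squared
  lengths of the projections of these functions onto a space of dimension \<open>2n+1\<close>, summed over the
  frequencies or integrated over the translations, are bounded by a multiple of the dimension, so one
  of the functions is nearly orthogonal to it.
\<close>

section \<open>Integration over the circle\<close>

lemma space_circle [simp]: "space circle = {0..2 * pi}"
  by (simp add: circle_def space_restrict_space)

lemma measurable_circleI [measurable (raw)]:
  "f \<in> measurable borel M \<Longrightarrow> f \<in> measurable circle M"
  unfolding circle_def by (intro measurable_restrict_space1) simp

lemma emeasure_circle: "emeasure circle (space circle) = ennreal (2 * pi)"
  unfolding circle_def by (simp add: emeasure_restrict_space space_restrict_space)

lemma measure_circle [simp]: "measure circle {0..2 * pi} = 2 * pi"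
  using emeasure_circle by (simp add: measure_def)

interpretation circle: finite_measure circle
  by standard (simp only: emeasure_circle, simp)

interpretation circle_pair: pair_sigma_finite circle circle ..

lemma integrable_circle_bounded:
  fixes f :: "real \<Rightarrow> real"
  assumes "f \<in> borel_measurable circle" "\<And>x. \<bar>f x\<bar> \<le> B"
  shows "integrable circle f"
  by (rule circle.integrable_const_bound[where B=B]) (use assms in auto)

lemma integrable_circle_continuous:
  fixes f :: "real \<Rightarrow> real"
  assumes "continuous_on UNIV f"
  shows "integrable circle f"
proof -
  have "compact (f ` {0..2 * pi})"
    by (rule compact_continuous_image) (auto intro: continuous_on_subset[OF assms])
  then obtain B where B: "\<And>x. x \<in> {0..2 * pi} \<Longrightarrow> \<bar>f x\<bar> \<le> B"
    by (metis bounded_iff compact_imp_bounded imageI real_norm_def)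
  have [measurable]: "f \<in> borel_measurable borel"
    using assms by (rule borel_measurable_continuous_onI)
  show ?thesis
    by (rule circle.integrable_const_bound[where B=B]) (auto simp: B)
qed

lemma integral_circle_FTC:
  fixes F f :: "real \<Rightarrow> real"
  assumes "\<And>x. (F has_real_derivative f x) (at x)" "\<And>x. isCont f x"
  shows "(\<integral>x. f x \<partial>circle) = F (2 * pi) - F 0"
proof -
  have "(\<integral>x. f x \<partial>circle) = (\<integral>x. f x * indicator {0..2*pi} x \<partial>lborel)"
    unfolding circle_def by (simp add: integral_restrict_space set_lebesgue_integral_def mult.commute)
  also have "\<dots> = F (2 * pi) - F 0"
    by (rule integral_FTC_Icc_real) (use assms in auto)
  finally show ?thesis .
qed

lemma integral_circle_cos:
  fixes m :: int
  assumes "m \<noteq> 0"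
  shows "(\<integral>x. cos (of_int m * x + c) \<partial>circle) = 0"
proof -
  have "(\<integral>x. cos (of_int m * x + c) \<partial>circle)
      = sin (of_int m * (2 * pi) + c) / of_int m - sin (of_int m * 0 + c) / of_int m"
    by (rule integral_circle_FTC[where F="\<lambda>x. sin (of_int m * x + c) / of_int m"])
       (use assms in \<open>auto intro!: derivative_eq_intros continuous_intros\<close>)
  also have "of_int m * (2 * pi) + c = c + 2 * pi * of_int m" by simp
  also have "sin \<dots> = sin c" by (simp add: sin_add)
  finally show ?thesis by simp
qed

text \<open>
  Constant factors do not matter here, so the estimates are for power integrals and not for norms; in
  this form \<open>\<bar>a + b\<bar>\<^sup>p \<le> 2\<^sup>p (\<bar>a\<bar>\<^sup>p + \<bar>b\<bar>\<^sup>p)\<close> does the work of Minkowski's inequality.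
\<close>

abbreviation pint :: "real \<Rightarrow> (real \<Rightarrow> real) \<Rightarrow> real" where
  "pint p f \<equiv> (\<integral>x. \<bar>f x\<bar> powr p \<partial>circle)"

section \<open>Trigonometric polynomials without constant term\<close>

text \<open>
  The harmonic \<open>a cos kx + b sin kx\<close> is the real inner product of \<open>a + \<i> b\<close> with \<open>cis (k x)\<close>.
  With complex coefficients, conjugation is multiplication by \<open>\<i>\<close> and the rotation of all phases
  by a fixed angle is multiplication by a number of modulus one.
\<close>

definition trig :: "nat \<Rightarrow> (nat \<Rightarrow> complex) \<Rightarrow> real \<Rightarrow> real" where
  "trig N u x = (\<Sum>k=1..N. u k \<bullet> cis (real k * x))"

definition fcoef :: "(real \<Rightarrow> real) \<Rightarrow> nat \<Rightarrow> complex" where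
  "fcoef f k = Complex (fourier_cos f k) (fourier_sin f k)"

lemma inner_cis: "u \<bullet> cis t = Re u * cos t + Im u * sin t"
  by (simp add: inner_complex_def)

lemma fcoef_inner_cis: "fcoef f k \<bullet> cis t = fourier_cos f k * cos t + fourier_sin f k * sin t"
  by (simp add: inner_cis fcoef_def)

lemma continuous_trig [continuous_intros]:
  "continuous_on A g \<Longrightarrow> continuous_on A (\<lambda>x. trig N u (g x))"
  unfolding trig_def by (intro continuous_intros) (auto simp: cis_conv_exp intro!: continuous_intros)

lemma trig_measurable [measurable]: "trig N u \<in> borel_measurable borel"
  by (rule borel_measurable_continuous_onI) (intro continuous_intros)

lemma trig_periodic: "trig N u (x + 2 * pi) = trig N u x"
proof -
  have "cis (real k * (x + 2 * pi)) = cis (real k * x)" for k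
  proof -
    have "cis (real k * (x + 2 * pi)) = cis (real k * x) * cis (2 * pi * real k)"
      by (simp add: cis_mult algebra_simps)
    also have "cis (2 * pi * real k) = 1"
      by (rule cis_multiple_2pi) auto
    finally show ?thesis by simp
  qed
  then show ?thesis by (simp add: trig_def)
qed

lemma trig_add: "trig N (\<lambda>k. u k + v k) x = trig N u x + trig N v x"
  by (simp add: trig_def inner_add_left sum.distrib)

lemma trig_diff: "trig N (\<lambda>k. u k - v k) x = trig N u x - trig N v x"
  by (simp add: trig_def inner_diff_left sum_subtractf)

lemma trig_scaleR: "trig N (\<lambda>k. c *\<^sub>R u k) x = c * trig N u x"
  by (simp add: trig_def sum_distrib_left)

lemma trig_sum: "trig N (\<lambda>k. \<Sum>i\<in>A. u i k) x = (\<Sum>i\<in>A. trig N (u i) x)"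
  by (simp add: trig_def inner_sum_left sum.swap[of _ A])

lemma trig_cong: "(\<And>k. 1 \<le> k \<Longrightarrow> k \<le> N \<Longrightarrow> u k = v k) \<Longrightarrow> trig N u x = trig N v x"
  by (simp add: trig_def)

lemma trig_extend:
  assumes "N \<le> M" "\<And>k. N < k \<Longrightarrow> k \<le> M \<Longrightarrow> u k = 0"
  shows "trig M u x = trig N u x"
  unfolding trig_def using assms by (intro sum.mono_neutral_right) auto

lemma trig_multiplier_rotate:
  "trig N (\<lambda>k. cis \<theta> * u k) x = cos \<theta> * trig N u x + sin \<theta> * trig N (\<lambda>k. \<i> * u k) x"
  by (simp add: trig_def inner_cis sum_distrib_left sum.distrib[symmetric] algebra_simps)

lemma integrable_trig [simp]: "integrable circle (trig N u)"
  by (intro integrable_circle_continuous continuous_intros)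

lemma trig_tendsto:
  assumes "\<And>k. 1 \<le> k \<Longrightarrow> k \<le> N \<Longrightarrow> (\<lambda>M. u M k) \<longlonglongrightarrow> v k"
  shows "(\<lambda>M. trig N (u M) x) \<longlonglongrightarrow> trig N v x"
  unfolding trig_def by (intro tendsto_intros) (use assms in auto)

lemma integrable_mult_continuous:
  fixes f g :: "real \<Rightarrow> real"
  assumes "integrable circle f" "continuous_on UNIV g"
  shows "integrable circle (\<lambda>x. f x * g x)"
proof -
  have "compact (g ` {0..2 * pi})"
    by (rule compact_continuous_image) (auto intro: continuous_on_subset[OF assms(2)])
  then obtain B where B: "\<And>x. x \<in> {0..2 * pi} \<Longrightarrow> \<bar>g x\<bar> \<le> B"
    by (metis bounded_iff compact_imp_bounded imageI real_norm_def)
  have [measurable]: "g \<in> borel_measurable borel"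
    using assms(2) by (rule borel_measurable_continuous_onI)
  show ?thesis
  proof (rule Bochner_Integration.integrable_bound[where f="\<lambda>x. B * f x"])
    show "integrable circle (\<lambda>x. B * f x)" using assms(1) by simp
    show "AE x in circle. norm (f x * g x) \<le> norm (B * f x)"
    proof (rule AE_I2)
      fix x assume "x \<in> space circle"
      then have "\<bar>g x\<bar> \<le> \<bar>B\<bar>" using B[of x] by auto
      then show "norm (f x * g x) \<le> norm (B * f x)"
        by (simp add: abs_mult mult.commute[of "\<bar>f x\<bar>"] mult_right_mono)
    qed
  qed (use assms(1) in measurable)
qed

lemma integral_mult_trig:
  assumes "integrable circle f"
  shows "(\<integral>x. f x * trig N u x \<partial>circle) = pi * (\<Sum>k=1..N. u k \<bullet> fcoef f k)"
proof -
  have I1: "integrable circle (\<lambda>x. f x * cos (real k * x))" for k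
    by (intro integrable_mult_continuous assms continuous_intros)
  have I2: "integrable circle (\<lambda>x. f x * sin (real k * x))" for k
    by (intro integrable_mult_continuous assms continuous_intros)
  have "(\<integral>x. f x * trig N u x \<partial>circle)
      = (\<integral>x. (\<Sum>k=1..N. Re (u k) * (f x * cos (real k * x)) + Im (u k) * (f x * sin (real k * x))) \<partial>circle)"
    by (simp add: trig_def inner_cis sum_distrib_left algebra_simps)
  also have "\<dots> = (\<Sum>k=1..N. Re (u k) * (\<integral>x. f x * cos (real k * x) \<partial>circle)
       + Im (u k) * (\<integral>x. f x * sin (real k * x) \<partial>circle))"
    by (subst Bochner_Integration.integral_sum) (simp_all add: I1 I2)
  also have "\<dots> = pi * (\<Sum>k=1..N. u k \<bullet> fcoef f k)"
    unfolding sum_distrib_left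
    by (intro sum.cong refl)
       (simp add: fcoef_def inner_complex_def fourier_cos_def fourier_sin_def distrib_left)
  finally show ?thesis .
qed

lemma integral_inner_cis_mult:
  assumes "1 \<le> j" "1 \<le> k"
  shows "(\<integral>x. (u \<bullet> cis (real j * x)) * (v \<bullet> cis (real k * x)) \<partial>circle) = (if j = k then pi * (u \<bullet> v) else 0)"
proof -
  have C: "integrable circle (\<lambda>x. cos (of_int m * x + c))" for m c
    by (intro integrable_circle_continuous continuous_intros)
  define A where "A = (Re u * Re v - Im u * Im v) / 2"
  define B where "B = (Re u * Im v + Im u * Re v) / 2"
  define D where "D = (Re u * Re v + Im u * Im v) / 2"
  define E where "E = (Im u * Re v - Re u * Im v) / 2"
  let ?p = "int j + int k" and ?m = "int j - int k"
  have eq: "(u \<bullet> cis (real j * x)) * (v \<bullet> cis (real k * x))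
     = A * cos (of_int ?p * x + 0) - B * cos (of_int ?p * x + pi/2)
       + D * cos (of_int ?m * x + 0) - E * cos (of_int ?m * x + pi/2)" for x
  proof -
    have 1: "of_int ?p * x + 0 = real j * x + real k * x" "of_int ?m * x + 0 = real j * x - real k * x"
       "of_int ?p * x + pi/2 = (real j * x + real k * x) + pi/2" "of_int ?m * x + pi/2 = (real j * x - real k * x) + pi/2"
      by (simp_all add: algebra_simps)
    have 2: "cos (t + pi/2) = - sin t" for t :: real by (simp add: cos_add)
    show ?thesis
      unfolding 1 2 A_def B_def D_def E_def by (simp add: inner_cis cos_add sin_add cos_diff sin_diff field_simps)
  qed
  have "(\<integral>x. (u \<bullet> cis (real j * x)) * (v \<bullet> cis (real k * x)) \<partial>circle)
     = A * (\<integral>x. cos (of_int ?p * x + 0) \<partial>circle) - B * (\<integral>x. cos (of_int ?p * x + pi/2) \<partial>circle)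
       + D * (\<integral>x. cos (of_int ?m * x + 0) \<partial>circle) - E * (\<integral>x. cos (of_int ?m * x + pi/2) \<partial>circle)"
    unfolding eq using C by (simp del: of_int_add of_int_diff add_0_right)
  also have "\<dots> = D * (\<integral>x. cos (of_int ?m * x + 0) \<partial>circle) - E * (\<integral>x. cos (of_int ?m * x + pi/2) \<partial>circle)"
    using assms by (subst (1 2) integral_circle_cos) auto
  also have "\<dots> = (if j = k then pi * (u \<bullet> v) else 0)"
  proof (cases "j = k")
    case True
    then show ?thesis by (simp add: D_def inner_complex_def)
  next
    case False
    then show ?thesis by (subst (1 2) integral_circle_cos) auto
  qed
  finally show ?thesis .
qed

lemma integral_trig_mult:
  "(\<integral>x. trig N u x * trig N v x \<partial>circle) = pi * (\<Sum>k=1..N. u k \<bullet> v k)"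
proof -
  have I: "integrable circle (\<lambda>x. (u j \<bullet> cis (real j * x)) * (v k \<bullet> cis (real k * x)))" for j k
    by (intro integrable_circle_continuous continuous_intros)
  have "(\<integral>x. trig N u x * trig N v x \<partial>circle)
      = (\<integral>x. (\<Sum>j=1..N. \<Sum>k=1..N. (u j \<bullet> cis (real j * x)) * (v k \<bullet> cis (real k * x))) \<partial>circle)"
    by (simp add: trig_def sum_product)
  also have "\<dots> = (\<Sum>j=1..N. \<Sum>k=1..N. (\<integral>x. (u j \<bullet> cis (real j * x)) * (v k \<bullet> cis (real k * x)) \<partial>circle))"
    by (simp only: Bochner_Integration.integral_sum I Bochner_Integration.integrable_sum)
  also have "\<dots> = (\<Sum>j=1..N. \<Sum>k=1..N. if j = k then pi * (u j \<bullet> v k) else 0)"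
    by (intro sum.cong refl) (simp add: integral_inner_cis_mult)
  also have "\<dots> = pi * (\<Sum>k=1..N. u k \<bullet> v k)"
    by (simp add: sum_distrib_left)
  finally show ?thesis .
qed

lemma fcoef_trig: "1 \<le> k \<Longrightarrow> k \<le> N \<Longrightarrow> fcoef (trig N u) k = u k"
proof -
  assume k: "1 \<le> k" "k \<le> N"
  have *: "v \<bullet> fcoef (trig N u) k = v \<bullet> u k" for v
  proof -
    define w where "w j = (if j = k then v else 0)" for j
    have w: "w j \<bullet> z = (if j = k then v \<bullet> z else 0)" for j z by (simp add: w_def)
    have "pi * (\<Sum>j=1..N. w j \<bullet> fcoef (trig N u) j) = pi * (\<Sum>j=1..N. u j \<bullet> w j)"
      unfolding integral_mult_trig[OF integrable_trig, symmetric] integral_trig_mult[symmetric] ..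
    then have "(\<Sum>j=1..N. w j \<bullet> fcoef (trig N u) j) = (\<Sum>j=1..N. w j \<bullet> u j)"
      by (simp add: inner_commute)
    then show ?thesis unfolding w using k by simp
  qed
  show "fcoef (trig N u) k = u k"
    using *[of "fcoef (trig N u) k - u k"] by (metis inner_diff_right inner_eq_zero_iff right_minus_eq)
qed

lemma fcoef_trig': "1 \<le> k \<Longrightarrow> fcoef (trig N u) k = (if k \<le> N then u k else 0)"
proof -
  assume k: "1 \<le> k"
  define v where "v j = (if j \<le> N then u j else 0)" for j
  have "trig N u = trig (N + k) v"
  proof
    fix x
    have "trig (N + k) v x = trig N v x" by (rule trig_extend) (auto simp: v_def)
    also have "\<dots> = trig N u x" by (rule trig_cong) (auto simp: v_def)
    finally show "trig N u x = trig (N + k) v x" ..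
  qed
  then show ?thesis using fcoef_trig[of k "N + k" v] k by (simp add: v_def)
qed

lemma integral_trig [simp]: "(\<integral>x. trig N u x \<partial>circle) = 0"
proof -
  have 1: "(\<integral>x. cos (real k * x) \<partial>circle) = 0" if "1 \<le> k" for k
    using integral_circle_cos[of "int k" 0] that by simp
  have 2: "(\<integral>x. sin (real k * x) \<partial>circle) = 0" if "1 \<le> k" for k
    using integral_circle_cos[of "int k" "-pi/2"] that by (simp add: cos_diff cos_add)
  have I1: "integrable circle (\<lambda>x. cos (real k * x))" for k
    by (intro integrable_circle_continuous continuous_intros)
  have I2: "integrable circle (\<lambda>x. sin (real k * x))" for k
    by (intro integrable_circle_continuous continuous_intros)
  show ?thesis
    unfolding trig_def inner_cis
    by (subst Bochner_Integration.integral_sum) (auto simp: I1 I2 1 2)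
qed

lemma fourier_cos_0: "fourier_cos f 0 = (\<integral>x. f x \<partial>circle) / pi"
  by (simp add: fourier_cos_def)

lemma fourier_cos_trig_0 [simp]: "fourier_cos (trig N u) 0 = 0"
  by (simp add: fourier_cos_0)

lemma fcoef_diff:
  assumes "integrable circle f" "integrable circle g"
  shows "fcoef (\<lambda>x. f x - g x) k = fcoef f k - fcoef g k"
proof -
  have "integrable circle (\<lambda>x. f x * cos (real k * x))" "integrable circle (\<lambda>x. f x * sin (real k * x))"
    "integrable circle (\<lambda>x. g x * cos (real k * x))" "integrable circle (\<lambda>x. g x * sin (real k * x))"
    by (intro integrable_mult_continuous assms continuous_intros)+
  then show ?thesis
    by (simp add: fcoef_def fourier_cos_def fourier_sin_def complex_eq_iff left_diff_distrib right_diff_distrib)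
qed

section \<open>Fejer means\<close>

text \<open>
  The kernel is given as \<open>\<bar>\<Sum>k<N. cis (k x)\<bar>\<^sup>2 / N\<close>, which makes it nonnegative and at most \<open>N\<close>. Its
  expansion into cosines (\<open>fejer_expand\<close>) identifies the convolution with a weighted partial sum of
  the Fourier series, with weights \<open>max 0 (1 - k/N)\<close>.
\<close>

definition fejer :: "nat \<Rightarrow> real \<Rightarrow> real" where
  "fejer N x = ((\<Sum>k<N. cos (real k * x))\<^sup>2 + (\<Sum>k<N. sin (real k * x))\<^sup>2) / real N"

definition cesaro_weight :: "nat \<Rightarrow> nat \<Rightarrow> real" where
  "cesaro_weight N k = max 0 (1 - real k / real N)"

definition cesaro :: "nat \<Rightarrow> (real \<Rightarrow> real) \<Rightarrow> real \<Rightarrow> real" where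
  "cesaro N f x = (\<integral>t. f t * fejer N (x - t) \<partial>circle) / (2 * pi)"

lemma fejer_nonneg: "0 \<le> fejer N x"
  by (simp add: fejer_def)

lemma fejer_le: "fejer N x \<le> real N"
proof (cases "N = 0")
  case False
  have *: "(\<Sum>k<N. cos (real k * x))\<^sup>2 \<le> real N * (\<Sum>k<N. (cos (real k * x))\<^sup>2)"
          "(\<Sum>k<N. sin (real k * x))\<^sup>2 \<le> real N * (\<Sum>k<N. (sin (real k * x))\<^sup>2)"
    using Cauchy_Schwarz_ineq_sum[of "\<lambda>_. 1" "\<lambda>k. cos (real k * x)" "{..<N}"]
          Cauchy_Schwarz_ineq_sum[of "\<lambda>_. 1" "\<lambda>k. sin (real k * x)" "{..<N}"] by simp_all
  have "(\<Sum>k<N. (cos (real k * x))\<^sup>2) + (\<Sum>k<N. (sin (real k * x))\<^sup>2) = (\<Sum>k<N. 1)"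
    unfolding sum.distrib[symmetric] by (intro sum.cong) auto
  then have "real N * (\<Sum>k<N. (cos (real k * x))\<^sup>2) + real N * (\<Sum>k<N. (sin (real k * x))\<^sup>2) = real N * real N"
    by (simp add: distrib_left[symmetric])
  then show ?thesis using * False by (simp add: fejer_def field_simps)
qed (simp add: fejer_def)

lemma continuous_fejer [continuous_intros]:
  fixes g :: "real \<Rightarrow> real"
  shows "continuous_on A g \<Longrightarrow> continuous_on A (\<lambda>x. fejer N (g x))"
  unfolding fejer_def divide_inverse by (intro continuous_intros)

lemma fejer_measurable [measurable]: "fejer N \<in> borel_measurable borel"
  by (rule borel_measurable_continuous_onI) (intro continuous_intros)

lemma fejer_minus: "fejer N (x - y) = fejer N (y - x)"
proof -
  have "fejer N (- z) = fejer N z" for z by (simp add: fejer_def sum_negf)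
  from this[of "y - x"] show ?thesis by simp
qed

lemma fejer_expand_aux:
  "(\<Sum>k<N. cos (real k * x))\<^sup>2 + (\<Sum>k<N. sin (real k * x))\<^sup>2
     = real N + 2 * (\<Sum>k=1..<N. (real N - real k) * cos (real k * x))"
proof (induction N)
  case (Suc N)
  define c s where "c = cos (real N * x)" and "s = sin (real N * x)"
  let ?C = "\<Sum>k<N. cos (real k * x)" and ?S = "\<Sum>k<N. sin (real k * x)"
  have "c * ?C + s * ?S = (\<Sum>k<N. cos (real (N - k) * x))"
    unfolding sum_distrib_left sum.distrib[symmetric]
    by (intro sum.cong refl) (simp add: c_def s_def of_nat_diff left_diff_distrib cos_diff)
  also have "\<dots> = (\<Sum>k=1..N. cos (real k * x))"
    by (rule sum.reindex_bij_witness[of _ "\<lambda>k. N - k" "\<lambda>k. N - k"]) auto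
  finally have cs: "c * ?C + s * ?S = (\<Sum>k=1..N. cos (real k * x))" .
  have "(?C + c)\<^sup>2 + (?S + s)\<^sup>2 = (?C\<^sup>2 + ?S\<^sup>2) + 2 * (c * ?C + s * ?S) + 1"
  proof -
    have "c\<^sup>2 + s\<^sup>2 = 1" by (simp add: c_def s_def)
    then show ?thesis by (simp add: power2_eq_square algebra_simps)
  qed
  also have "\<dots> = real (Suc N) + 2 * ((\<Sum>k=1..<N. (real N - real k) * cos (real k * x)) + (\<Sum>k=1..N. cos (real k * x)))"
    unfolding Suc cs by simp
  also have "(\<Sum>k=1..<N. (real N - real k) * cos (real k * x)) = (\<Sum>k=1..N. (real N - real k) * cos (real k * x))"
    by (rule sum.mono_neutral_left) auto
  also have "\<dots> + (\<Sum>k=1..N. cos (real k * x)) = (\<Sum>k=1..N. (real (Suc N) - real k) * cos (real k * x))"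
    unfolding sum.distrib[symmetric] by (intro sum.cong) (auto simp: algebra_simps)
  finally show ?case by (simp add: c_def s_def atLeastLessThanSuc_atLeastAtMost)
qed simp

lemma cesaro_weight_bounds: "0 \<le> cesaro_weight N k" "cesaro_weight N k \<le> 1"
  by (auto simp: cesaro_weight_def)

lemma cesaro_weight_tendsto: "(\<lambda>N. cesaro_weight N k) \<longlonglongrightarrow> 1"
proof -
  have "(\<lambda>N. max 0 (1 - real k * (1 / real N))) \<longlonglongrightarrow> max 0 (1 - real k * 0)"
    by (intro tendsto_intros lim_1_over_n)
  then show ?thesis by (simp add: cesaro_weight_def)
qed

lemma fejer_expand:
  assumes "0 < N" "N \<le> K"
  shows "fejer N x = 1 + 2 * (\<Sum>k=1..K. cesaro_weight N k * cos (real k * x))"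
proof -
  have "(\<Sum>k=1..K. cesaro_weight N k * cos (real k * x)) = (\<Sum>k=1..<N. cesaro_weight N k * cos (real k * x))"
    by (rule sum.mono_neutral_right) (use assms in \<open>auto simp: cesaro_weight_def max_def field_simps\<close>)
  also have "\<dots> = (\<Sum>k=1..<N. (real N - real k) * cos (real k * x)) / real N"
    unfolding sum_divide_distrib
    by (intro sum.cong refl) (use assms in \<open>auto simp: cesaro_weight_def max_def field_simps\<close>)
  finally show ?thesis
    unfolding fejer_def fejer_expand_aux using assms by (simp add: field_simps)
qed

lemma fejer_expand_trig:
  assumes "0 < N" "N \<le> K"
  shows "fejer N (x - t) = 1 + 2 * trig K (\<lambda>k. cesaro_weight N k *\<^sub>R cis (real k * x)) t"
  unfolding fejer_expand[OF assms] trig_def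
  by (simp add: inner_cis cos_diff sin_diff algebra_simps)

lemma cesaro_eq_trig:
  assumes f: "integrable circle f" and N: "0 < N" "N \<le> K"
  shows "cesaro N f x = fourier_cos f 0 / 2 + trig K (\<lambda>k. cesaro_weight N k *\<^sub>R fcoef f k) x"
proof -
  let ?u = "\<lambda>k. cesaro_weight N k *\<^sub>R cis (real k * x)"
  have "integrable circle (\<lambda>t. f t * trig K ?u t)"
    by (intro integrable_mult_continuous f continuous_intros)
  then have "(\<integral>t. f t * fejer N (x - t) \<partial>circle)
      = (\<integral>t. f t \<partial>circle) + 2 * (\<integral>t. f t * trig K ?u t \<partial>circle)"
    unfolding fejer_expand_trig[OF N] using f by (simp add: distrib_left mult.left_commute[of _ 2])
  also have "\<dots> = pi * fourier_cos f 0 + 2 * pi * trig K (\<lambda>k. cesaro_weight N k *\<^sub>R fcoef f k) x"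
    unfolding integral_mult_trig[OF f] by (simp add: fourier_cos_0 trig_def inner_commute)
  finally show ?thesis by (simp add: cesaro_def field_simps)
qed

lemma cesaro_measurable [measurable]:
  assumes "integrable circle f"
  shows "cesaro N f \<in> borel_measurable borel"
proof (cases "N = 0")
  case False
  then have "cesaro N f = (\<lambda>x. fourier_cos f 0 / 2 + trig N (\<lambda>k. cesaro_weight N k *\<^sub>R fcoef f k) x)"
    using cesaro_eq_trig[OF assms, of N N] by auto
  then show ?thesis by simp
qed (simp add: cesaro_def[abs_def] fejer_def)

lemma continuous_cesaro:
  assumes "integrable circle f"
  shows "continuous_on UNIV (cesaro N f)"
proof (cases "N = 0")
  case False
  then have "cesaro N f = (\<lambda>x. fourier_cos f 0 / 2 + trig N (\<lambda>k. cesaro_weight N k *\<^sub>R fcoef f k) x)"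
    using cesaro_eq_trig[OF assms, of N N] by auto
  then show ?thesis by (auto intro!: continuous_intros)
qed (simp add: cesaro_def[abs_def] fejer_def)

lemma integrable_cesaro [simp]: "integrable circle f \<Longrightarrow> integrable circle (cesaro N f)"
  by (rule integrable_circle_continuous[OF continuous_cesaro])

lemma integral_cesaro:
  assumes "integrable circle f" "0 < N"
  shows "(\<integral>x. cesaro N f x \<partial>circle) = (\<integral>x. f x \<partial>circle)"
  using assms by (simp add: cesaro_eq_trig[OF assms(1,2) order_refl] fourier_cos_0)

lemma integral_fejer:
  assumes "0 < N"
  shows "(\<integral>t. fejer N (x - t) \<partial>circle) = 2 * pi"
  by (simp add: fejer_expand_trig[OF assms order_refl])

lemma integrable_mult_fejer:
  "integrable circle f \<Longrightarrow> integrable circle (\<lambda>t. f t * fejer N (x - t))"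
  by (intro integrable_mult_continuous continuous_intros)

lemma cesaro_const: "0 < N \<Longrightarrow> cesaro N (\<lambda>_. c) x = c"
  by (simp add: cesaro_def integral_fejer)

lemma cesaro_add:
  "integrable circle f \<Longrightarrow> integrable circle g \<Longrightarrow> cesaro N (\<lambda>x. f x + g x) x = cesaro N f x + cesaro N g x"
  by (simp add: cesaro_def distrib_right integrable_mult_fejer add_divide_distrib)

lemma cesaro_cmult: "cesaro N (\<lambda>x. c * f x) x = c * cesaro N f x"
  by (simp add: cesaro_def mult.assoc)

lemma cesaro_diff:
  "integrable circle f \<Longrightarrow> integrable circle g \<Longrightarrow> cesaro N (\<lambda>x. f x - g x) x = cesaro N f x - cesaro N g x"
  by (simp add: cesaro_def left_diff_distrib integrable_mult_fejer diff_divide_distrib)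

lemma cesaro_mono:
  assumes "integrable circle f" "integrable circle g" "\<And>x. x \<in> {0..2 * pi} \<Longrightarrow> f x \<le> g x"
  shows "cesaro N f x \<le> cesaro N g x"
  unfolding cesaro_def
  by (intro divide_right_mono integral_mono integrable_mult_fejer assms mult_right_mono)
     (use assms(3) in \<open>auto simp: fejer_nonneg\<close>)

lemma abs_cesaro_le:
  assumes "integrable circle f"
  shows "\<bar>cesaro N f x\<bar> \<le> cesaro N (\<lambda>x. \<bar>f x\<bar>) x"
proof -
  have "cesaro N f x \<le> cesaro N (\<lambda>x. \<bar>f x\<bar>) x" by (rule cesaro_mono) (use assms in auto)
  moreover have "(-1) * cesaro N f x \<le> cesaro N (\<lambda>x. \<bar>f x\<bar>) x"
    unfolding cesaro_cmult[symmetric] by (rule cesaro_mono) (use assms in auto)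
  ultimately show ?thesis by simp
qed

lemma cesaro_nonneg: "(\<And>x. 0 \<le> f x) \<Longrightarrow> 0 \<le> cesaro N f x"
  unfolding cesaro_def by (intro divide_nonneg_nonneg Bochner_Integration.integral_nonneg mult_nonneg_nonneg) (auto simp: fejer_nonneg)

section \<open>Power means\<close>

text \<open>
  The tangent of the convex function \<open>s \<mapsto> s\<^sup>p\<close> at \<open>A\<close>. Averaging it with \<open>A\<close> the mean value of \<open>s\<close>
  is Jensen's inequality, both for the Fejer kernel and for finite sums.
\<close>

lemma powr_tangent:
  fixes s A p :: real
  assumes "0 \<le> s" "0 \<le> A" "1 < p"
  shows "A powr p + p * A powr (p - 1) * (s - A) \<le> s powr p"
proof (cases "A = 0")
  case False
  then have A: "0 < A" using assms by simp
  have "p * A powr (p - 1) * (s - A) \<le> s powr p - A powr p" if "0 < s"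
  proof -
    have "((\<lambda>x. x powr p) has_real_derivative p * A powr (p - 1)) (at A)"
      using A has_real_derivative_powr by blast
    then have "((\<lambda>x. x powr p) has_real_derivative p * A powr (p - 1)) (at A within {0<..})"
      by (rule DERIV_subset) simp
    then show ?thesis
      using assms(3) A that
      by (intro convex_on_imp_above_tangent[OF powr_convex[of p]]) (auto simp: interior_open connected_Ioi)
  qed
  moreover have "A powr p + p * A powr (p - 1) * (0 - A) \<le> 0"
  proof -
    have "A powr (p - 1) * A = A powr p" using A powr_mult_base[of A "p - 1"] by (simp add: mult.commute)
    then have "A powr p + p * A powr (p - 1) * (0 - A) = (1 - p) * A powr p" by (simp add: algebra_simps)
    then show ?thesis using assms by (simp add: mult_nonpos_nonneg)
  qed
  ultimately show ?thesis using assms by (cases "s = 0") auto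
qed (use assms in simp)

lemma integrable_of_powr:
  fixes f :: "real \<Rightarrow> real"
  assumes [measurable]: "f \<in> borel_measurable circle" and "1 \<le> p"
    and "integrable circle (\<lambda>x. \<bar>f x\<bar> powr p)"
  shows "integrable circle f"
proof (rule Bochner_Integration.integrable_bound[where f="\<lambda>x. 1 + \<bar>f x\<bar> powr p"])
  show "integrable circle (\<lambda>x. 1 + \<bar>f x\<bar> powr p)" using assms(3) by simp
  have "\<bar>f x\<bar> \<le> 1 + \<bar>f x\<bar> powr p" for x
  proof (cases "\<bar>f x\<bar> \<le> 1")
    case False
    then have "\<bar>f x\<bar> powr 1 \<le> \<bar>f x\<bar> powr p" using assms by (intro powr_mono) auto
    then show ?thesis by simp
  qed (auto intro: order_trans[of _ 1])
  then show "AE x in circle. norm (f x) \<le> norm (1 + \<bar>f x\<bar> powr p)" by auto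
qed (use assms in auto)

lemma cesaro_jensen:
  assumes p: "1 < p" and N: "0 < N"
    and u: "\<And>x. 0 \<le> u x" "integrable circle u" "integrable circle (\<lambda>x. u x powr p)"
  shows "(cesaro N u x) powr p \<le> cesaro N (\<lambda>x. u x powr p) x"
proof -
  define A where "A = cesaro N u x"
  have A: "0 \<le> A" unfolding A_def using u by (intro cesaro_nonneg)
  have "A powr p = cesaro N (\<lambda>s. (A powr p - p * A powr (p - 1) * A) + p * A powr (p - 1) * u s) x"
    using u N by (simp add: cesaro_add cesaro_const cesaro_cmult A_def)
  also have "\<dots> \<le> cesaro N (\<lambda>x. u x powr p) x"
  proof (rule cesaro_mono)
    fix s
    show "A powr p - p * A powr (p - 1) * A + p * A powr (p - 1) * u s \<le> u s powr p"
      using powr_tangent[OF u(1) A p, of s] by (simp add: right_diff_distrib)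
  qed (use u in simp_all)
  finally show ?thesis by (simp add: A_def)
qed

text \<open>
  By Jensen's inequality, as the kernel is nonnegative with mean value 1 in both variables.
\<close>

lemma cesaro_powr_contraction:
  assumes p: "1 < p" and N: "0 < N"
    and f: "f \<in> borel_measurable circle" "integrable circle (\<lambda>x. \<bar>f x\<bar> powr p)"
  shows "pint p (cesaro N f) \<le> pint p f"
proof -
  have If: "integrable circle f" using integrable_of_powr[OF f(1) _ f(2)] p by simp
  have "pint p (cesaro N f) \<le> (\<integral>x. cesaro N (\<lambda>x. \<bar>f x\<bar> powr p) x \<partial>circle)"
  proof (rule integral_mono)
    have "continuous_on UNIV (\<lambda>x. \<bar>cesaro N f x\<bar> powr p)"
      using p by (intro continuous_on_powr' continuous_intros continuous_cesaro If) auto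
    then show "integrable circle (\<lambda>x. \<bar>cesaro N f x\<bar> powr p)"
      by (rule integrable_circle_continuous)
    show "integrable circle (cesaro N (\<lambda>x. \<bar>f x\<bar> powr p))"
      by (rule integrable_cesaro[OF f(2)])
    fix x
    have "\<bar>cesaro N f x\<bar> powr p \<le> (cesaro N (\<lambda>x. \<bar>f x\<bar>) x) powr p"
      using p by (intro powr_mono2 abs_cesaro_le If) auto
    also have "\<dots> \<le> cesaro N (\<lambda>x. \<bar>f x\<bar> powr p) x"
      using If f by (intro cesaro_jensen p N) auto
    finally show "\<bar>cesaro N f x\<bar> powr p \<le> cesaro N (\<lambda>x. \<bar>f x\<bar> powr p) x" .
  qed
  also have "\<dots> = pint p f"
    by (intro integral_cesaro f N)
  finally show ?thesis .
qed

text \<open>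
  By Fatou's lemma. It serves to remove the auxiliary Fejer means of high order, and the truncation of
  infinite combinations of Fejer means, from the estimates.
\<close>

lemma integral_powr_limit:
  fixes g :: "real \<Rightarrow> real"
  assumes meas: "\<And>M. h M \<in> borel_measurable circle" "g \<in> borel_measurable circle"
    and int: "\<And>M. integrable circle (\<lambda>x. \<bar>h M x\<bar> powr p)"
    and lim: "AE x in circle. (\<lambda>M. h M x) \<longlonglongrightarrow> g x"
    and bound: "\<forall>\<^sub>F M in sequentially. pint p (h M) \<le> B" and "0 < p" "0 \<le> B"
  shows "integrable circle (\<lambda>x. \<bar>g x\<bar> powr p)" "pint p g \<le> B"
proof -
  note [measurable] = meas
  have "(\<integral>\<^sup>+x. ennreal (\<bar>g x\<bar> powr p) \<partial>circle) = (\<integral>\<^sup>+x. liminf (\<lambda>M. ennreal (\<bar>h M x\<bar> powr p)) \<partial>circle)"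
  proof (rule nn_integral_cong_AE)
    show "AE x in circle. ennreal (\<bar>g x\<bar> powr p) = liminf (\<lambda>M. ennreal (\<bar>h M x\<bar> powr p))"
      using lim
    proof (eventually_elim)
      fix x assume "(\<lambda>M. h M x) \<longlonglongrightarrow> g x"
      then have "(\<lambda>M. ennreal (\<bar>h M x\<bar> powr p)) \<longlonglongrightarrow> ennreal (\<bar>g x\<bar> powr p)"
        using \<open>0 < p\<close> by (intro tendsto_ennrealI tendsto_powr' tendsto_intros) auto
      then show "ennreal (\<bar>g x\<bar> powr p) = liminf (\<lambda>M. ennreal (\<bar>h M x\<bar> powr p))"
        by (intro lim_imp_Liminf[symmetric]) simp_all
    qed
  qed
  also have "\<dots> \<le> liminf (\<lambda>M. \<integral>\<^sup>+x. ennreal (\<bar>h M x\<bar> powr p) \<partial>circle)"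
    by (rule nn_integral_liminf) simp
  also have "\<dots> \<le> ennreal B"
  proof (rule Liminf_le)
    show "\<forall>\<^sub>F M in sequentially. (\<integral>\<^sup>+x. ennreal (\<bar>h M x\<bar> powr p) \<partial>circle) \<le> ennreal B"
      using bound
    proof eventually_elim
      case (elim M)
      then show ?case using int by (subst nn_integral_eq_integral) (auto intro: ennreal_leI)
    qed
  qed simp
  finally have *: "(\<integral>\<^sup>+x. ennreal (\<bar>g x\<bar> powr p) \<partial>circle) \<le> ennreal B" .
  show I: "integrable circle (\<lambda>x. \<bar>g x\<bar> powr p)"
    by (rule integrableI_bounded) (use * in \<open>auto intro: le_less_trans[OF _ ennreal_less_top]\<close>)
  show "pint p g \<le> B"
    using * I \<open>0 \<le> B\<close> by (subst (asm) nn_integral_eq_integral) auto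
qed

section \<open>Convergence of Fejer means in \<open>L\<^sub>1\<close>\<close>

text \<open>
  The geometric sum for the Dirichlet kernel; it shows that \<open>fejer N\<close> is of order \<open>1/N\<close> away from the
  multiples of \<open>2\<pi>\<close>.
\<close>

lemma fejer_telescope: "real N * (fejer N x * (1 - cos x)) = 1 - cos (real N * x)"
proof -
  have *: "((\<Sum>k<N. cos (real k * x))\<^sup>2 + (\<Sum>k<N. sin (real k * x))\<^sup>2) * (1 - cos x) = 1 - cos (real N * x)"
  proof -
    have z: "cis (real k * x) = cis x ^ k" for k by (rule Complex.DeMoivre[symmetric])
    have "(\<Sum>k<N. cis x ^ k) * (1 - cis x) = 1 - cis x ^ N"
      by (metis one_diff_power_eq mult.commute)
    then have "(norm (\<Sum>k<N. cis (real k * x)))\<^sup>2 * (norm (1 - cis x))\<^sup>2 = (norm (1 - cis (real N * x)))\<^sup>2"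
      unfolding z by (metis norm_mult power_mult_distrib)
    moreover have n: "(norm (1 - cis y))\<^sup>2 = 2 * (1 - cos y)" for y
    proof -
      have "(norm (1 - cis y))\<^sup>2 = 1 - 2 * cos y + ((cos y)\<^sup>2 + (sin y)\<^sup>2)"
        by (simp add: cmod_power2 power2_diff)
      then show ?thesis by simp
    qed
    moreover have "(norm (\<Sum>k<N. cis (real k * x)))\<^sup>2 = (\<Sum>k<N. cos (real k * x))\<^sup>2 + (\<Sum>k<N. sin (real k * x))\<^sup>2"
      by (simp add: cmod_power2)
    ultimately show ?thesis by (simp add: algebra_simps)
  qed
  show ?thesis
    by (cases "N = 0") (simp_all add: fejer_def *[symmetric])
qed

lemma cesaro_tendsto_locally_constant:
  fixes f :: "real \<Rightarrow> real"
  assumes x: "0 < x" "x < 2 * pi" and [measurable]: "f \<in> borel_measurable circle"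
    and b: "\<And>t. \<bar>f t\<bar> \<le> 1" and d: "0 < d" "\<And>t. \<bar>t - x\<bar> < d \<Longrightarrow> f t = f x"
  shows "(\<lambda>N. cesaro N f x) \<longlonglongrightarrow> f x"
proof -
  have If: "integrable circle f" by (rule integrable_circle_bounded[OF _ b]) simp
  \<comment> \<open>For \<open>t\<close> in one period with \<open>e \<le> \<bar>t - x\<bar>\<close> also \<open>\<bar>t - x\<bar> \<le> 2\<pi> - e\<close>, so \<open>cos (x - t) \<le> cos e\<close>.\<close>
  define e where "e = min d (min pi (min x (2 * pi - x)))"
  have e: "0 < e" "e \<le> pi" "e \<le> d" "e \<le> x" "e \<le> 2 * pi - x" using x d pi_gt_zero by (auto simp: e_def)
  define K where "K = 1 - cos e"
  have K: "0 < K" unfolding K_def using cos_monotone_0_pi[of 0 e] e by simp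
  have far: "fejer N (x - t) \<le> 2 / (real N * K)" if "0 < N" "t \<in> {0..2 * pi}" "e \<le> \<bar>t - x\<bar>" for N t
  proof -
    have "cos (x - t) \<le> cos e"
    proof -
      define s where "s = \<bar>t - x\<bar>"
      have s: "e \<le> s" "s \<le> 2 * pi - e" using that x e by (auto simp: s_def)
      have "cos (x - t) = cos s" unfolding s_def by (metis abs_minus_commute cos_abs_real)
      also have "\<dots> \<le> cos e"
      proof (cases "s \<le> pi")
        case True then show ?thesis using s e by (intro cos_monotone_0_pi_le) auto
      next
        case False
        have "cos s = cos (2 * pi - s)" by (simp add: cos_diff)
        also have "\<dots> \<le> cos e" using s e False by (intro cos_monotone_0_pi_le) auto
        finally show ?thesis .
      qed
      finally show ?thesis .
    qed
    then have "fejer N (x - t) * K \<le> fejer N (x - t) * (1 - cos (x - t))"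
      unfolding K_def by (intro mult_left_mono) (auto simp: fejer_nonneg)
    then have "real N * (fejer N (x - t) * K) \<le> 1 - cos (real N * (x - t))"
      unfolding fejer_telescope[symmetric] by (rule mult_left_mono) simp
    also have "\<dots> \<le> 2" using cos_ge_minus_one[of "real N * (x - t)"] by linarith
    finally show ?thesis using that K by (simp add: field_simps)
  qed
  have est: "\<bar>cesaro N f x - f x\<bar> \<le> 4 / (real N * K)" if N: "0 < N" for N
  proof -
    have "cesaro N f x - f x = (\<integral>t. (f t - f x) * fejer N (x - t) \<partial>circle) / (2 * pi)"
      using cesaro_diff[OF If, of "\<lambda>_. f x" N x] cesaro_const[OF N, of "f x" x] by (simp add: cesaro_def)
    also have "\<bar>\<dots>\<bar> \<le> (\<integral>t. 4 / (real N * K) \<partial>circle) / (2 * pi)"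
    proof -
      have "norm (\<integral>t. (f t - f x) * fejer N (x - t) \<partial>circle) \<le> (\<integral>t. 4 / (real N * K) \<partial>circle)"
      proof (rule Bochner_Integration.integral_norm_bound_integral)
        show "integrable circle (\<lambda>t. (f t - f x) * fejer N (x - t))"
          by (intro integrable_mult_fejer) (use If in simp)
        fix t assume t: "t \<in> space circle"
        show "norm ((f t - f x) * fejer N (x - t)) \<le> 4 / (real N * K)"
        proof (cases "\<bar>t - x\<bar> < d")
          case True
          then show ?thesis using d(2)[OF True] K by simp
        next
          case False
          then have "fejer N (x - t) \<le> 2 / (real N * K)" using far N t e by auto
          moreover have "\<bar>f t - f x\<bar> \<le> 2" using b[of t] b[of x] by linarith
          ultimately have "\<bar>f t - f x\<bar> * fejer N (x - t) \<le> 2 * (2 / (real N * K))"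
            by (intro mult_mono) (auto simp: fejer_nonneg)
          then show ?thesis by (simp add: abs_mult fejer_nonneg)
        qed
      qed auto
      from divide_right_mono[OF this, of "2 * pi"] show ?thesis by simp
    qed
    also have "\<dots> = 4 / (real N * K)" by simp
    finally show ?thesis .
  qed
  show ?thesis
  proof (rule LIM_zero_cancel, rule Lim_null_comparison)
    show "\<forall>\<^sub>F N in sequentially. norm (cesaro N f x - f x) \<le> (4 / K) * (1 / real N)"
      using eventually_gt_at_top[of 0] by eventually_elim (use est in \<open>auto simp: field_simps\<close>)
    show "(\<lambda>N. (4 / K) * (1 / real N)) \<longlonglongrightarrow> 0"
      by (rule tendsto_mult_right_zero) (rule lim_1_over_n)
  qed
qed

definition cesaro_L1 :: "(real \<Rightarrow> real) \<Rightarrow> bool" where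
  "cesaro_L1 f \<longleftrightarrow> integrable circle f \<and> (\<lambda>N. \<integral>x. \<bar>cesaro N f x - f x\<bar> \<partial>circle) \<longlonglongrightarrow> 0"

lemma cesaro_L1_contraction:
  assumes "integrable circle f" "0 < N"
  shows "(\<integral>x. \<bar>cesaro N f x\<bar> \<partial>circle) \<le> (\<integral>x. \<bar>f x\<bar> \<partial>circle)"
proof -
  have "(\<integral>x. \<bar>cesaro N f x\<bar> \<partial>circle) \<le> (\<integral>x. cesaro N (\<lambda>x. \<bar>f x\<bar>) x \<partial>circle)"
    using assms by (intro integral_mono abs_cesaro_le) auto
  then show ?thesis using assms by (simp add: integral_cesaro)
qed

text \<open>
  Fejer means are contractions of \<open>L\<^sub>1\<close>, so an approximation of \<open>f\<close> by \<open>g\<close> is also one of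
  \<open>cesaro N f\<close> by \<open>cesaro N g\<close>, uniformly in \<open>N\<close>.
\<close>

lemma cesaro_L1_approx:
  assumes f: "integrable circle f"
    and approx: "\<And>e. 0 < e \<Longrightarrow> \<exists>g. cesaro_L1 g \<and> (\<integral>x. \<bar>f x - g x\<bar> \<partial>circle) \<le> e"
  shows "cesaro_L1 f"
  unfolding cesaro_L1_def
proof (intro conjI f LIMSEQ_I)
  fix r :: real assume r: "0 < r"
  then obtain g where g: "cesaro_L1 g" "(\<integral>x. \<bar>f x - g x\<bar> \<partial>circle) \<le> r / 4"
    using approx[of "r / 4"] by auto
  then have Ig: "integrable circle g" by (simp add: cesaro_L1_def)
  from g(1) r obtain N0 where N0: "\<And>N. N \<ge> N0 \<Longrightarrow> (\<integral>x. \<bar>cesaro N g x - g x\<bar> \<partial>circle) < r / 4"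
    unfolding cesaro_L1_def using LIMSEQ_D[of _ 0 "r/4"] by fastforce
  show "\<exists>no. \<forall>N\<ge>no. norm ((\<integral>x. \<bar>cesaro N f x - f x\<bar> \<partial>circle) - 0) < r"
  proof (intro exI allI impI)
    fix N assume "max 1 N0 \<le> N"
    then have N: "0 < N" "N0 \<le> N" by auto
    have D: "integrable circle (\<lambda>x. f x - g x)" using f Ig by simp
    have I1: "integrable circle (\<lambda>x. \<bar>cesaro N (\<lambda>x. f x - g x) x\<bar>)"
      using integrable_cesaro[OF D] by (rule integrable_abs)
    have I2: "integrable circle (\<lambda>x. \<bar>cesaro N g x - g x\<bar>)"
      using Ig by simp
    have I3: "integrable circle (\<lambda>x. \<bar>f x - g x\<bar>)" using D by (rule integrable_abs)
    have "(\<integral>x. \<bar>cesaro N f x - f x\<bar> \<partial>circle)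
      \<le> (\<integral>x. \<bar>cesaro N (\<lambda>x. f x - g x) x\<bar> + \<bar>cesaro N g x - g x\<bar> + \<bar>f x - g x\<bar> \<partial>circle)"
    proof (rule integral_mono)
      show "integrable circle (\<lambda>x. \<bar>cesaro N f x - f x\<bar>)" using f by simp
      show "integrable circle (\<lambda>x. \<bar>cesaro N (\<lambda>x. f x - g x) x\<bar> + \<bar>cesaro N g x - g x\<bar> + \<bar>f x - g x\<bar>)"
        by (intro Bochner_Integration.integrable_add I1 I2 I3)
    qed (use f Ig in \<open>simp add: cesaro_diff\<close>)
    also have "\<dots> = (\<integral>x. \<bar>cesaro N (\<lambda>x. f x - g x) x\<bar> \<partial>circle) + (\<integral>x. \<bar>cesaro N g x - g x\<bar> \<partial>circle)
         + (\<integral>x. \<bar>f x - g x\<bar> \<partial>circle)"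
      using I1 I2 I3 by (simp only: Bochner_Integration.integral_add Bochner_Integration.integrable_add)
    also have "\<dots> \<le> r / 4 + r / 4 + r / 4"
      using cesaro_L1_contraction[OF D N(1)] g(2) N0[OF N(2)] by linarith
    finally have "(\<integral>x. \<bar>cesaro N f x - f x\<bar> \<partial>circle) < r" using r by simp
    moreover have "0 \<le> (\<integral>x. \<bar>cesaro N f x - f x\<bar> \<partial>circle)" by simp
    ultimately show "norm ((\<integral>x. \<bar>cesaro N f x - f x\<bar> \<partial>circle) - 0) < r" by simp
  qed
qed

lemma cesaro_L1_lincomb:
  assumes "cesaro_L1 f" "cesaro_L1 g"
  shows "cesaro_L1 (\<lambda>x. a * f x + b * g x)"
  unfolding cesaro_L1_def
proof (intro conjI)
  have I: "integrable circle f" "integrable circle g" using assms by (auto simp: cesaro_L1_def)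
  then show "integrable circle (\<lambda>x. a * f x + b * g x)" by simp
  show "(\<lambda>N. \<integral>x. \<bar>cesaro N (\<lambda>x. a * f x + b * g x) x - (a * f x + b * g x)\<bar> \<partial>circle) \<longlonglongrightarrow> 0"
  proof (rule Lim_null_comparison)
    have "(\<lambda>N. \<bar>a\<bar> * (\<integral>x. \<bar>cesaro N f x - f x\<bar> \<partial>circle) + \<bar>b\<bar> * (\<integral>x. \<bar>cesaro N g x - g x\<bar> \<partial>circle))
        \<longlonglongrightarrow> \<bar>a\<bar> * 0 + \<bar>b\<bar> * 0"
      using assms by (intro tendsto_intros) (auto simp: cesaro_L1_def)
    then show "(\<lambda>N. \<bar>a\<bar> * (\<integral>x. \<bar>cesaro N f x - f x\<bar> \<partial>circle) + \<bar>b\<bar> * (\<integral>x. \<bar>cesaro N g x - g x\<bar> \<partial>circle)) \<longlonglongrightarrow> 0"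
      by simp
    show "\<forall>\<^sub>F N in sequentially. norm (\<integral>x. \<bar>cesaro N (\<lambda>x. a * f x + b * g x) x - (a * f x + b * g x)\<bar> \<partial>circle)
       \<le> \<bar>a\<bar> * (\<integral>x. \<bar>cesaro N f x - f x\<bar> \<partial>circle) + \<bar>b\<bar> * (\<integral>x. \<bar>cesaro N g x - g x\<bar> \<partial>circle)"
    proof (rule always_eventually, rule allI)
      fix N
      have "(\<integral>x. \<bar>cesaro N (\<lambda>x. a * f x + b * g x) x - (a * f x + b * g x)\<bar> \<partial>circle)
        \<le> (\<integral>x. \<bar>a\<bar> * \<bar>cesaro N f x - f x\<bar> + \<bar>b\<bar> * \<bar>cesaro N g x - g x\<bar> \<partial>circle)"
      proof (rule integral_mono)
        fix x
        have "cesaro N (\<lambda>x. a * f x + b * g x) x - (a * f x + b * g x)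
           = a * (cesaro N f x - f x) + b * (cesaro N g x - g x)"
          using I by (simp add: cesaro_add cesaro_cmult algebra_simps)
        then show "\<bar>cesaro N (\<lambda>x. a * f x + b * g x) x - (a * f x + b * g x)\<bar>
           \<le> \<bar>a\<bar> * \<bar>cesaro N f x - f x\<bar> + \<bar>b\<bar> * \<bar>cesaro N g x - g x\<bar>"
          by (metis abs_mult abs_triangle_ineq)
      qed (use I in simp_all)
      also have "\<dots> = \<bar>a\<bar> * (\<integral>x. \<bar>cesaro N f x - f x\<bar> \<partial>circle) + \<bar>b\<bar> * (\<integral>x. \<bar>cesaro N g x - g x\<bar> \<partial>circle)"
        using I by simp
      finally show "norm (\<integral>x. \<bar>cesaro N (\<lambda>x. a * f x + b * g x) x - (a * f x + b * g x)\<bar> \<partial>circle)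
       \<le> \<bar>a\<bar> * (\<integral>x. \<bar>cesaro N f x - f x\<bar> \<partial>circle) + \<bar>b\<bar> * (\<integral>x. \<bar>cesaro N g x - g x\<bar> \<partial>circle)"
        by simp
    qed
  qed
qed

lemma cesaro_L1_AE:
  assumes [measurable]: "f \<in> borel_measurable circle" and b: "\<And>x. \<bar>f x\<bar> \<le> 1"
    and lim: "AE x in circle. (\<lambda>N. cesaro N f x) \<longlonglongrightarrow> f x"
  shows "cesaro_L1 f"
  unfolding cesaro_L1_def
proof
  show If: "integrable circle f" by (rule integrable_circle_bounded[OF _ b]) simp
  have bc: "\<bar>cesaro N f x\<bar> \<le> 1" for N x
  proof (cases "N = 0")
    case False
    have "cesaro N (\<lambda>x. \<bar>f x\<bar>) x \<le> cesaro N (\<lambda>x. 1) x"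
      by (rule cesaro_mono) (use If b in auto)
    also have "\<dots> = 1" using False by (simp add: cesaro_const)
    finally show ?thesis using abs_cesaro_le[OF If, of N x] by linarith
  qed (simp add: cesaro_def fejer_def)
  have "(\<lambda>N. \<integral>x. \<bar>cesaro N f x - f x\<bar> \<partial>circle) \<longlonglongrightarrow> (\<integral>x. 0 \<partial>circle)"
  proof (rule integral_dominated_convergence[where w="\<lambda>_. 2"])
    show "AE x in circle. (\<lambda>N. \<bar>cesaro N f x - f x\<bar>) \<longlonglongrightarrow> 0"
      using lim by eventually_elim (auto intro!: tendsto_rabs_zero simp: LIM_zero_iff)
    show "AE x in circle. norm \<bar>cesaro N f x - f x\<bar> \<le> 2" for N
    proof (rule AE_I2)
      fix x show "norm \<bar>cesaro N f x - f x\<bar> \<le> 2" using bc[of N x] b[of x] by simp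
    qed
    show "(\<lambda>x. \<bar>cesaro N f x - f x\<bar>) \<in> borel_measurable circle" for N
      using integrable_cesaro[OF If] by measurable
  qed auto
  then show "(\<lambda>N. \<integral>x. \<bar>cesaro N f x - f x\<bar> \<partial>circle) \<longlonglongrightarrow> 0" by simp
qed

lemma AE_circle_neq: "AE x in circle. x \<noteq> a"
  unfolding circle_def by (subst AE_restrict_space_iff) (auto intro: AE_mp[OF AE_lborel_singleton[of a]])

lemma cesaro_L1_atLeastAtMost: "cesaro_L1 (indicator {a..b})"
proof (rule cesaro_L1_AE)
  have "AE x in circle. x \<noteq> a \<and> x \<noteq> b \<and> x \<noteq> 0 \<and> x \<noteq> 2 * pi"
    by (intro AE_conjI AE_circle_neq)
  then show "AE x in circle. (\<lambda>N. cesaro N (indicator {a..b}) x) \<longlonglongrightarrow> indicator {a..b} x"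
    using AE_space
  proof eventually_elim
    fix x assume *: "x \<noteq> a \<and> x \<noteq> b \<and> x \<noteq> 0 \<and> x \<noteq> 2 * pi" "x \<in> space circle"
    show "(\<lambda>N. cesaro N (indicator {a..b}) x) \<longlonglongrightarrow> indicator {a..b} x"
    proof (rule cesaro_tendsto_locally_constant[where d="min \<bar>x - a\<bar> \<bar>x - b\<bar>"])
      fix t assume "\<bar>t - x\<bar> < min \<bar>x - a\<bar> \<bar>x - b\<bar>"
      then show "indicator {a..b} t = (indicator {a..b} x :: real)" by (auto simp: indicator_def)
    qed (use * in \<open>auto simp: indicator_def\<close>)
  qed
qed (auto simp: indicator_def)

lemma cesaro_L1_const: "cesaro_L1 (\<lambda>_. c)"
  unfolding cesaro_L1_def
proof (intro conjI)
  have "\<forall>\<^sub>F N in sequentially. (\<integral>x. \<bar>cesaro N (\<lambda>_. c) x - c\<bar> \<partial>circle) = 0"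
    using eventually_gt_at_top[of 0] by eventually_elim (simp add: cesaro_const)
  then show "(\<lambda>N. \<integral>x. \<bar>cesaro N (\<lambda>_. c) x - c\<bar> \<partial>circle) \<longlonglongrightarrow> 0"
    by (rule tendsto_eventually)
qed simp

lemma cesaro_L1_limit:
  assumes s: "\<And>i::nat. cesaro_L1 (s i)" and f: "integrable circle f"
    and lim: "\<And>x. x \<in> space circle \<Longrightarrow> (\<lambda>i. s i x) \<longlonglongrightarrow> f x"
    and dom: "\<And>i x. x \<in> space circle \<Longrightarrow> \<bar>s i x\<bar> \<le> w x" "integrable circle w"
  shows "cesaro_L1 f"
proof (rule cesaro_L1_approx[OF f])
  fix e :: real assume e: "0 < e"
  have I: "integrable circle (s i)" for i using s by (simp add: cesaro_L1_def)
  have "(\<lambda>i. \<integral>x. \<bar>f x - s i x\<bar> \<partial>circle) \<longlonglongrightarrow> (\<integral>x. 0 \<partial>circle)"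
  proof (rule integral_dominated_convergence[where w="\<lambda>x. \<bar>f x\<bar> + w x"])
    show "AE x in circle. (\<lambda>i. \<bar>f x - s i x\<bar>) \<longlonglongrightarrow> 0"
    proof (rule AE_I2)
      fix x assume "x \<in> space circle"
      from tendsto_rabs[OF tendsto_diff[OF tendsto_const[of "f x"] lim[OF this]]]
      show "(\<lambda>i. \<bar>f x - s i x\<bar>) \<longlonglongrightarrow> 0" by simp
    qed
    show "AE x in circle. norm \<bar>f x - s i x\<bar> \<le> \<bar>f x\<bar> + w x" for i
    proof (rule AE_I2)
      fix x assume "x \<in> space circle"
      then show "norm \<bar>f x - s i x\<bar> \<le> \<bar>f x\<bar> + w x" using dom(1)[of x i] by simp
    qed
    show "integrable circle (\<lambda>x. \<bar>f x\<bar> + w x)" using f dom(2) by simp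
    show "(\<lambda>x. \<bar>f x - s i x\<bar>) \<in> borel_measurable circle" for i using f I[of i] by measurable
  qed auto
  then have "\<forall>\<^sub>F i in sequentially. (\<integral>x. \<bar>f x - s i x\<bar> \<partial>circle) < e"
    using e by (auto dest: order_tendstoD(2))
  then obtain i where "(\<integral>x. \<bar>f x - s i x\<bar> \<partial>circle) < e"
    by (auto simp: eventually_sequentially)
  then show "\<exists>g. cesaro_L1 g \<and> (\<integral>x. \<bar>f x - g x\<bar> \<partial>circle) \<le> e"
    using s[of i] less_imp_le by blast
qed

text \<open>
  The sets whose indicator functions have the property form a Dynkin system that contains the
  intervals, and these are stable under intersection.
\<close>

lemma cesaro_L1_indicator:
  assumes "A \<in> sets borel"
  shows "cesaro_L1 (indicator A)"
proof -
  have "(borel :: real measure) = sigma UNIV (range (\<lambda>(a, b). {a..b}))"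
    by (rule borel_eq_atLeastAtMost)
  then have sb: "sets (borel :: real measure) = sigma_sets UNIV (range (\<lambda>(a, b::real). {a..b}))"
    by (metis sets_measure_of Pow_UNIV subset_UNIV)
  have "Int_stable (range (\<lambda>(a, b::real). {a..b}))"
    by (auto simp: Int_stable_def)
  moreover have "range (\<lambda>(a, b::real). {a..b}) \<subseteq> Pow UNIV" by simp
  ultimately show ?thesis
    using assms[unfolded sb]
  proof (induction rule: sigma_sets_induct_disjoint)
    case (basic A)
    then show ?case using cesaro_L1_atLeastAtMost by auto
  next
    case empty
    then show ?case using cesaro_L1_const[of 0] by (simp add: indicator_def)
  next
    case (compl A)
    have "indicator (UNIV - A) = (\<lambda>x. 1 * 1 + (-1) * indicator A x :: real)"
      by (auto simp: indicator_def fun_eq_iff)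
    then show ?case using cesaro_L1_lincomb[OF cesaro_L1_const[of 1] compl.IH, of 1 "-1"] by simp
  next
    case (union A)
    have A: "A i \<in> sets borel" for i using union(2) by (auto simp: sb)
    show ?case
    proof (rule cesaro_L1_limit[where s="\<lambda>n x. \<Sum>i<n. indicator (A i) x" and w="\<lambda>_. 1"])
      show "cesaro_L1 (\<lambda>x. \<Sum>i<n. indicator (A i) x)" for n
      proof (induction n)
        case 0 then show ?case using cesaro_L1_const[of 0] by simp
      next
        case (Suc n)
        from cesaro_L1_lincomb[OF this union.IH[of n], of 1 1] show ?case by simp
      qed
      have eq: "(\<Sum>i<n. indicator (A i) x) = (indicator (\<Union>i<n. A i) x :: real)" for n x
        using union(1) by (intro indicator_UN_disjoint[symmetric]) (auto simp: disjoint_family_on_def)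
      show "integrable circle (indicator (\<Union>i. A i) :: real \<Rightarrow> real)"
        by (rule integrable_circle_bounded[where B=1]) (use A in \<open>auto simp: indicator_def\<close>)
      show "(\<lambda>n. \<Sum>i<n. indicator (A i) x) \<longlonglongrightarrow> (indicator (\<Union>i. A i) x :: real)" for x
        unfolding eq by (rule LIMSEQ_indicator_UN)
      show "\<bar>\<Sum>i<n. indicator (A i) x\<bar> \<le> (1::real)" for n x
        unfolding eq by (simp add: indicator_def)
    qed simp
  qed
qed

text \<open>
  The class of functions with the property is a closed subspace of \<open>L\<^sub>1\<close> and contains the indicator
  functions of Borel sets.
\<close>

lemma cesaro_tendsto_L1:
  assumes "integrable circle f"
  shows "cesaro_L1 f"
  using assms
proof (induction rule: integrable_induct)
  case (base A c)
  then obtain B where B: "B \<in> sets borel" "A = B \<inter> {0..2 * pi}"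
    by (auto simp: circle_def sets_restrict_space)
  then have "A \<in> sets borel" by auto
  from cesaro_L1_lincomb[OF cesaro_L1_indicator[OF this] cesaro_L1_const[of 0], of c 0]
  show ?case by (simp add: mult.commute)
next
  case (add f g)
  from cesaro_L1_lincomb[OF add(3,4), of 1 1] show ?case by simp
next
  case (lim f s)
  show ?case
    by (rule cesaro_L1_limit[where s=s and w="\<lambda>x. 2 * \<bar>f x\<bar>"]) (use lim in auto)
qed

lemma cesaro_AE_subseq:
  assumes f: "integrable circle f"
  obtains r where "strict_mono r" "AE x in circle. (\<lambda>N. cesaro (r N) f x) \<longlonglongrightarrow> f x"
proof -
  have "(\<lambda>N. \<integral>x. norm (cesaro N f x - f x) \<partial>circle) \<longlonglongrightarrow> 0"
    using cesaro_tendsto_L1[OF f] by (simp add: cesaro_L1_def)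
  then obtain r where r: "strict_mono r" "AE x in circle. (\<lambda>N. cesaro (r N) f x - f x) \<longlonglongrightarrow> 0"
    using f tendsto_L1_AE_subseq[of circle "\<lambda>N x. cesaro N f x - f x"] by auto
  have "AE x in circle. (\<lambda>N. cesaro (r N) f x) \<longlonglongrightarrow> f x"
    using r(2) by eventually_elim (simp add: LIM_zero_iff)
  then show ?thesis using r(1) that by blast
qed

section \<open>Conjugate functions\<close>

lemma powr_add_le:
  fixes a b p :: real
  assumes "0 \<le> a" "0 \<le> b" "0 < p"
  shows "(a + b) powr p \<le> 2 powr p * (a powr p + b powr p)"
proof -
  have "(a + b) powr p \<le> (2 * max a b) powr p" using assms by (intro powr_mono2) auto
  also have "\<dots> = 2 powr p * (max a b) powr p" using assms by (simp add: powr_mult)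
  also have "(max a b) powr p \<le> a powr p + b powr p" by (auto simp: max_def)
  finally show ?thesis by simp
qed

lemma integrable_powr_continuous:
  fixes f :: "real \<Rightarrow> real"
  assumes "continuous_on UNIV f" "0 < p"
  shows "integrable circle (\<lambda>x. \<bar>f x\<bar> powr p)"
  using assms by (intro integrable_circle_continuous continuous_on_powr' continuous_intros) auto

lemma integrable_trig_powr: "0 < p \<Longrightarrow> integrable circle (\<lambda>x. \<bar>trig N u x\<bar> powr p)"
  by (intro integrable_powr_continuous continuous_intros)

lemma integral_powr_add_le:
  fixes f g :: "real \<Rightarrow> real"
  assumes "0 < p" "integrable circle (\<lambda>x. \<bar>f x\<bar> powr p)" "integrable circle (\<lambda>x. \<bar>g x\<bar> powr p)"
    and [measurable]: "f \<in> borel_measurable circle" "g \<in> borel_measurable circle"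
  shows "(\<integral>x. \<bar>f x + g x\<bar> powr p \<partial>circle)
     \<le> 2 powr p * (pint p f + pint p g)"
    and "integrable circle (\<lambda>x. \<bar>f x + g x\<bar> powr p)"
proof -
  have b: "\<bar>f x + g x\<bar> powr p \<le> 2 powr p * (\<bar>f x\<bar> powr p + \<bar>g x\<bar> powr p)" for x
  proof -
    have "\<bar>f x + g x\<bar> powr p \<le> (\<bar>f x\<bar> + \<bar>g x\<bar>) powr p" using assms by (intro powr_mono2) auto
    also have "\<dots> \<le> 2 powr p * (\<bar>f x\<bar> powr p + \<bar>g x\<bar> powr p)" using assms by (intro powr_add_le) auto
    finally show ?thesis .
  qed
  show I: "integrable circle (\<lambda>x. \<bar>f x + g x\<bar> powr p)"
  proof (rule Bochner_Integration.integrable_bound)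
    show "integrable circle (\<lambda>x. 2 powr p * (\<bar>f x\<bar> powr p + \<bar>g x\<bar> powr p))" using assms by simp
    show "AE x in circle. norm (\<bar>f x + g x\<bar> powr p) \<le> norm (2 powr p * (\<bar>f x\<bar> powr p + \<bar>g x\<bar> powr p))"
      using b by (auto intro!: AE_I2 order_trans[OF b])
  qed simp
  have "(\<integral>x. \<bar>f x + g x\<bar> powr p \<partial>circle) \<le> (\<integral>x. 2 powr p * (\<bar>f x\<bar> powr p + \<bar>g x\<bar> powr p) \<partial>circle)"
    using assms by (intro integral_mono I b) auto
  also have "\<dots> = 2 powr p * (pint p f + pint p g)"
    using assms by simp
  finally show "(\<integral>x. \<bar>f x + g x\<bar> powr p \<partial>circle)
     \<le> 2 powr p * (pint p f + pint p g)" .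
qed

text \<open>
  Since \<open>p > 1\<close>, the cosine of \<open>p \<theta>\<close> is already negative, and bounded away from \<open>0\<close>, where
  \<open>cos \<theta>\<close> vanishes. There the second term provides the bound 1; elsewhere the first one does, and it
  also compensates the second. The condition \<open>p \<le> 2\<close> keeps \<open>p \<theta>\<close> within \<open>[-\<pi>, \<pi>]\<close>.
\<close>

lemma cos_power_dominates:
  fixes p :: real
  assumes p: "1 < p" "p \<le> 2"
  obtains A B where "0 \<le> A" "0 \<le> B"
    "\<And>\<theta>. \<bar>\<theta>\<bar> < pi / 2 \<Longrightarrow> 1 \<le> A * cos \<theta> powr p - B * cos (p * \<theta>)"
proof -
  \<comment> \<open>The midpoint between \<open>\<pi>/(2p)\<close>, where \<open>cos (p t)\<close> vanishes, and \<open>\<pi>/2\<close>, where \<open>cos t\<close> does.\<close>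
  define t where "t = (pi / 2 + pi / (2 * p)) / 2"
  have t1: "t < pi / 2" "0 < t" "pi / 2 < p * t"
    using p by (auto simp: t_def field_simps intro!: add_pos_pos)
  have tp: "p * t \<le> pi" using p t1 mult_mono[of p 2 t "pi/2"] by auto
  have c: "cos (p * t) < 0"
    using cos_monotone_0_pi[of "pi/2" "p * t"] t1 tp by simp
  have ct: "0 < cos t" using t1 by (intro cos_gt_zero_pi) auto
  define B where "B = 1 / - cos (p * t)"
  define A where "A = (1 + B) / cos t powr p"
  have B: "0 \<le> B" using c by (simp add: B_def field_simps)
  have A: "0 \<le> A" using B ct by (simp add: A_def)
  show ?thesis
  proof (rule that[OF A B])
    fix \<theta> :: real assume th: "\<bar>\<theta>\<bar> < pi / 2"
    define s where "s = \<bar>\<theta>\<bar>"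
    have s: "0 \<le> s" "s < pi / 2" using th by (auto simp: s_def)
    have cs: "cos \<theta> = cos s" "cos (p * \<theta>) = cos (p * s)"
      unfolding s_def using cos_abs_real[of "p * \<theta>"] p by (simp_all add: abs_mult)
    have cs0: "0 < cos s" using s by (intro cos_gt_zero_pi) auto
    show "1 \<le> A * cos \<theta> powr p - B * cos (p * \<theta>)"
    proof (cases "s < t")
      case True
      have "cos t \<le> cos s" using True s t1 by (intro cos_monotone_0_pi_le) auto
      then have "cos t powr p \<le> cos s powr p" using ct p by (intro powr_mono2) auto
      then have "A * cos t powr p \<le> A * cos s powr p" using A by (rule mult_left_mono)
      then have "1 + B \<le> A * cos s powr p" using ct by (simp add: A_def)
      moreover have "B * cos (p * s) \<le> B * 1" using B by (intro mult_left_mono) auto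
      ultimately show ?thesis unfolding cs by simp
    next
      case False
      have "p * s \<le> pi" using p s mult_mono[of p 2 s "pi/2"] by auto
      then have "cos (p * s) \<le> cos (p * t)"
        using False p t1 by (intro cos_monotone_0_pi_le) auto
      then have "B * (- cos (p * t)) \<le> B * (- cos (p * s))" using B by (intro mult_left_mono) auto
      moreover have "B * (- cos (p * t)) = 1" using c by (simp add: B_def)
      ultimately have "1 \<le> - (B * cos (p * s))" by simp
      moreover have "0 \<le> A * cos s powr p" using A by simp
      ultimately show ?thesis unfolding cs by simp
    qed
  qed
qed

text \<open>Cauchy's formula at the centre of the unit disc, in the parametrization by the angle.\<close>

lemma integral_circle_holomorphic:
  assumes "continuous_on (cball 0 1) G" "G holomorphic_on ball 0 1"
  shows "(\<integral>x. Re (G (cis x)) \<partial>circle) = 2 * pi * Re (G 0)"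
proof -
  have "((\<lambda>w. G w / (w - 0)) has_contour_integral (2 * of_real pi * \<i> * G 0)) (circlepath 0 1)"
    by (rule Cauchy_integral_circlepath) (use assms in auto)
  then have "((\<lambda>t. G (0 + 1 * cis t) / (0 + 1 * cis t - 0) * 1 * \<i> * cis t) has_integral (2 * of_real pi * \<i> * G 0)) {0..2*pi}"
    unfolding circlepath_def by (subst (asm) has_contour_integral_part_circlepath_iff) auto
  then have "((\<lambda>t. \<i> * G (cis t)) has_integral (\<i> * (2 * of_real pi * G 0))) {0..2*pi}"
    by (simp add: mult_ac)
  then have "((\<lambda>t. (-\<i>) * (\<i> * G (cis t))) has_integral ((-\<i>) * (\<i> * (2 * of_real pi * G 0)))) {0..2*pi}"
    by (rule has_integral_mult_right)
  then have "((\<lambda>t. G (cis t)) has_integral (2 * of_real pi * G 0)) {0..2*pi}"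
    by (simp add: mult.assoc[symmetric])
  from has_integral_Re[OF this]
  have hi: "((\<lambda>t. Re (G (cis t))) has_integral (2 * pi * Re (G 0))) {0..2*pi}"
    by simp
  have "continuous_on {0..2*pi} (\<lambda>t. G (cis t))"
    by (rule continuous_on_compose2[OF assms(1)]) (auto intro!: continuous_intros)
  then have cont: "continuous_on {0..2*pi} (\<lambda>t. Re (G (cis t)))"
    by (intro continuous_intros)
  have "(\<integral>x. Re (G (cis x)) \<partial>circle) = set_lebesgue_integral lborel {0..2*pi} (\<lambda>t. Re (G (cis t)))"
    unfolding circle_def by (subst integral_restrict_space) (auto simp: set_lebesgue_integral_def)
  also have "\<dots> = integral {0..2*pi} (\<lambda>t. Re (G (cis t)))"
    by (rule set_borel_integral_eq_integral(2)) (rule borel_integrable_atLeastAtMost'[OF cont])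
  also have "\<dots> = 2 * pi * Re (G 0)" using hi by (rule integral_unique)
  finally show ?thesis .
qed

text \<open>On the unit circle the real part is \<open>c + trig N u\<close> and the imaginary part its conjugate function.\<close>

definition analytic_poly :: "nat \<Rightarrow> real \<Rightarrow> (nat \<Rightarrow> complex) \<Rightarrow> complex \<Rightarrow> complex" where
  "analytic_poly N c u z = of_real c + (\<Sum>k=1..N. cnj (u k) * z ^ k)"

lemma analytic_poly_cis:
  "Re (analytic_poly N c u (cis x)) = c + trig N u x"
  "Im (analytic_poly N c u (cis x)) = trig N (\<lambda>k. \<i> * u k) x"
  by (simp_all add: analytic_poly_def trig_def inner_cis Complex.DeMoivre)

lemma holomorphic_analytic_poly [holomorphic_intros]: "analytic_poly N c u holomorphic_on S"
  unfolding analytic_poly_def[abs_def] by (intro holomorphic_intros)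

text \<open>
  A holomorphic \<open>F = f + \<i> h\<close> with values in the right half plane has a holomorphic power \<open>F\<^sup>p\<close>,
  whose mean value is the positive number \<open>F(0)\<^sup>p\<close>. Integrate the inequality
  \<open>\<bar>F\<bar>\<^sup>p \<le> A (Re F)\<^sup>p - B Re (F\<^sup>p)\<close>, which holds in that half plane.
\<close>

lemma riesz_positive:
  assumes p: "1 < p" "p \<le> 2"
  obtains A where "0 \<le> A" "\<And>N u c. (\<And>x. 0 < c + trig N u x) \<Longrightarrow>
    pint p (trig N (\<lambda>k. \<i> * u k)) \<le> A * (\<integral>x. (c + trig N u x) powr p \<partial>circle)"
proof -
  obtain A B where AB: "0 \<le> A" "0 \<le> B"
    "\<And>\<theta>. \<bar>\<theta>\<bar> < pi / 2 \<Longrightarrow> 1 \<le> A * cos \<theta> powr p - B * cos (p * \<theta>)"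
    using cos_power_dominates[OF p] by blast
  show ?thesis
  proof (rule that[OF AB(1)])
    fix N u c assume pos: "\<And>x. 0 < c + trig N u x"
    define F where "F = analytic_poly N c u"
    have holF: "F holomorphic_on S" for S unfolding F_def by (intro holomorphic_intros)
    have contF: "continuous_on S F" for S using holF by (rule holomorphic_on_imp_continuous_on)
    have "compact (sphere (0::complex) 1)" by simp
    moreover have "continuous_on (sphere 0 1) (\<lambda>z. Re (F z))" by (intro continuous_intros contF)
    moreover have "(1::complex) \<in> sphere 0 1" by simp
    ultimately obtain z0 where z0: "z0 \<in> sphere 0 1" "\<And>z. z \<in> sphere 0 1 \<Longrightarrow> Re (F z0) \<le> Re (F z)"
      using continuous_attains_inf[of "sphere (0::complex) 1" "\<lambda>z. Re (F z)"] by blast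
    define m where "m = Re (F z0)"
    have "z0 = cis (Arg z0)" using z0(1) by (metis cis_Arg mem_sphere_0 norm_zero sgn_if zero_neq_one complex_sgn_def div_by_1 scaleR_one inverse_1 sgn_div_norm)
    then have m: "0 < m" using pos[of "Arg z0"] by (metis F_def analytic_poly_cis(1) m_def)
    have Repos: "0 < Re (F z)" if "z \<in> cball 0 1" for z
    proof -
      \<comment> \<open>The real part is positive on the circle, and inside the disc by the maximum principle.\<close>
      have "Re (- F z) \<le> - m"
      proof (rule maximum_real_frontier[where f="\<lambda>z. - F z" and S="cball 0 1"])
        show "(\<lambda>z. - F z) holomorphic_on interior (cball 0 1)" by (intro holomorphic_intros holF)
        show "continuous_on (closure (cball 0 1)) (\<lambda>z. - F z)" by (intro continuous_intros contF)
        fix w :: complex assume "w \<in> frontier (cball 0 1)"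
        then show "Re (- F w) \<le> - m" using z0(2)[of w] by (simp add: m_def)
      qed (use that in auto)
      then show ?thesis using m by simp
    qed
    have nonneg: "F z \<notin> \<real>\<^sub>\<le>\<^sub>0" if "z \<in> cball 0 1" for z
      using Repos[OF that] by (simp add: complex_nonpos_Reals_iff)
    define G where "G z = exp (of_real p * Ln (F z))" for z
    have holG: "G holomorphic_on ball 0 1"
      unfolding G_def[abs_def] by (intro holomorphic_intros holF) (use nonneg in auto)
    have contG: "continuous_on (cball 0 1) G"
      unfolding G_def[abs_def] by (intro continuous_intros contF) (use nonneg in auto)
    have mean: "(\<integral>x. Re (G (cis x)) \<partial>circle) = 2 * pi * Re (G 0)"
      by (rule integral_circle_holomorphic[OF contG holG])
    have F0: "F 0 = of_real c" by (simp add: F_def analytic_poly_def)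
    then have "0 < c" using Repos[of 0] by simp
    then have G0: "0 \<le> Re (G 0)"
      unfolding G_def F0 by (simp add: Ln_of_real Re_exp)
    have pw: "\<bar>trig N (\<lambda>k. \<i> * u k) x\<bar> powr p \<le> A * (c + trig N u x) powr p - B * Re (G (cis x))" for x
    proof -
      define z where "z = F (cis x)"
      define L where "L = Ln z"
      have Rz: "0 < Re z" unfolding z_def by (rule Repos) simp
      then have "z \<noteq> 0" by auto
      have th: "\<bar>Im L\<bar> < pi / 2" unfolding L_def using Rz \<open>z \<noteq> 0\<close> Re_Ln_pos_lt by blast
      have zL: "z = exp L" unfolding L_def using \<open>z \<noteq> 0\<close> by simp
      define r where "r = exp (Re L)"
      have r: "0 < r" "norm z = r" by (simp_all add: r_def zL)
      have Rez: "Re z = r * cos (Im L)" by (simp add: zL Re_exp r_def)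
      have cpos: "0 < cos (Im L)" using th by (intro cos_gt_zero_pi) auto
      have RG: "Re (G (cis x)) = r powr p * cos (p * Im L)"
        unfolding G_def z_def[symmetric] L_def[symmetric]
        by (simp add: Re_exp r_def powr_def)
      have "r powr p * 1 \<le> r powr p * (A * cos (Im L) powr p - B * cos (p * Im L))"
        by (intro mult_left_mono AB(3) th) simp
      also have "\<dots> = A * (Re z) powr p - B * Re (G (cis x))"
        unfolding Rez RG using r cpos by (simp add: powr_mult algebra_simps)
      finally have "(norm z) powr p \<le> A * (Re z) powr p - B * Re (G (cis x))" using r by simp
      moreover have "\<bar>Im z\<bar> powr p \<le> (norm z) powr p"
        using p by (intro powr_mono2 abs_Im_le_cmod) auto
      ultimately show ?thesis by (simp add: z_def F_def analytic_poly_cis)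
    qed
    have IG: "integrable circle (\<lambda>x. Re (G (cis x)))"
    proof (rule integrable_circle_continuous)
      have "continuous_on UNIV (\<lambda>x. G (cis x))"
        by (rule continuous_on_compose2[OF contG]) (auto intro!: continuous_intros)
      then show "continuous_on UNIV (\<lambda>x. Re (G (cis x)))" by (intro continuous_intros)
    qed
    have If: "integrable circle (\<lambda>x. (c + trig N u x) powr p)"
      by (intro integrable_circle_continuous continuous_on_powr' continuous_intros)
         (use pos p in \<open>auto intro: less_imp_le\<close>)
    have "pint p (trig N (\<lambda>k. \<i> * u k))
        \<le> (\<integral>x. A * (c + trig N u x) powr p - B * Re (G (cis x)) \<partial>circle)"
      using IG If p by (intro integral_mono pw integrable_trig_powr) auto
    also have "\<dots> = A * (\<integral>x. (c + trig N u x) powr p \<partial>circle) - B * (2 * pi * Re (G 0))"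
      using IG If by (simp add: mean)
    also have "\<dots> \<le> A * (\<integral>x. (c + trig N u x) powr p \<partial>circle)"
      using AB(2) G0 by simp
    finally show "pint p (trig N (\<lambda>k. \<i> * u k)) \<le> A * (\<integral>x. (c + trig N u x) powr p \<partial>circle)" .
  qed
qed

definition conjugation_bounded :: "real \<Rightarrow> bool" where
  "conjugation_bounded p \<longleftrightarrow> (\<exists>C\<ge>0. \<forall>N u.
     pint p (trig N (\<lambda>k. \<i> * u k)) \<le> C * pint p (trig N u))"

text \<open>
  The positive and the negative part of a trigonometric polynomial are not polynomials; their Fejer
  means are, and stay positive. The means of high order recover the given polynomial.
\<close>

lemma conjugation_bounded_le_2:
  assumes p: "1 < p" "p \<le> 2"
  shows "conjugation_bounded p"
proof -
  obtain A where A: "0 \<le> A" "\<And>N u c. (\<And>x. 0 < c + trig N u x) \<Longrightarrow>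
    pint p (trig N (\<lambda>k. \<i> * u k)) \<le> A * (\<integral>x. (c + trig N u x) powr p \<partial>circle)"
    using riesz_positive[OF p] by blast
  define C where "C = 2 powr p * (2 * (A * 2 powr p))"
  have "pint p (trig N (\<lambda>k. \<i> * u k)) \<le> C * pint p (trig N u)" for N u
  proof -
    define f where "f = trig N u"
    define Y where "Y = pint p f"
    have Ifp: "integrable circle (\<lambda>x. \<bar>f x\<bar> powr p)" unfolding f_def using p by (intro integrable_trig_powr) auto
    have contf: "continuous_on UNIV f" unfolding f_def by (intro continuous_intros)
    \<comment> \<open>The conjugate function of the \<open>M\<close>-th Fejer mean of a function \<open>g\<close> that lies above \<open>e > 0\<close>.\<close>
    have part: "pint p (trig M (\<lambda>k. \<i> * (cesaro_weight M k *\<^sub>R fcoef g k)))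
        \<le> A * (2 powr p * (Y + 2 * pi * e powr p))"
      if e: "0 < e" and M: "0 < M" and g: "continuous_on UNIV g" "\<And>x. e \<le> g x" "\<And>x. g x \<le> \<bar>f x\<bar> + e" for e M g
    proof -
      have Ig: "integrable circle g" using g(1) by (rule integrable_circle_continuous)
      have gp: "\<bar>g x\<bar> = g x" for x using g(2)[of x] e by simp
      have Igp: "integrable circle (\<lambda>x. \<bar>g x\<bar> powr p)" using g(1) p by (intro integrable_powr_continuous) auto
      have ces: "cesaro M g x = fourier_cos g 0 / 2 + trig M (\<lambda>k. cesaro_weight M k *\<^sub>R fcoef g k) x" for x
        by (rule cesaro_eq_trig[OF Ig M order_refl])
      have pos: "0 < cesaro M g x" for x
      proof -
        have "e = cesaro M (\<lambda>_. e) x" using M by (simp add: cesaro_const)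
        also have "\<dots> \<le> cesaro M g x" by (rule cesaro_mono) (use Ig g in auto)
        finally show ?thesis using e by simp
      qed
      have "pint p (trig M (\<lambda>k. \<i> * (cesaro_weight M k *\<^sub>R fcoef g k)))
          \<le> A * (\<integral>x. (cesaro M g x) powr p \<partial>circle)"
        unfolding ces by (rule A(2)) (use pos in \<open>simp add: ces\<close>)
      also have "(\<integral>x. (cesaro M g x) powr p \<partial>circle) = pint p (cesaro M g)"
        using pos by (simp add: less_imp_le)
      also have "\<dots> \<le> pint p g"
        using Igp Ig p by (intro cesaro_powr_contraction M) auto
      also have "\<dots> \<le> (\<integral>x. 2 powr p * (\<bar>f x\<bar> powr p + e powr p) \<partial>circle)"
      proof (rule integral_mono[OF Igp])
        fix x
        have "\<bar>g x\<bar> powr p \<le> (\<bar>f x\<bar> + e) powr p" using g(3)[of x] gp[of x] p by (intro powr_mono2) auto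
        also have "\<dots> \<le> 2 powr p * (\<bar>f x\<bar> powr p + e powr p)" using p e by (intro powr_add_le) auto
        finally show "\<bar>g x\<bar> powr p \<le> 2 powr p * (\<bar>f x\<bar> powr p + e powr p)" .
      qed (use Ifp in simp)
      also have "\<dots> = 2 powr p * (Y + 2 * pi * e powr p)" using Ifp by (simp add: Y_def)
      finally show ?thesis using A(1) by (simp add: mult_left_mono)
    qed
    have eps: "pint p (trig N (\<lambda>k. \<i> * u k)) \<le> C * (Y + 2 * pi * e powr p)" if e: "0 < e" for e
    proof -
      have Y0: "0 \<le> Y + 2 * pi * e powr p" by (simp add: Y_def)
      \<comment> \<open>The shift by \<open>e\<close> makes both parts strictly positive and cancels in the difference.\<close>
      define g1 where "g1 x = max (f x) 0 + e" for x
      define g2 where "g2 x = max (- f x) 0 + e" for x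
      have c: "continuous_on UNIV g1" "continuous_on UNIV g2"
        unfolding g1_def g2_def by (intro continuous_intros contf)+
      then have I: "integrable circle g1" "integrable circle g2" by (auto intro: integrable_circle_continuous)
      have "f = (\<lambda>x. g1 x - g2 x)" by (auto simp: g1_def g2_def)
      then have fd: "fcoef f k = fcoef g1 k - fcoef g2 k" for k using fcoef_diff[OF I] by simp
      define h where "h M = trig N (\<lambda>k. \<i> * (cesaro_weight M k *\<^sub>R u k))" for M
      show ?thesis
      proof (rule integral_powr_limit(2)[where h=h])
        show "AE x in circle. (\<lambda>M. h M x) \<longlonglongrightarrow> trig N (\<lambda>k. \<i> * u k) x"
        proof (rule AE_I2)
          fix x
          have "(\<lambda>M. h M x) \<longlonglongrightarrow> trig N (\<lambda>k. \<i> * (1 *\<^sub>R u k)) x"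
            unfolding h_def by (intro trig_tendsto tendsto_intros cesaro_weight_tendsto)
          then show "(\<lambda>M. h M x) \<longlonglongrightarrow> trig N (\<lambda>k. \<i> * u k) x" by simp
        qed
        show "\<forall>\<^sub>F M in sequentially. pint p (h M) \<le> C * (Y + 2 * pi * e powr p)"
          using eventually_ge_at_top[of "Suc N"]
        proof eventually_elim
          fix M assume M: "Suc N \<le> M"
          let ?t = "\<lambda>g. trig M (\<lambda>k. \<i> * (cesaro_weight M k *\<^sub>R fcoef g k))"
          have eq: "h M x = ?t g1 x + - ?t g2 x" for x
          proof -
            have "?t g1 x + - ?t g2 x = trig M (\<lambda>k. \<i> * (cesaro_weight M k *\<^sub>R fcoef f k)) x"
              unfolding fd by (simp add: scaleR_diff_right right_diff_distrib trig_diff)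
            also have "\<dots> = trig N (\<lambda>k. \<i> * (cesaro_weight M k *\<^sub>R fcoef f k)) x"
              by (rule trig_extend) (use M in \<open>auto simp: f_def fcoef_trig'\<close>)
            also have "\<dots> = h M x"
              unfolding h_def by (rule trig_cong) (simp add: f_def fcoef_trig')
            finally show ?thesis ..
          qed
          have "pint p (h M)
             \<le> 2 powr p * (pint p (?t g1) + (\<integral>x. \<bar>- ?t g2 x\<bar> powr p \<partial>circle))"
            unfolding eq using p by (intro integral_powr_add_le) (auto intro: integrable_trig_powr)
          also have "\<dots> = 2 powr p * (pint p (?t g1) + pint p (?t g2))"
            by simp
          also have "\<dots> \<le> 2 powr p * (A * (2 powr p * (Y + 2 * pi * e powr p)) + A * (2 powr p * (Y + 2 * pi * e powr p)))"
            using e M by (intro mult_left_mono add_mono part c) (auto simp: g1_def g2_def)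
          also have "\<dots> = C * (Y + 2 * pi * e powr p)"
            unfolding C_def by (simp add: algebra_simps)
          finally show "pint p (h M) \<le> C * (Y + 2 * pi * e powr p)" .
        qed
        show "0 \<le> C * (Y + 2 * pi * e powr p)" using Y0 A(1) by (simp add: C_def)
      qed (use p in \<open>auto simp: h_def intro: integrable_trig_powr\<close>)
    qed
    have "(\<lambda>n. C * (Y + 2 * pi * (1 / real n) powr p)) \<longlonglongrightarrow> C * (Y + 2 * pi * 0 powr p)"
      using p by (intro tendsto_intros tendsto_powr' lim_1_over_n) auto
    moreover have "\<forall>\<^sub>F n in sequentially. pint p (trig N (\<lambda>k. \<i> * u k)) \<le> C * (Y + 2 * pi * (1 / real n) powr p)"
      using eventually_gt_at_top[of 0] by eventually_elim (rule eps, simp)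
    ultimately have "pint p (trig N (\<lambda>k. \<i> * u k)) \<le> C * (Y + 2 * pi * 0 powr p)"
      by (rule tendsto_lowerbound) simp
    then show ?thesis using p by (simp add: Y_def f_def)
  qed
  moreover have "0 \<le> C" using A(1) by (simp add: C_def)
  ultimately show ?thesis unfolding conjugation_bounded_def by blast
qed

lemma young_powr:
  fixes a b p q :: real
  assumes "1 < p" "1 < q" "1 / p + 1 / q = 1" "0 \<le> a" "0 \<le> b"
  shows "a * b \<le> a powr p + b powr q"
proof -
  have "a * b \<le> a powr p / p + b powr q / q"
    using Youngs_inequality[of p q a b] assms by auto
  also have "a powr p / p \<le> a powr p" using assms by (simp add: divide_le_eq mult_le_cancel_left1)
  also have "b powr q / q \<le> b powr q" using assms by (simp add: divide_le_eq mult_le_cancel_left1)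
  finally show ?thesis by simp
qed

lemma conjugate_exponent:
  fixes p q :: real
  assumes "1 < p" "1 < q" "1 / p + 1 / q = 1"
  shows "(p - 1) * q = p"
  using assms by (auto simp: field_simps)

text \<open>Conjugation is antisymmetric, so its bounds pass from an exponent to the dual one.\<close>

lemma conjugation_bounded_dual:
  assumes q: "conjugation_bounded q" and pq: "1 < p" "1 < q" "1 / p + 1 / q = 1"
  shows "conjugation_bounded p"
proof -
  obtain C where C: "0 \<le> C" "\<And>N u. pint q (trig N (\<lambda>k. \<i> * u k)) \<le> C * pint q (trig N u)"
    using q unfolding conjugation_bounded_def by blast
  define D where "D = C * (2 powr q * 2)"
  \<comment> \<open>With this scaling in Young's inequality the dual term is at most half of the left hand side.\<close>
  define t where "t = (2 * D + 1) powr (1 / q)"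
  have D: "0 \<le> D" using C by (simp add: D_def)
  have t: "0 < t" "t powr q = 2 * D + 1" using D pq by (simp_all add: t_def powr_powr)
  have "pint p (trig N (\<lambda>k. \<i> * u k)) \<le> 2 * t powr p * pint p (trig N u)" for N u
  proof -
    define f where "f = trig N u"
    define h where "h = trig N (\<lambda>k. \<i> * u k)"
    define X where "X = pint p h"
    define Y where "Y = pint p f"
    \<comment> \<open>The function for which Hoelder's inequality with \<open>h\<close> is an equality: \<open>g h = \<bar>h\<bar>\<^sup>p = \<bar>g\<bar>\<^sup>q\<close>.\<close>
    define g where "g x = sgn (h x) * \<bar>h x\<bar> powr (p - 1)" for x
    have conth: "continuous_on UNIV h" unfolding h_def by (intro continuous_intros)
    have contg: "continuous_on UNIV g"
    proof -
      have "continuous_on UNIV (\<lambda>y::real. sgn y * \<bar>y\<bar> powr (p - 1))"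
      proof (rule continuous_at_imp_continuous_on, rule ballI)
        fix y :: real
        show "isCont (\<lambda>y. sgn y * \<bar>y\<bar> powr (p - 1)) y"
        proof (cases "y = 0")
          case False
          then show ?thesis by (intro continuous_intros) auto
        next
          case True
          have "((\<lambda>y::real. \<bar>y\<bar> powr (p - 1)) \<longlongrightarrow> \<bar>0\<bar> powr (p - 1)) (at 0)"
            using pq by (intro tendsto_powr' tendsto_intros) auto
          then have "((\<lambda>y::real. \<bar>y\<bar> powr (p - 1)) \<longlongrightarrow> 0) (at 0)" using pq by simp
          then have "((\<lambda>y::real. sgn y * \<bar>y\<bar> powr (p - 1)) \<longlongrightarrow> 0) (at 0)"
            by (rule Lim_null_comparison[rotated]) (auto simp: abs_mult sgn_if)
          then show ?thesis using True pq by (simp add: isCont_def)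
        qed
      qed
      then show ?thesis unfolding g_def[abs_def]
        by (rule continuous_on_compose2) (use conth in auto)
    qed
    have Ig: "integrable circle g" using contg by (rule integrable_circle_continuous)
    have gq: "\<bar>g x\<bar> powr q = \<bar>h x\<bar> powr p" for x
      using conjugate_exponent[OF pq] pq by (cases "h x = 0") (simp_all add: g_def abs_mult powr_powr)
    have gh: "g x * h x = \<bar>h x\<bar> powr p" for x
    proof -
      have "g x * h x = \<bar>h x\<bar> powr (p - 1) * \<bar>h x\<bar>"
        by (simp add: g_def sgn_if)
      also have "\<dots> = \<bar>h x\<bar> powr p"
        using powr_mult_base[of "\<bar>h x\<bar>" "p - 1"] by (simp add: mult.commute)
      finally show ?thesis .
    qed
    have Igq: "integrable circle (\<lambda>x. \<bar>g x\<bar> powr q)"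
      using contg pq by (intro integrable_powr_continuous) auto
    have intg: "pint q g = X" by (simp add: gq X_def)
    have Xeq: "X = pi * (\<Sum>k=1..N. (\<i> * u k) \<bullet> fcoef g k)"
    proof -
      have "X = (\<integral>x. g x * h x \<partial>circle)" by (simp add: X_def gh)
      then show ?thesis unfolding h_def by (simp add: integral_mult_trig[OF Ig])
    qed
    have bound: "pi * (\<Sum>k=1..N. cesaro_weight M k * ((\<i> * u k) \<bullet> fcoef g k)) \<le> t powr p * Y + X / 2"
      if M: "Suc N \<le> M" for M
    proof -
      define v where "v k = cesaro_weight M k *\<^sub>R fcoef g k" for k
      define w where "w = trig M (\<lambda>k. \<i> * v k)"
      have "pint q w \<le> C * pint q (trig M v)"
        unfolding w_def by (rule C(2))
      moreover have "pint q (trig M v) \<le> 2 powr q * (X + X)"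
      proof -
        \<comment> \<open>\<open>cesaro 1 g\<close> is the mean value of \<open>g\<close>.\<close>
        have eq: "trig M v x = cesaro M g x + - cesaro 1 g x" for x
          using cesaro_eq_trig[OF Ig, of M M x] cesaro_eq_trig[OF Ig, of 1 1 x] M
          by (simp add: v_def[abs_def] cesaro_weight_def trig_def)
        have cq: "integrable circle (\<lambda>x. \<bar>cesaro j g x\<bar> powr q)" for j
          using pq by (intro integrable_powr_continuous continuous_cesaro Ig) auto
        have "pint q (trig M v)
           \<le> 2 powr q * (pint q (cesaro M g) + (\<integral>x. \<bar>- cesaro 1 g x\<bar> powr q \<partial>circle))"
          unfolding eq using pq Ig cq by (intro integral_powr_add_le) auto
        also have "\<dots> = 2 powr q * (pint q (cesaro M g) + pint q (cesaro 1 g))"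
          by simp
        also have "\<dots> \<le> 2 powr q * (X + X)"
          unfolding intg[symmetric] using pq M Ig Igq
          by (intro mult_left_mono add_mono cesaro_powr_contraction) auto
        finally show ?thesis .
      qed
      ultimately have wX: "pint q w \<le> D * X"
        using mult_left_mono[OF _ C(1), of "\<integral>x. \<bar>trig M v x\<bar> powr q \<partial>circle" "2 powr q * (X + X)"]
        by (simp add: D_def algebra_simps)
      have "pi * (\<Sum>k=1..N. cesaro_weight M k * ((\<i> * u k) \<bullet> fcoef g k)) = - (pi * (\<Sum>k=1..N. (\<i> * v k) \<bullet> u k))"
        by (simp add: v_def inner_complex_def sum_negf[symmetric] algebra_simps sum_subtractf flip: sum_distrib_left)
      also have "(\<Sum>k=1..N. (\<i> * v k) \<bullet> u k) = (\<Sum>k=1..M. (\<i> * v k) \<bullet> fcoef f k)"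
        by (rule sum.mono_neutral_cong_left) (use M in \<open>auto simp: f_def fcoef_trig'\<close>)
      also have "pi * \<dots> = (\<integral>x. f x * w x \<partial>circle)"
        unfolding w_def by (rule integral_mult_trig[symmetric]) (simp add: f_def)
      also have "- \<dots> \<le> (\<integral>x. t powr p * \<bar>f x\<bar> powr p + (1 / t) powr q * \<bar>w x\<bar> powr q \<partial>circle)"
        unfolding Bochner_Integration.integral_minus[symmetric]
      proof (rule integral_mono)
        show "integrable circle (\<lambda>x. - (f x * w x))"
          unfolding f_def w_def by (intro integrable_circle_continuous continuous_intros)
        show "integrable circle (\<lambda>x. t powr p * \<bar>f x\<bar> powr p + (1 / t) powr q * \<bar>w x\<bar> powr q)"
          unfolding f_def w_def using pq
          by (intro Bochner_Integration.integrable_add integrable_mult_right integrable_trig_powr) auto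
        fix x
        have "- (f x * w x) \<le> \<bar>f x\<bar> * \<bar>w x\<bar>" by (metis abs_ge_minus_self abs_mult)
        also have "\<dots> = (t * \<bar>f x\<bar>) * (1 / t * \<bar>w x\<bar>)" using t by simp
        also have "\<dots> \<le> (t * \<bar>f x\<bar>) powr p + (1 / t * \<bar>w x\<bar>) powr q"
          using t by (intro young_powr pq) auto
        also have "\<dots> = t powr p * \<bar>f x\<bar> powr p + (1 / t) powr q * \<bar>w x\<bar> powr q"
          using t by (simp only: powr_mult abs_ge_zero less_imp_le zero_less_divide_1_iff)
        finally show "- (f x * w x) \<le> t powr p * \<bar>f x\<bar> powr p + (1 / t) powr q * \<bar>w x\<bar> powr q" .
      qed
      also have "\<dots> = t powr p * Y + (1 / t) powr q * pint q w"
        unfolding Y_def f_def w_def using pq integrable_trig_powr[of p] integrable_trig_powr[of q] by simp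
      also have "\<dots> \<le> t powr p * Y + (1 / t) powr q * (D * X)"
        using wX by (simp add: mult_left_mono)
      also have "(1 / t) powr q * (D * X) \<le> X / 2"
      proof -
        have "(1 / t) powr q = 1 / (2 * D + 1)" using t by (simp add: powr_divide)
        moreover have "0 \<le> X" by (simp add: X_def)
        moreover have "D / (2 * D + 1) \<le> 1 / 2" using D by (simp add: field_simps)
        ultimately show ?thesis using mult_right_mono[of "D / (2 * D + 1)" "1/2" X] by simp
      qed
      finally show ?thesis by simp
    qed
    have "(\<lambda>M. pi * (\<Sum>k=1..N. cesaro_weight M k * ((\<i> * u k) \<bullet> fcoef g k)))
        \<longlonglongrightarrow> pi * (\<Sum>k=1..N. 1 * ((\<i> * u k) \<bullet> fcoef g k))"
      by (intro tendsto_intros cesaro_weight_tendsto)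
    moreover have "\<forall>\<^sub>F M in sequentially. pi * (\<Sum>k=1..N. cesaro_weight M k * ((\<i> * u k) \<bullet> fcoef g k)) \<le> t powr p * Y + X / 2"
      using eventually_ge_at_top[of "Suc N"] by eventually_elim (rule bound)
    ultimately have "pi * (\<Sum>k=1..N. 1 * ((\<i> * u k) \<bullet> fcoef g k)) \<le> t powr p * Y + X / 2"
      by (rule tendsto_upperbound) simp
    then have "X \<le> t powr p * Y + X / 2" unfolding Xeq by simp
    then show ?thesis by (simp add: X_def Y_def f_def h_def)
  qed
  then show ?thesis unfolding conjugation_bounded_def
    by (intro exI[of _ "2 * t powr p"] conjI) auto
qed

theorem conjugation_bounded:
  assumes "1 < p"
  shows "conjugation_bounded p"
proof (cases "p \<le> 2")
  case False
  define q where "q = p / (p - 1)"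
  have q: "1 < q" "q \<le> 2" "1 / p + 1 / q = 1" using False assms by (auto simp: q_def field_simps)
  then show ?thesis
    using conjugation_bounded_dual[OF conjugation_bounded_le_2[of q]] assms by blast
qed (use assms conjugation_bounded_le_2 in blast)

text \<open>
  A rotation of all phases by \<open>\<theta>\<close> is \<open>cos \<theta>\<close> times the identity plus \<open>sin \<theta>\<close> times conjugation.
\<close>

lemma rotation_bounded:
  assumes "1 < p"
  obtains C where "0 < C" "\<And>N u \<theta>. pint p (trig N (\<lambda>k. cis \<theta> * u k)) \<le> C * pint p (trig N u)"
proof -
  obtain C where C: "0 \<le> C" "\<And>N u. pint p (trig N (\<lambda>k. \<i> * u k)) \<le> C * pint p (trig N u)"
    using conjugation_bounded[OF assms] unfolding conjugation_bounded_def by blast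
  show ?thesis
  proof (rule that)
    show "0 < 2 powr p * (1 + C)" using C by simp
    fix N u \<theta>
    have I: "integrable circle (\<lambda>x. \<bar>c * trig N v x\<bar> powr p)" for c v
      using assms by (intro integrable_powr_continuous continuous_intros) auto
    have "pint p (trig N (\<lambda>k. cis \<theta> * u k))
      \<le> 2 powr p * ((\<integral>x. \<bar>cos \<theta> * trig N u x\<bar> powr p \<partial>circle) + (\<integral>x. \<bar>sin \<theta> * trig N (\<lambda>k. \<i> * u k) x\<bar> powr p \<partial>circle))"
      unfolding trig_multiplier_rotate using assms by (intro integral_powr_add_le I) auto
    also have "\<dots> \<le> 2 powr p * (pint p (trig N u) + pint p (trig N (\<lambda>k. \<i> * u k)))"
      using assms by (intro mult_left_mono add_mono integral_mono I integrable_trig_powr powr_mono2)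
         (auto simp: abs_mult mult_left_le_one_le)
    also have "\<dots> \<le> 2 powr p * (pint p (trig N u) + C * pint p (trig N u))"
      using C by (intro mult_left_mono add_mono) auto
    finally show "pint p (trig N (\<lambda>k. cis \<theta> * u k)) \<le> 2 powr p * (1 + C) * pint p (trig N u)"
      by (simp add: algebra_simps)
  qed
qed

section \<open>Nonnegative combinations of Fejer means\<close>

lemma powr_mean_value:
  fixes a b s :: real
  assumes "0 < a" "a < b"
  obtains z where "a < z" "z < b" "b powr s - a powr s = (b - a) * (s * z powr (s - 1))"
proof -
  have "\<And>x. a \<le> x \<Longrightarrow> x \<le> b \<Longrightarrow> ((\<lambda>x. x powr s) has_real_derivative s * x powr (s - 1)) (at x)"
    using assms by (intro has_real_derivative_powr) auto
  from MVT2[OF assms(2) this] that show ?thesis by blast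
qed

lemma sum_powr_increasing:
  assumes s: "0 < s" "s \<le> 1"
  shows "(\<Sum>k=1..m. real k powr (s - 1)) \<le> real m powr s / s"
proof (induction m)
  case (Suc m)
  have "real (Suc m) powr (s - 1) \<le> (real (Suc m) powr s - real m powr s) / s"
  proof (cases "m = 0")
    case False
    then obtain z where z: "real m < z" "z < real (Suc m)"
      "real (Suc m) powr s - real m powr s = (real (Suc m) - real m) * (s * z powr (s - 1))"
      using powr_mean_value[of "real m" "real (Suc m)" s] by auto
    have "real (Suc m) powr (s - 1) \<le> z powr (s - 1)"
      using z s False by (intro powr_mono2') auto
    then show ?thesis using z(3) s by simp
  qed (use s in \<open>simp add: field_simps\<close>)
  then show ?case using Suc by (simp add: diff_divide_distrib)
qed simp

lemma sum_powr_decreasing: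
  assumes a: "0 < a" and "1 \<le> m"
  shows "(\<Sum>k=m+1..M. real k powr (- a - 1)) \<le> real m powr (- a) / a"
proof (cases "m \<le> M")
  case True
  then have "(\<Sum>k=m+1..M. real k powr (- a - 1)) \<le> (real m powr (- a) - real M powr (- a)) / a"
  proof (induction rule: dec_induct)
    case (step n)
    have n: "1 \<le> n" using step \<open>1 \<le> m\<close> by simp
    obtain z where z: "real n < z" "z < real (Suc n)"
      "real (Suc n) powr (- a) - real n powr (- a) = (real (Suc n) - real n) * (- a * z powr (- a - 1))"
      using powr_mean_value[of "real n" "real (Suc n)" "- a"] n by auto
    have "real (Suc n) powr (- a - 1) \<le> z powr (- a - 1)"
      using z n a by (intro powr_mono2') auto
    moreover have "real n powr (- a) - real (Suc n) powr (- a) = a * z powr (- a - 1)" using z(3) by simp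
    ultimately have "real (Suc n) powr (- a - 1) \<le> (real n powr (- a) - real (Suc n) powr (- a)) / a"
      using a by simp
    then show ?case using step by (simp add: diff_divide_distrib)
  qed simp
  also have "\<dots> \<le> real m powr (- a) / a" using a by (intro divide_right_mono) auto
  finally show ?thesis .
qed (use a in simp)

text \<open>
  The two members of the minimum balance at \<open>k = \<tau>\<^sup>p\<close>. The terms before this point grow like a sum of
  \<open>k\<^bsup>1/q-1\<^esup>\<close> and those behind it decay like a tail of \<open>\<tau> k\<^bsup>-a-1\<^esup>\<close>; both parts are of order
  \<open>\<tau>\<^bsup>p/q\<^esup>\<close>, because \<open>1 - p a = p/q\<close>.
\<close>

lemma sum_min_powr:
  fixes p q a \<tau> :: real
  assumes pq: "1 < p" "p < q" and a: "a = 1 / p - 1 / q" and tau: "0 \<le> \<tau>"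
  shows "(\<Sum>k=1..M. real k powr (- a - 1) * min \<tau> (real k powr (1 / p))) \<le> (q + 2 powr a / a + 1) * \<tau> powr (p / q)"
proof (cases "\<tau> = 0")
  case True
  then show ?thesis by (simp add: min_def)
next
  case False
  then have t: "0 < \<tau>" using tau by simp
  have a0: "0 < a" using pq by (simp add: a field_simps)
  have pa: "1 - p * a = p / q" using pq by (simp add: a field_simps)
  define m where "m = nat \<lfloor>\<tau> powr p\<rfloor>"
  have m: "real m \<le> \<tau> powr p" "\<tau> powr p < real m + 1" unfolding m_def by (auto simp: of_nat_nat)
  let ?T = "\<lambda>k. real k powr (- a - 1) * min \<tau> (real k powr (1 / p))"
  have "(\<Sum>k=1..M. ?T k) \<le> (\<Sum>k\<in>{1..m} \<union> {m+1..max m M}. ?T k)"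
    by (rule sum_mono2) (use tau in auto)
  also have "\<dots> = (\<Sum>k=1..m. ?T k) + (\<Sum>k=m+1..max m M. ?T k)"
    by (rule sum.union_disjoint) auto
  finally have split: "(\<Sum>k=1..M. ?T k) \<le> (\<Sum>k=1..m. ?T k) + (\<Sum>k=m+1..max m M. ?T k)" .
  have low: "(\<Sum>k=1..m. ?T k) \<le> q * \<tau> powr (p / q)"
  proof -
    have "(\<Sum>k=1..m. ?T k) \<le> (\<Sum>k=1..m. real k powr (1 / q - 1))"
    proof (rule sum_mono)
      fix k assume "k \<in> {1..m}"
      have "?T k \<le> real k powr (- a - 1) * real k powr (1 / p)" by (intro mult_left_mono) auto
      also have "\<dots> = real k powr (1 / q - 1)" by (simp add: powr_add[symmetric] a)
      finally show "?T k \<le> real k powr (1 / q - 1)" .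
    qed
    also have "\<dots> \<le> real m powr (1 / q) / (1 / q)" by (rule sum_powr_increasing) (use pq in auto)
    also have "\<dots> = q * real m powr (1 / q)" by simp
    also have "real m powr (1 / q) \<le> (\<tau> powr p) powr (1 / q)" using m pq by (intro powr_mono2) auto
    also have "\<dots> = \<tau> powr (p / q)" by (simp add: powr_powr)
    finally show ?thesis using pq by simp
  qed
  have high: "(\<Sum>k=m+1..max m M. ?T k) \<le> (2 powr a / a + 1) * \<tau> powr (p / q)"
  proof -
    have "(\<Sum>k=m+1..max m M. ?T k) \<le> (\<Sum>k=m+1..max m M. real k powr (- a - 1) * \<tau>)"
      by (intro sum_mono mult_left_mono) auto
    also have "\<dots> = (\<Sum>k=m+1..max m M. real k powr (- a - 1)) * \<tau>" by (simp add: sum_distrib_right)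
    also have "\<dots> \<le> (2 powr a / a + 1) * \<tau> powr (p / q)"
    proof (cases "m = 0")
      case True
      have "\<tau> powr p < 1 powr p" using m True by simp
      then have t1: "\<tau> < 1" using t pq by (metis powr_less_cancel2 zero_less_one less_trans)
      have "(\<Sum>k=1..max m M. real k powr (- a - 1)) \<le> (\<Sum>k\<in>{1} \<union> {1+1..max m M}. real k powr (- a - 1))"
        by (rule sum_mono2) auto
      also have "\<dots> = 1 + (\<Sum>k=1+1..max m M. real k powr (- a - 1))"
        by (subst sum.union_disjoint) auto
      also have "\<dots> \<le> 1 + real 1 powr (- a) / a" using a0 by (intro add_left_mono sum_powr_decreasing) auto
      also have "\<dots> \<le> 2 powr a / a + 1" using a0 by (simp add: divide_right_mono ge_one_powr_ge_zero)
      finally have "(\<Sum>k=m+1..max m M. real k powr (- a - 1)) * \<tau> \<le> (2 powr a / a + 1) * \<tau>"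
        using True t by simp
      moreover have "\<tau> \<le> \<tau> powr (p / q)" using t t1 pq powr_mono'[of "p / q" 1 \<tau>] by simp
      then have "(2 powr a / a + 1) * \<tau> \<le> (2 powr a / a + 1) * \<tau> powr (p / q)"
        using a0 by (intro mult_left_mono) auto
      ultimately show ?thesis by linarith
    next
      case False
      then have m1: "1 \<le> m" by simp
      have "(\<Sum>k=m+1..max m M. real k powr (- a - 1)) \<le> real m powr (- a) / a"
        by (rule sum_powr_decreasing[OF a0 m1])
      also have "real m powr (- a) \<le> (\<tau> powr p / 2) powr (- a)"
        using m m1 a0 t by (intro powr_mono2') auto
      also have "\<dots> = 2 powr a * \<tau> powr (- p * a)"
        using t by (simp add: powr_divide powr_powr powr_minus field_simps)
      finally have "(\<Sum>k=m+1..max m M. real k powr (- a - 1)) \<le> 2 powr a * \<tau> powr (- p * a) / a"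
        using a0 by (simp add: divide_right_mono)
      from mult_right_mono[OF this tau]
      have "(\<Sum>k=m+1..max m M. real k powr (- a - 1)) * \<tau> \<le> 2 powr a * \<tau> powr (- p * a) / a * \<tau>" .
      also have "2 powr a * \<tau> powr (- p * a) / a * \<tau> = 2 powr a / a * (\<tau> powr (- p * a) * \<tau> powr 1)" using t by simp
      also have "\<tau> powr (- p * a) * \<tau> powr 1 = \<tau> powr (p / q)"
        unfolding powr_add[symmetric] pa[symmetric] by (simp add: algebra_simps)
      also have "2 powr a / a * \<dots> \<le> (2 powr a / a + 1) * \<tau> powr (p / q)"
        by (simp add: algebra_simps)
      finally show ?thesis .
    qed
    finally show ?thesis .
  qed
  have "(q + 2 powr a / a + 1) * \<tau> powr (p / q) = q * \<tau> powr (p / q) + (2 powr a / a + 1) * \<tau> powr (p / q)"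
    by (simp only: distrib_right add.assoc)
  then show ?thesis by (simp only:) (rule order_trans[OF split add_mono[OF low high]])
qed

lemma integrable_continuous_powr:
  fixes u :: "real \<Rightarrow> real"
  assumes "continuous_on UNIV u" "\<And>x. 0 \<le> u x" "0 < p"
  shows "integrable circle (\<lambda>x. u x powr p)"
  using integrable_powr_continuous[OF assms(1,3)] assms(2) by simp

text \<open>
  The second bound is Jensen's inequality together with \<open>fejer k \<le> k\<close>: the mean of order \<open>k\<close> sees a
  function of \<open>L\<^sub>p\<close> at the scale \<open>1/k\<close>.
\<close>

lemma cesaro_min_le:
  fixes u :: "real \<Rightarrow> real"
  assumes p: "1 < p" and k: "0 < k" and tau: "0 \<le> \<tau>"
    and u: "continuous_on UNIV u" "\<And>x. 0 \<le> u x" "(\<integral>x. u x powr p \<partial>circle) \<le> 1"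
  shows "cesaro k (\<lambda>t. min (u t) \<tau>) x \<le> min \<tau> (real k powr (1 / p))"
proof -
  have Iu: "integrable circle u" using u(1) by (rule integrable_circle_continuous)
  have Im: "integrable circle (\<lambda>t. min (u t) \<tau>)"
    by (intro integrable_circle_continuous continuous_intros u(1))
  have Ip: "integrable circle (\<lambda>x. u x powr p)" using u p by (intro integrable_continuous_powr) auto
  have "cesaro k (\<lambda>t. min (u t) \<tau>) x \<le> cesaro k (\<lambda>t. \<tau>) x"
    using Im by (intro cesaro_mono) auto
  then have 1: "cesaro k (\<lambda>t. min (u t) \<tau>) x \<le> \<tau>" using k by (simp add: cesaro_const)
  have "cesaro k (\<lambda>t. min (u t) \<tau>) x \<le> cesaro k u x"
    using Im Iu by (intro cesaro_mono) auto
  also have "\<dots> \<le> real k powr (1 / p)"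
  proof -
    have "(cesaro k u x) powr p \<le> cesaro k (\<lambda>x. u x powr p) x"
      by (rule cesaro_jensen[OF p k u(2) Iu Ip])
    also have "\<dots> \<le> (\<integral>t. u t powr p * real k \<partial>circle) / (2 * pi)"
      unfolding cesaro_def using Ip
      by (intro divide_right_mono integral_mono integrable_mult_fejer mult_left_mono fejer_le) auto
    also have "\<dots> \<le> (1 * real k) / (2 * pi)"
      using Ip mult_right_mono[OF u(3), of "real k"] by (intro divide_right_mono) auto
    also have "\<dots> \<le> real k"
      using pi_gt3 mult_left_mono[of 1 "2 * pi" "real k"] by (simp add: divide_le_eq)
    finally have "((cesaro k u x) powr p) powr (1 / p) \<le> real k powr (1 / p)"
      using p by (intro powr_mono2) auto
    then show ?thesis using p u(2) by (simp add: powr_powr cesaro_nonneg)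
  qed
  finally show ?thesis using 1 by simp
qed

definition fejer_kernel :: "(nat \<Rightarrow> real) \<Rightarrow> nat \<Rightarrow> real \<Rightarrow> real \<Rightarrow> real" where
  "fejer_kernel v M x t = (\<Sum>k=1..M. v k * fejer k (x - t)) / (2 * pi)"

lemma fejer_kernel_sym: "fejer_kernel v M x t = fejer_kernel v M t x"
  by (simp add: fejer_kernel_def fejer_minus[of _ x t])

lemma fejer_kernel_nonneg: "(\<And>k. 0 \<le> v k) \<Longrightarrow> 0 \<le> fejer_kernel v M x t"
  unfolding fejer_kernel_def by (intro divide_nonneg_nonneg sum_nonneg mult_nonneg_nonneg) (auto simp: fejer_nonneg)

lemma continuous_fejer_kernel: "continuous_on UNIV (fejer_kernel v M x)"
  unfolding fejer_kernel_def[abs_def] divide_inverse by (intro continuous_intros)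

lemma fejer_kernel_measurable [measurable]:
  "(\<lambda>(x, t). fejer_kernel v M x t) \<in> borel_measurable (borel \<Otimes>\<^sub>M borel)"
  unfolding fejer_kernel_def by measurable

lemma integral_fejer_kernel:
  assumes "integrable circle f"
  shows "(\<integral>t. f t * fejer_kernel v M x t \<partial>circle) = (\<Sum>k=1..M. v k * cesaro k f x)"
proof -
  have "(\<integral>t. f t * fejer_kernel v M x t \<partial>circle) = (\<integral>t. (\<Sum>k=1..M. v k * (f t * fejer k (x - t)) / (2 * pi)) \<partial>circle)"
    unfolding fejer_kernel_def
    by (intro Bochner_Integration.integral_cong refl) (simp add: sum_divide_distrib sum_distrib_left mult.left_commute)
  also have "\<dots> = (\<Sum>k=1..M. v k * cesaro k f x)"
    using integrable_mult_fejer[OF assms]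
    by (subst Bochner_Integration.integral_sum) (auto simp: cesaro_def)
  finally show ?thesis .
qed

text \<open>
  The exponents that occur when \<open>r\<close> and \<open>s\<close> are dual to \<open>q\<close> and \<open>p\<close>: \<open>1 + r/q = r\<close> and \<open>1 + p/s = p\<close>.
\<close>

lemma dual_exponent:
  fixes q :: real
  assumes "1 < q"
  shows "1 + q / (q - 1) / q = q / (q - 1)" "1 + q / (q / (q - 1)) = q"
proof -
  have "q / (q - 1) = ((q - 1) + 1) / (q - 1)" by simp
  also have "\<dots> = 1 + 1 / (q - 1)" using assms by (subst add_divide_distrib) simp
  finally have "q / (q - 1) = 1 + 1 / (q - 1)" .
  moreover have "q / (q - 1) / q = 1 / (q - 1)" using assms by simp
  ultimately show "1 + q / (q - 1) / q = q / (q - 1)" by (simp only:)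
  show "1 + q / (q / (q - 1)) = q" using assms by simp
qed

lemma fejer_kernel_min_le:
  fixes u :: "real \<Rightarrow> real"
  assumes pq: "1 < p" "p < q" and v: "\<And>k. 0 \<le> v k" "\<And>k. 1 \<le> k \<Longrightarrow> v k \<le> D * real k powr (- (1 / p - 1 / q) - 1)"
    and D: "0 \<le> D" and tau: "0 \<le> \<tau>"
    and u: "continuous_on UNIV u" "\<And>x. 0 \<le> u x" "(\<integral>x. u x powr p \<partial>circle) \<le> 1"
  shows "(\<integral>t. min (u t) \<tau> * fejer_kernel v M x t \<partial>circle)
    \<le> D * (q + 2 powr (1 / p - 1 / q) / (1 / p - 1 / q) + 1) * \<tau> powr (p / q)"
proof -
  let ?a = "1 / p - 1 / q"
  have Im: "integrable circle (\<lambda>t. min (u t) \<tau>)"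
    by (intro integrable_circle_continuous continuous_intros u(1))
  have "(\<integral>t. min (u t) \<tau> * fejer_kernel v M x t \<partial>circle) = (\<Sum>k=1..M. v k * cesaro k (\<lambda>t. min (u t) \<tau>) x)"
    by (rule integral_fejer_kernel[OF Im])
  also have "\<dots> \<le> (\<Sum>k=1..M. (D * real k powr (- ?a - 1)) * min \<tau> (real k powr (1 / p)))"
  proof (intro sum_mono mult_mono)
    fix k assume k: "k \<in> {1..M}"
    then show "v k \<le> D * real k powr (- ?a - 1)" using v(2) by simp
    show "cesaro k (\<lambda>t. min (u t) \<tau>) x \<le> min \<tau> (real k powr (1 / p))"
      using k pq tau by (intro cesaro_min_le u) auto
    show "0 \<le> cesaro k (\<lambda>t. min (u t) \<tau>) x" using u tau by (intro cesaro_nonneg) auto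
  qed (use D in auto)
  also have "\<dots> = D * (\<Sum>k=1..M. real k powr (- ?a - 1) * min \<tau> (real k powr (1 / p)))"
    by (simp add: sum_distrib_left mult.assoc)
  also have "\<dots> \<le> D * ((q + 2 powr ?a / ?a + 1) * \<tau> powr (p / q))"
    using D by (intro mult_left_mono sum_min_powr pq tau) auto
  finally show ?thesis by (simp only: mult.assoc)
qed

text \<open>
  Bilinear form of the Hardy-Littlewood-Sobolev inequality. Of two numbers \<open>u, g\<close> either \<open>u \<le> g\<^bsup>r/p\<^esup>\<close> or
  \<open>g \<le> u\<^bsup>p/r\<^esup>\<close>. Hence the product \<open>u(t) g(x)\<close> is bounded by the sum of two products with one
  truncated factor, and the truncated factor can be integrated against the kernel by itself
  (\<open>fejer_kernel_min_le\<close>): the powers of the truncation level that arise make the two products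
  integrable as \<open>g\<^sup>r\<close> and as \<open>u\<^sup>p\<close>. The second one uses the first estimate for the dual exponents,
  which have the same difference \<open>1/r - 1/s = 1/p - 1/q\<close>.
\<close>

lemma hardy_littlewood_sobolev_bilinear:
  fixes u g :: "real \<Rightarrow> real"
  assumes pq: "1 < p" "p < q" and r: "r = q / (q - 1)"
    and v: "\<And>k. 0 \<le> v k" "\<And>k. 1 \<le> k \<Longrightarrow> v k \<le> D * real k powr (- (1 / p - 1 / q) - 1)" and D: "0 \<le> D"
    and u: "continuous_on UNIV u" "\<And>x. 0 \<le> u x" "(\<integral>x. u x powr p \<partial>circle) \<le> 1"
    and g: "continuous_on UNIV g" "\<And>x. 0 \<le> g x" "(\<integral>x. g x powr r \<partial>circle) \<le> 1"
  shows "(\<integral>x. g x * (\<Sum>k=1..M. v k * cesaro k u x) \<partial>circle)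
    \<le> D * (q + 2 powr (1 / p - 1 / q) / (1 / p - 1 / q) + 1)
      + D * (p / (p - 1) + 2 powr (1 / p - 1 / q) / (1 / p - 1 / q) + 1)"
proof -
  define s where "s = p / (p - 1)"
  let ?a = "1 / p - 1 / q"
  have "r = 1 + 1 / (q - 1)" "s = 1 + 1 / (p - 1)"
    using pq dual_exponent(1)[of q] dual_exponent(1)[of p] by (simp_all add: r s_def)
  moreover have "1 / (q - 1) < 1 / (p - 1)" using pq by (intro divide_strict_left_mono) auto
  ultimately have rs: "1 < r" "r < s" using pq by auto
  have "1 / r = 1 - 1 / q" "1 / s = 1 - 1 / p" using pq by (simp_all add: r s_def diff_divide_distrib)
  then have ars: "1 / r - 1 / s = ?a" by simp
  have a0: "0 < ?a" using pq by (simp add: field_simps)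
  define C1 where "C1 = D * (q + 2 powr ?a / ?a + 1)"
  define C2 where "C2 = D * (s + 2 powr ?a / ?a + 1)"
  have C: "0 \<le> C1" "0 \<le> C2" using D a0 pq rs by (auto simp: C1_def C2_def)
  define K where "K = fejer_kernel v M"
  have K0: "0 \<le> K x t" for x t unfolding K_def by (rule fejer_kernel_nonneg[OF v(1)])
  have contK: "continuous_on UNIV (K x)" for x unfolding K_def by (rule continuous_fejer_kernel)
  have [measurable]: "u \<in> borel_measurable borel" "g \<in> borel_measurable borel"
    using u(1) g(1) by (auto intro: borel_measurable_continuous_onI)
  have Km[measurable]: "(\<lambda>(x, t). K x t) \<in> borel_measurable (borel \<Otimes>\<^sub>M borel)"
    unfolding K_def by measurable
  have Km2[measurable]: "(\<lambda>z. K (fst z) (snd z)) \<in> borel_measurable (circle \<Otimes>\<^sub>M circle)"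
  proof -
    have "(\<lambda>z. (fst z, snd z)) \<in> measurable (circle \<Otimes>\<^sub>M circle) (borel \<Otimes>\<^sub>M borel)"
      by (intro measurable_Pair measurable_compose[OF measurable_fst] measurable_compose[OF measurable_snd]) auto
    from measurable_compose[OF this Km] show ?thesis by (simp add: case_prod_beta)
  qed
  have [measurable]: "(\<lambda>z. u (snd z)) \<in> borel_measurable (circle \<Otimes>\<^sub>M circle)"
    "(\<lambda>z. g (fst z)) \<in> borel_measurable (circle \<Otimes>\<^sub>M circle)"
    by (intro measurable_compose[OF measurable_snd] measurable_compose[OF measurable_fst]; measurable)+
  have M1: "(\<lambda>(x, t). ennreal (g x * min (u t) (g x powr (r / p)) * K x t)) \<in> borel_measurable (circle \<Otimes>\<^sub>M circle)"
    unfolding case_prod_beta by measurable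
  have M2: "(\<lambda>(x, t). ennreal (u t * min (g x) (u t powr (p / r)) * K x t)) \<in> borel_measurable (circle \<Otimes>\<^sub>M circle)"
    unfolding case_prod_beta by measurable
  have Iu: "integrable circle u" using u(1) by (rule integrable_circle_continuous)
  have split: "g x * u t \<le> g x * min (u t) (g x powr (r / p)) + u t * min (g x) (u t powr (p / r))" for x t
  proof (cases "u t \<le> g x powr (r / p)")
    case True
    then show ?thesis using u(2) g(2) by (simp add: min_def)
  next
    case False
    then have "(g x powr (r / p)) powr (p / r) \<le> u t powr (p / r)"
      using pq rs by (intro powr_mono2) auto
    then have "g x \<le> u t powr (p / r)" using pq rs g(2)[of x] by (simp add: powr_powr)
    then show ?thesis using u(2)[of t] g(2)[of x] by (simp add: min_def mult.commute)
  qed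
  have contm: "continuous_on UNIV (\<lambda>t. min (f t) \<tau> * K x t)" if "continuous_on UNIV f" for f :: "real \<Rightarrow> real" and \<tau> x
    by (intro continuous_intros that contK)
  have nn: "(\<integral>\<^sup>+t. ennreal (c * min (f t) \<tau> * K x t) \<partial>circle) = ennreal (c * (\<integral>t. min (f t) \<tau> * K x t \<partial>circle))"
    if f: "continuous_on UNIV f" "\<And>t. 0 \<le> f t" and c: "0 \<le> c" "0 \<le> \<tau>" for c f \<tau> x
  proof -
    have I: "integrable circle (\<lambda>t. c * (min (f t) \<tau> * K x t))"
      by (intro integrable_mult_right integrable_circle_continuous contm f)
    have "(\<integral>\<^sup>+t. ennreal (c * (min (f t) \<tau> * K x t)) \<partial>circle) = ennreal (\<integral>t. c * (min (f t) \<tau> * K x t) \<partial>circle)"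
      by (rule nn_integral_eq_integral[OF I AE_I2]) (intro mult_nonneg_nonneg f c K0 min.boundedI)
    then show ?thesis by (simp only: mult.assoc Bochner_Integration.integral_mult_right_zero)
  qed
  have first: "(\<integral>\<^sup>+t. ennreal (g x * min (u t) (g x powr (r / p)) * K x t) \<partial>circle) \<le> ennreal (C1 * g x powr r)" for x
  proof -
    have "(\<integral>\<^sup>+t. ennreal (g x * min (u t) (g x powr (r / p)) * K x t) \<partial>circle)
        = ennreal (g x * (\<integral>t. min (u t) (g x powr (r / p)) * K x t \<partial>circle))"
      by (intro nn u g powr_ge_zero)
    also have "\<dots> \<le> ennreal (g x * (C1 * (g x powr (r / p)) powr (p / q)))"
      unfolding C1_def K_def
      by (intro ennreal_leI mult_left_mono fejer_kernel_min_le pq v D u g powr_ge_zero)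
    also have "g x * (C1 * (g x powr (r / p)) powr (p / q)) = C1 * (g x powr 1 * g x powr (r / q))"
      using pq g(2)[of x] by (simp add: powr_powr)
    also have "g x powr 1 * g x powr (r / q) = g x powr r"
    proof -
      have "1 + r / q = r" unfolding r by (rule dual_exponent) (use pq in linarith)
      then show ?thesis unfolding powr_add[symmetric] by simp
    qed
    finally show ?thesis .
  qed
  have second: "(\<integral>\<^sup>+x. ennreal (u t * min (g x) (u t powr (p / r)) * K x t) \<partial>circle) \<le> ennreal (C2 * u t powr p)" for t
  proof -
    have "(\<integral>\<^sup>+x. ennreal (u t * min (g x) (u t powr (p / r)) * K x t) \<partial>circle)
        = ennreal (u t * (\<integral>x. min (g x) (u t powr (p / r)) * K t x \<partial>circle))"
      unfolding K_def fejer_kernel_sym[of v M _ t] unfolding K_def[symmetric]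
      by (intro nn u g powr_ge_zero)
    also have "\<dots> \<le> ennreal (u t * (C2 * (u t powr (p / r)) powr (r / s)))"
      unfolding C2_def K_def ars[symmetric]
      by (intro ennreal_leI mult_left_mono fejer_kernel_min_le rs v[folded ars] D u g powr_ge_zero)
    also have "u t * (C2 * (u t powr (p / r)) powr (r / s)) = C2 * (u t powr 1 * u t powr (p / s))"
      using rs u(2)[of t] by (simp add: powr_powr)
    also have "u t powr 1 * u t powr (p / s) = u t powr p"
    proof -
      have "1 + p / s = p" unfolding s_def by (rule dual_exponent) (use pq in linarith)
      then show ?thesis unfolding powr_add[symmetric] by simp
    qed
    finally show ?thesis .
  qed
  let ?h = "\<lambda>x. \<Sum>k=1..M. v k * cesaro k u x"
  have h0: "0 \<le> ?h x" for x using v(1) u(2) by (intro sum_nonneg mult_nonneg_nonneg cesaro_nonneg) auto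
  have conth: "continuous_on UNIV ?h"
    by (intro continuous_intros continuous_cesaro Iu)
  have Igh: "integrable circle (\<lambda>x. g x * ?h x)"
    by (intro integrable_circle_continuous continuous_on_mult g conth)
  have Ig: "integrable circle (\<lambda>x. g x powr r)" using g rs by (intro integrable_continuous_powr) auto
  have Iup: "integrable circle (\<lambda>x. u x powr p)" using u pq by (intro integrable_continuous_powr) auto
  have "ennreal (\<integral>x. g x * ?h x \<partial>circle) = (\<integral>\<^sup>+x. ennreal (g x * ?h x) \<partial>circle)"
    using h0 g(2) Igh by (intro nn_integral_eq_integral[symmetric]) auto
  also have "\<dots> = (\<integral>\<^sup>+x. \<integral>\<^sup>+t. ennreal (g x * u t * K x t) \<partial>circle \<partial>circle)"
  proof (rule nn_integral_cong)
    fix x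
    have "integrable circle (\<lambda>t. u t * K x t)"
      by (intro integrable_circle_continuous continuous_intros u contK)
    then have "(\<integral>\<^sup>+t. ennreal (g x * (u t * K x t)) \<partial>circle) = ennreal (\<integral>t. g x * (u t * K x t) \<partial>circle)"
      using K0 u(2) g(2) by (intro nn_integral_eq_integral) auto
    also have "(\<integral>t. g x * (u t * K x t) \<partial>circle) = g x * ?h x"
      unfolding K_def using integral_fejer_kernel[OF Iu] by simp
    finally show "ennreal (g x * ?h x) = (\<integral>\<^sup>+t. ennreal (g x * u t * K x t) \<partial>circle)" by (simp add: mult.assoc)
  qed
  also have "\<dots> \<le> (\<integral>\<^sup>+x. \<integral>\<^sup>+t. ennreal (g x * min (u t) (g x powr (r / p)) * K x t)
        + ennreal (u t * min (g x) (u t powr (p / r)) * K x t) \<partial>circle \<partial>circle)"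
  proof (intro nn_integral_mono)
    fix x t
    have "g x * u t * K x t \<le> (g x * min (u t) (g x powr (r / p)) + u t * min (g x) (u t powr (p / r))) * K x t"
      by (intro mult_right_mono split K0)
    then have "ennreal (g x * u t * K x t) \<le> ennreal (g x * min (u t) (g x powr (r / p)) * K x t
        + u t * min (g x) (u t powr (p / r)) * K x t)"
      by (intro ennreal_leI) (simp only: distrib_right)
    also have "\<dots> = ennreal (g x * min (u t) (g x powr (r / p)) * K x t)
        + ennreal (u t * min (g x) (u t powr (p / r)) * K x t)"
      by (intro ennreal_plus mult_nonneg_nonneg min.boundedI K0 u g powr_ge_zero)
    finally show "ennreal (g x * u t * K x t) \<le> ennreal (g x * min (u t) (g x powr (r / p)) * K x t)
        + ennreal (u t * min (g x) (u t powr (p / r)) * K x t)" .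
  qed
  also have "\<dots> = (\<integral>\<^sup>+x. (\<integral>\<^sup>+t. ennreal (g x * min (u t) (g x powr (r / p)) * K x t) \<partial>circle)
      + (\<integral>\<^sup>+t. ennreal (u t * min (g x) (u t powr (p / r)) * K x t) \<partial>circle) \<partial>circle)"
    using borel_measurable_continuous_onI[OF contK]
    by (intro nn_integral_cong nn_integral_add) measurable
  also have "\<dots> = (\<integral>\<^sup>+x. \<integral>\<^sup>+t. ennreal (g x * min (u t) (g x powr (r / p)) * K x t) \<partial>circle \<partial>circle)
      + (\<integral>\<^sup>+x. \<integral>\<^sup>+t. ennreal (u t * min (g x) (u t powr (p / r)) * K x t) \<partial>circle \<partial>circle)"
    by (intro nn_integral_add circle.borel_measurable_nn_integral M1 M2)
  also have "(\<integral>\<^sup>+x. \<integral>\<^sup>+t. ennreal (u t * min (g x) (u t powr (p / r)) * K x t) \<partial>circle \<partial>circle)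
      = (\<integral>\<^sup>+t. \<integral>\<^sup>+x. ennreal (u t * min (g x) (u t powr (p / r)) * K x t) \<partial>circle \<partial>circle)"
    by (rule circle_pair.Fubini'[symmetric, OF M2])
  also have "(\<integral>\<^sup>+x. \<integral>\<^sup>+t. ennreal (g x * min (u t) (g x powr (r / p)) * K x t) \<partial>circle \<partial>circle)
      + (\<integral>\<^sup>+t. \<integral>\<^sup>+x. ennreal (u t * min (g x) (u t powr (p / r)) * K x t) \<partial>circle \<partial>circle)
     \<le> (\<integral>\<^sup>+x. ennreal (C1 * g x powr r) \<partial>circle) + (\<integral>\<^sup>+t. ennreal (C2 * u t powr p) \<partial>circle)"
    by (intro add_mono nn_integral_mono first second)
  also have "\<dots> = ennreal (\<integral>x. C1 * g x powr r \<partial>circle) + ennreal (\<integral>x. C2 * u x powr p \<partial>circle)"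
    using Ig Iup C by (subst (1 2) nn_integral_eq_integral) auto
  also have "\<dots> \<le> ennreal (C1 * 1) + ennreal (C2 * 1)"
    using g(3) u(3) C by (intro add_mono ennreal_leI) (auto intro: mult_left_mono simp del: mult_1_right)
  also have "\<dots> = ennreal (C1 + C2)" using C by simp
  finally have "(\<integral>x. g x * ?h x \<partial>circle) \<le> C1 + C2"
    using C by (simp only: ennreal_le_iff add_nonneg_nonneg)
  then show ?thesis by (simp only: C1_def C2_def s_def)
qed

text \<open>
  From the bilinear form by duality, testing with \<open>\<bar>h\<bar>\<^bsup>q-1\<^esup>\<close> for the function \<open>h\<close> to be estimated.
\<close>

lemma fejer_combination_sobolev:
  fixes \<phi> :: "real \<Rightarrow> real"
  assumes pq: "1 < p" "p < q" and D: "0 \<le> D"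
    and v: "\<And>k. 0 \<le> v k" "\<And>k. 1 \<le> k \<Longrightarrow> v k \<le> D * real k powr (- (1 / p - 1 / q) - 1)"
    and \<phi>: "continuous_on UNIV \<phi>" "pint p \<phi> \<le> 1"
  shows "(\<integral>x. \<bar>\<Sum>k=1..M. v k * cesaro k \<phi> x\<bar> powr q \<partial>circle)
    \<le> (D * (q + 2 powr (1 / p - 1 / q) / (1 / p - 1 / q) + 1)
      + D * (p / (p - 1) + 2 powr (1 / p - 1 / q) / (1 / p - 1 / q) + 1)) powr q"
proof -
  define C where "C = D * (q + 2 powr (1 / p - 1 / q) / (1 / p - 1 / q) + 1)
      + D * (p / (p - 1) + 2 powr (1 / p - 1 / q) / (1 / p - 1 / q) + 1)"
  define r where "r = q / (q - 1)"
  have "r = 1 + 1 / (q - 1)" using pq dual_exponent(1)[of q] by (simp add: r_def)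
  moreover have "(q - 1) * r = q" unfolding r_def using pq by simp
  ultimately have r: "1 < r" "(q - 1) * r = q" using pq by auto
  define h where "h x = (\<Sum>k=1..M. v k * cesaro k \<phi> x)" for x
  define X where "X = pint q h"
  have I\<phi>: "integrable circle \<phi>" using \<phi>(1) by (rule integrable_circle_continuous)
  have conth: "continuous_on UNIV h" unfolding h_def[abs_def] by (intro continuous_intros continuous_cesaro I\<phi>)
  have X0: "0 \<le> X" by (simp add: X_def)
  show ?thesis
  proof (cases "X = 0")
    case False
    then have X: "0 < X" using X0 by simp
    \<comment> \<open>The factor that normalizes \<open>g\<close> in the dual space.\<close>
    define s where "s = X powr (- 1 / r)"
    have "s powr r = X powr (- 1 / r * r)" by (simp only: s_def powr_powr)
    also have "- 1 / r * r = - 1" using r by simp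
    also have "X powr (- 1) = 1 / X" using X by (simp add: powr_minus_divide)
    finally have s: "0 < s" "s powr r = 1 / X" using X by (simp_all add: s_def)
    define g where "g x = s * \<bar>h x\<bar> powr (q - 1)" for x
    have contg: "continuous_on UNIV g"
      unfolding g_def[abs_def] using pq by (intro continuous_intros continuous_on_powr' conth) auto
    have gr: "g x powr r = 1 / X * \<bar>h x\<bar> powr q" for x
      using s r by (simp add: g_def powr_mult powr_powr)
    have "(\<integral>x. g x * \<bar>h x\<bar> \<partial>circle) \<le> (\<integral>x. g x * (\<Sum>k=1..M. v k * cesaro k (\<lambda>x. \<bar>\<phi> x\<bar>) x) \<partial>circle)"
    proof (intro integral_mono mult_left_mono)
      show "integrable circle (\<lambda>x. g x * \<bar>h x\<bar>)"
        by (intro integrable_circle_continuous continuous_intros contg conth)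
      show "integrable circle (\<lambda>x. g x * (\<Sum>k=1..M. v k * cesaro k (\<lambda>x. \<bar>\<phi> x\<bar>) x))"
        using I\<phi> \<phi>(1) by (intro integrable_circle_continuous continuous_intros contg continuous_cesaro) auto
      fix x
      have "\<bar>h x\<bar> \<le> (\<Sum>k=1..M. \<bar>v k * cesaro k \<phi> x\<bar>)" unfolding h_def by (rule sum_abs)
      also have "\<dots> \<le> (\<Sum>k=1..M. v k * cesaro k (\<lambda>x. \<bar>\<phi> x\<bar>) x)"
        using v(1) abs_cesaro_le[OF I\<phi>] by (intro sum_mono) (auto simp: abs_mult intro: mult_left_mono)
      finally show "\<bar>h x\<bar> \<le> (\<Sum>k=1..M. v k * cesaro k (\<lambda>x. \<bar>\<phi> x\<bar>) x)" .
      show "0 \<le> g x" using s by (simp add: g_def)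
    qed
    also have "\<dots> \<le> C"
      unfolding C_def
    proof (rule hardy_littlewood_sobolev_bilinear[OF pq r_def v D])
      show "continuous_on UNIV (\<lambda>x. \<bar>\<phi> x\<bar>)" by (intro continuous_intros \<phi>)
      have "(\<integral>x. g x powr r \<partial>circle) = 1 / X * X" unfolding gr X_def by simp
      then show "(\<integral>x. g x powr r \<partial>circle) \<le> 1" using X by simp
    qed (use \<phi> contg s in \<open>auto simp: g_def\<close>)
    finally have "(\<integral>x. g x * \<bar>h x\<bar> \<partial>circle) \<le> C" .
    moreover have "(\<integral>x. g x * \<bar>h x\<bar> \<partial>circle) = s * X"
    proof -
      have "g x * \<bar>h x\<bar> = s * \<bar>h x\<bar> powr q" for x
        using powr_mult_base[of "\<bar>h x\<bar>" "q - 1"] by (simp add: g_def mult_ac)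
      then show ?thesis by (simp add: X_def)
    qed
    moreover have "s * X = X powr (1 / q)"
    proof -
      have "- 1 / r + 1 = 1 / q" using pq by (simp add: r_def diff_divide_distrib)
      moreover have "s * X = X powr (- 1 / r + 1)" using X by (simp only: powr_add) (simp add: s_def)
      ultimately show ?thesis by simp
    qed
    ultimately have "(X powr (1 / q)) powr q \<le> C powr q" using pq by (intro powr_mono2) auto
    then have "X \<le> C powr q" using X pq by (simp add: powr_powr)
    then show ?thesis by (simp add: X_def h_def C_def)
  next
    case True
    then have "(\<integral>x. \<bar>\<Sum>k=1..M. v k * cesaro k \<phi> x\<bar> powr q \<partial>circle) = 0"
      by (simp only: X_def h_def)
    then show ?thesis by (simp only: powr_ge_zero)
  qed
qed

lemma sum_jensen_powr:
  fixes v s :: "nat \<Rightarrow> real"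
  assumes p: "1 < p" and "finite K" "\<And>k. k \<in> K \<Longrightarrow> 0 \<le> v k" "\<And>k. k \<in> K \<Longrightarrow> 0 \<le> s k"
  shows "(\<Sum>k\<in>K. v k * s k) powr p \<le> (\<Sum>k\<in>K. v k) powr (p - 1) * (\<Sum>k\<in>K. v k * s k powr p)"
proof (cases "(\<Sum>k\<in>K. v k) = 0")
  case True
  then have "\<forall>k\<in>K. v k = 0" using assms sum_nonneg_eq_0_iff by blast
  then show ?thesis by simp
next
  case False
  define W where "W = (\<Sum>k\<in>K. v k)"
  have W: "0 < W" using False assms sum_nonneg[of K v] by (simp add: W_def)
  define A where "A = (\<Sum>k\<in>K. v k * s k) / W"
  have A: "0 \<le> A" unfolding A_def using W assms by (intro divide_nonneg_pos sum_nonneg) auto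
  have sA: "(\<Sum>k\<in>K. v k * s k) = W * A" using W by (simp add: A_def)
  have "W * A powr p = (\<Sum>k\<in>K. v k * (A powr p + p * A powr (p - 1) * (s k - A)))"
  proof -
    have "(\<Sum>k\<in>K. v k * (A powr p + p * A powr (p - 1) * (s k - A)))
       = (\<Sum>k\<in>K. v k) * A powr p + p * A powr (p - 1) * ((\<Sum>k\<in>K. v k * s k) - (\<Sum>k\<in>K. v k) * A)"
      by (simp add: sum_distrib_left sum_distrib_right sum.distrib sum_subtractf algebra_simps)
    then show ?thesis unfolding sA W_def[symmetric] by simp
  qed
  also have "\<dots> \<le> (\<Sum>k\<in>K. v k * s k powr p)"
    using assms A by (intro sum_mono mult_left_mono powr_tangent) auto
  finally have "W powr (p - 1) * (W * A powr p) \<le> W powr (p - 1) * (\<Sum>k\<in>K. v k * s k powr p)"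
    by (intro mult_left_mono) auto
  moreover have "W powr (p - 1) * (W * A powr p) = (W * A) powr p"
    using W A powr_mult_base[of W "p - 1"] by (simp add: powr_mult mult_ac)
  ultimately show ?thesis by (simp add: sA W_def)
qed

text \<open>
  Up to its total mass the combination is an average of contractions.
\<close>

lemma fejer_combination_contraction:
  fixes \<phi> :: "real \<Rightarrow> real"
  assumes p: "1 < p" and v: "\<And>k. 0 \<le> v k" "(\<Sum>k=1..M. v k) \<le> D"
    and \<phi>: "continuous_on UNIV \<phi>"
  shows "(\<integral>x. \<bar>\<Sum>k=1..M. v k * cesaro k \<phi> x\<bar> powr p \<partial>circle) \<le> D powr p * pint p \<phi>"
proof -
  define W where "W = (\<Sum>k=1..M. v k)"
  have W: "0 \<le> W" "W \<le> D" using v by (auto simp: W_def intro: sum_nonneg)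
  have I\<phi>: "integrable circle \<phi>" using \<phi> by (rule integrable_circle_continuous)
  have I\<phi>p: "integrable circle (\<lambda>x. \<bar>\<phi> x\<bar> powr p)" using \<phi> p by (intro integrable_powr_continuous) auto
  have Ic: "integrable circle (\<lambda>x. \<bar>cesaro k \<phi> x\<bar> powr p)" for k
    using p by (intro integrable_powr_continuous continuous_cesaro I\<phi>) auto
  have "(\<integral>x. \<bar>\<Sum>k=1..M. v k * cesaro k \<phi> x\<bar> powr p \<partial>circle)
     \<le> (\<integral>x. W powr (p - 1) * (\<Sum>k=1..M. v k * \<bar>cesaro k \<phi> x\<bar> powr p) \<partial>circle)"
  proof (rule integral_mono)
    show "integrable circle (\<lambda>x. \<bar>\<Sum>k=1..M. v k * cesaro k \<phi> x\<bar> powr p)"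
      using p by (intro integrable_powr_continuous continuous_intros continuous_cesaro I\<phi>) auto
    show "integrable circle (\<lambda>x. W powr (p - 1) * (\<Sum>k=1..M. v k * \<bar>cesaro k \<phi> x\<bar> powr p))"
      using Ic by simp
    fix x
    have "\<bar>\<Sum>k=1..M. v k * cesaro k \<phi> x\<bar> \<le> (\<Sum>k=1..M. v k * \<bar>cesaro k \<phi> x\<bar>)"
      using v(1) by (intro order_trans[OF sum_abs]) (auto simp: abs_mult intro!: sum_mono)
    then have "\<bar>\<Sum>k=1..M. v k * cesaro k \<phi> x\<bar> powr p \<le> (\<Sum>k=1..M. v k * \<bar>cesaro k \<phi> x\<bar>) powr p"
      using p by (intro powr_mono2) auto
    also have "\<dots> \<le> W powr (p - 1) * (\<Sum>k=1..M. v k * \<bar>cesaro k \<phi> x\<bar> powr p)"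
      unfolding W_def using v(1) by (intro sum_jensen_powr p) auto
    finally show "\<bar>\<Sum>k=1..M. v k * cesaro k \<phi> x\<bar> powr p \<le> W powr (p - 1) * (\<Sum>k=1..M. v k * \<bar>cesaro k \<phi> x\<bar> powr p)" .
  qed
  also have "\<dots> = W powr (p - 1) * (\<Sum>k=1..M. v k * pint p (cesaro k \<phi>))"
    using Ic by simp
  also have "\<dots> \<le> W powr (p - 1) * (\<Sum>k=1..M. v k * pint p \<phi>)"
    using p v(1) I\<phi> I\<phi>p by (intro mult_left_mono sum_mono cesaro_powr_contraction) auto
  also have "\<dots> = W powr (p - 1) * (W * pint p \<phi>)"
    by (simp only: W_def sum_distrib_right)
  also have "\<dots> = W powr p * pint p \<phi>"
    using W powr_mult_base[of W "p - 1"] by (simp add: mult_ac)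
  also have "\<dots> \<le> D powr p * pint p \<phi>"
    using W p by (intro mult_right_mono powr_mono2) auto
  finally show ?thesis .
qed

lemma integral_powr_exponent_le:
  fixes h :: "real \<Rightarrow> real"
  assumes "0 < q" "q \<le> p" "continuous_on UNIV h"
  shows "pint q h \<le> 2 * pi + pint p h"
proof -
  have I: "integrable circle (\<lambda>x. \<bar>h x\<bar> powr p)" using assms by (intro integrable_powr_continuous) auto
  have "pint q h \<le> (\<integral>x. 1 + \<bar>h x\<bar> powr p \<partial>circle)"
  proof (rule integral_mono)
    show "integrable circle (\<lambda>x. \<bar>h x\<bar> powr q)" using assms by (intro integrable_powr_continuous) auto
    fix x
    show "\<bar>h x\<bar> powr q \<le> 1 + \<bar>h x\<bar> powr p"
    proof (cases "\<bar>h x\<bar> \<le> 1")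
      case True
      then have "\<bar>h x\<bar> powr q \<le> 1 powr q" using assms by (intro powr_mono2) auto
      then show ?thesis by (simp add: add_increasing2)
    next
      case False
      then have "\<bar>h x\<bar> powr q \<le> \<bar>h x\<bar> powr p" using assms by (intro powr_mono) auto
      then show ?thesis by simp
    qed
  qed (use I in simp)
  also have "\<dots> = 2 * pi + pint p h" using I by simp
  finally show ?thesis .
qed

section \<open>Convexity of the multiplier sequence\<close>

text \<open>
  The derivative of a function of this family is a combination of two of its members, so the
  differences of \<open>\<Lambda>\<close> are estimated within the family.
\<close>

definition powr_log :: "real \<Rightarrow> real \<Rightarrow> real \<Rightarrow> real" where
  "powr_log s t x = x powr s * ln x powr t"

lemma powr_log_nonneg: "0 \<le> powr_log s t x"
  by (simp add: powr_log_def)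

lemma has_derivative_powr_log:
  assumes "1 < x"
  shows "(powr_log s t has_real_derivative s * powr_log (s - 1) t x + t * powr_log (s - 1) (t - 1) x) (at x)"
proof -
  have "((\<lambda>x. x powr s * ln x powr t) has_real_derivative
      (s * x powr (s - 1)) * ln x powr t + (t * ln x powr (t - 1) * (1 / x)) * x powr s) (at x)"
    using assms by (intro DERIV_mult DERIV_chain2[where f="\<lambda>y. y powr t" and g=ln] has_real_derivative_powr DERIV_ln_divide) auto
  moreover have "x powr s = x * x powr (s - 1)" using assms by (simp add: powr_mult_base)
  then have "(t * ln x powr (t - 1) * (1 / x)) * x powr s = t * (x powr (s - 1) * ln x powr (t - 1))"
    using assms by simp
  ultimately show ?thesis unfolding powr_log_def[abs_def] by (simp add: mult.assoc)
qed

lemma powr_log_lower_exponent: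
  assumes "2 \<le> x"
  shows "powr_log s (t - 1) x \<le> powr_log s t x / ln 2"
proof -
  have x: "0 < ln (2::real)" "ln 2 \<le> ln x" using assms by auto
  then have l: "0 < ln x" by linarith
  have "ln x powr t = ln x * ln x powr (t - 1)" using l by (simp add: powr_mult_base)
  also have "\<dots> \<ge> ln 2 * ln x powr (t - 1)" using x by (intro mult_right_mono) auto
  finally have "ln x powr (t - 1) \<le> ln x powr t / ln 2" using x by (simp add: field_simps)
  then have "x powr s * ln x powr (t - 1) \<le> x powr s * (ln x powr t / ln 2)" by (rule mult_left_mono) simp
  then show ?thesis by (simp add: powr_log_def)
qed

lemma powr_log_antimono:
  assumes "s \<le> 0" "t \<le> 0" "1 < x" "x \<le> y"
  shows "powr_log s t y \<le> powr_log s t x"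
  unfolding powr_log_def using assms by (intro mult_mono powr_mono2') auto

lemma powr_log_difference:
  fixes \<alpha> \<gamma> x :: real
  assumes "0 \<le> \<alpha>" "0 < \<gamma>" "2 \<le> x"
  shows "powr_log (- \<alpha>) (- \<gamma>) x - powr_log (- \<alpha>) (- \<gamma>) (x + 1) \<le> (\<alpha> + \<gamma> / ln 2) * powr_log (- \<alpha> - 1) (- \<gamma>) x"
proof -
  let ?h = "powr_log (- \<alpha>) (- \<gamma>)"
  let ?h' = "\<lambda>z. - \<alpha> * powr_log (- \<alpha> - 1) (- \<gamma>) z + - \<gamma> * powr_log (- \<alpha> - 1) (- \<gamma> - 1) z"
  have "\<exists>z>x. z < x + 1 \<and> ?h (x + 1) - ?h x = (x + 1 - x) * ?h' z"
  proof (rule MVT2)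
    fix y assume "x \<le> y"
    then show "(?h has_real_derivative ?h' y) (at y)"
      by (intro has_derivative_powr_log) (use assms in linarith)
  qed simp
  then obtain z where z: "x < z" "?h x - ?h (x + 1) = - ?h' z" by auto
  have "- ?h' z = \<alpha> * powr_log (- \<alpha> - 1) (- \<gamma>) z + \<gamma> * powr_log (- \<alpha> - 1) (- \<gamma> - 1) z" by simp
  also have "\<dots> \<le> \<alpha> * powr_log (- \<alpha> - 1) (- \<gamma>) z + \<gamma> * (powr_log (- \<alpha> - 1) (- \<gamma>) z / ln 2)"
    using assms z by (intro add_left_mono mult_left_mono powr_log_lower_exponent) auto
  also have "\<dots> = (\<alpha> + \<gamma> / ln 2) * powr_log (- \<alpha> - 1) (- \<gamma>) z" by (simp add: algebra_simps)
  also have "\<dots> \<le> (\<alpha> + \<gamma> / ln 2) * powr_log (- \<alpha> - 1) (- \<gamma>) x"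
    using assms z by (intro mult_left_mono powr_log_antimono) auto
  finally show ?thesis using z by simp
qed

lemma powr_log_second_difference:
  fixes \<alpha> \<gamma> x :: real
  assumes "0 \<le> \<alpha>" "0 < \<gamma>" "3 \<le> x"
  defines "d \<equiv> powr_log (- \<alpha>) (- \<gamma>) (x - 1) + powr_log (- \<alpha>) (- \<gamma>) (x + 1) - 2 * powr_log (- \<alpha>) (- \<gamma>) x"
  shows "0 \<le> d"
    "d \<le> (\<alpha> * (\<alpha> + 1) + (2 * \<alpha> + 1) * (\<gamma> / ln 2) + \<gamma> * (\<gamma> + 1) / (ln 2)\<^sup>2) * powr_log (- \<alpha> - 2) (- \<gamma>) (x - 1)"
proof -
  let ?h = "powr_log (- \<alpha>) (- \<gamma>)"
  let ?h' = "\<lambda>z. - \<alpha> * powr_log (- \<alpha> - 1) (- \<gamma>) z + - \<gamma> * powr_log (- \<alpha> - 1) (- \<gamma> - 1) z"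
  let ?h'' = "\<lambda>z. - \<alpha> * ((- \<alpha> - 1) * powr_log (- \<alpha> - 1 - 1) (- \<gamma>) z + - \<gamma> * powr_log (- \<alpha> - 1 - 1) (- \<gamma> - 1) z)
     + - \<gamma> * ((- \<alpha> - 1) * powr_log (- \<alpha> - 1 - 1) (- \<gamma> - 1) z + (- \<gamma> - 1) * powr_log (- \<alpha> - 1 - 1) (- \<gamma> - 1 - 1) z)"
  have d1: "(?h has_real_derivative ?h' z) (at z)" if "1 < z" for z
    using that by (rule has_derivative_powr_log)
  have d2: "(?h' has_real_derivative ?h'' z) (at z)" if "1 < z" for z
    using that by (intro DERIV_add DERIV_cmult has_derivative_powr_log)
  have "\<exists>y>x-1. y < x \<and> (?h (x + 1) - ?h x) - (?h (x - 1 + 1) - ?h (x - 1)) = (x - (x - 1)) * (?h' (y + 1) - ?h' y)"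
  proof (rule MVT2[where f="\<lambda>y. ?h (y + 1) - ?h y"])
    fix y assume "x - 1 \<le> y"
    then have "1 < y" using assms by linarith
    then have "((\<lambda>y. ?h (y + 1)) has_real_derivative ?h' (y + 1)) (at y)"
      unfolding DERIV_shift[symmetric] by (intro d1) simp
    then show "((\<lambda>y. ?h (y + 1) - ?h y) has_real_derivative ?h' (y + 1) - ?h' y) (at y)"
      by (intro DERIV_diff d1 \<open>1 < y\<close>)
  qed simp
  then obtain y where y: "x - 1 < y" "y < x" "d = ?h' (y + 1) - ?h' y" by (auto simp: d_def)
  have "\<exists>z>y. z < y + 1 \<and> ?h' (y + 1) - ?h' y = (y + 1 - y) * ?h'' z"
  proof (rule MVT2)
    fix w assume "y \<le> w"
    then show "(?h' has_real_derivative ?h'' w) (at w)"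
      by (intro d2) (use assms y in linarith)
  qed simp
  then obtain z where z: "y < z" "d = ?h'' z" using y by auto
  let ?P = "\<lambda>t. powr_log (- \<alpha> - 2) t z"
  have z2: "2 \<le> z" "x - 1 \<le> z" using y z assms by auto
  have dz: "d = \<alpha> * (\<alpha> + 1) * ?P (- \<gamma>) + (2 * \<alpha> + 1) * \<gamma> * ?P (- \<gamma> - 1) + \<gamma> * (\<gamma> + 1) * ?P (- \<gamma> - 1 - 1)"
    unfolding z by (simp add: algebra_simps)
  show "0 \<le> d" unfolding dz using assms(1,2) by (intro add_nonneg_nonneg mult_nonneg_nonneg powr_log_nonneg) auto
  have P1: "?P (- \<gamma> - 1) \<le> ?P (- \<gamma>) / ln 2" using z2 by (intro powr_log_lower_exponent)
  have "?P (- \<gamma> - 1 - 1) \<le> ?P (- \<gamma> - 1) / ln 2" using z2 by (intro powr_log_lower_exponent)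
  also have "\<dots> \<le> (?P (- \<gamma>) / ln 2) / ln 2" using P1 by (intro divide_right_mono) auto
  finally have P2: "?P (- \<gamma> - 1 - 1) \<le> ?P (- \<gamma>) / (ln 2)\<^sup>2" by (simp add: power2_eq_square)
  have "d \<le> \<alpha> * (\<alpha> + 1) * ?P (- \<gamma>) + (2 * \<alpha> + 1) * \<gamma> * (?P (- \<gamma>) / ln 2) + \<gamma> * (\<gamma> + 1) * (?P (- \<gamma>) / (ln 2)\<^sup>2)"
    unfolding dz using assms(1,2) by (intro add_mono mult_left_mono P1 P2) auto
  also have "\<dots> = (\<alpha> * (\<alpha> + 1) + (2 * \<alpha> + 1) * (\<gamma> / ln 2) + \<gamma> * (\<gamma> + 1) / (ln 2)\<^sup>2) * ?P (- \<gamma>)"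
    by (simp add: algebra_simps add_divide_distrib)
  also have "\<dots> \<le> (\<alpha> * (\<alpha> + 1) + (2 * \<alpha> + 1) * (\<gamma> / ln 2) + \<gamma> * (\<gamma> + 1) / (ln 2)\<^sup>2) * powr_log (- \<alpha> - 2) (- \<gamma>) (x - 1)"
    using assms z2 by (intro mult_left_mono powr_log_antimono add_nonneg_nonneg mult_nonneg_nonneg divide_nonneg_nonneg) auto
  finally show "d \<le> (\<alpha> * (\<alpha> + 1) + (2 * \<alpha> + 1) * (\<gamma> / ln 2) + \<gamma> * (\<gamma> + 1) / (ln 2)\<^sup>2) * powr_log (- \<alpha> - 2) (- \<gamma>) (x - 1)" .
qed

text \<open>
  These weights reproduce the multiplier \<open>\<Lambda> j\<close> for \<open>j > n\<close>; for \<open>j \<le> n\<close> the resulting multiplier is the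
  linear continuation of \<open>\<Lambda>\<close> from \<open>n\<close> and \<open>n + 1\<close>.
\<close>

definition tail_weight :: "(nat \<Rightarrow> real) \<Rightarrow> nat \<Rightarrow> nat \<Rightarrow> real" where
  "tail_weight \<Lambda> n k = (if n < k then real k * (\<Lambda> (k - 1) + \<Lambda> (k + 1) - 2 * \<Lambda> k) else 0)"

text \<open>
  Summation by parts twice. The bracket at \<open>M\<close> tends to \<open>0\<close> for the sequences considered here.
\<close>

lemma sum_second_differences:
  fixes \<Lambda> :: "nat \<Rightarrow> real"
  assumes "n \<le> M"
  shows "(\<Sum>k=n+1..M. (real k - j) * (\<Lambda> (k - 1) + \<Lambda> (k + 1) - 2 * \<Lambda> k))
    = ((real M - j) * (\<Lambda> (M + 1) - \<Lambda> M) - \<Lambda> M) - ((real n - j) * (\<Lambda> (n + 1) - \<Lambda> n) - \<Lambda> n)"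
  using assms
proof (induction rule: dec_induct)
  case (step k)
  then show ?case by (simp add: algebra_simps)
qed simp

lemma sum_tail_weight:
  assumes "max n j \<le> M"
  shows "(\<Sum>k=1..M. tail_weight \<Lambda> n k * cesaro_weight k j)
    = ((real M - real j) * (\<Lambda> (M + 1) - \<Lambda> M) - \<Lambda> M)
      - ((real (max n j) - real j) * (\<Lambda> (max n j + 1) - \<Lambda> (max n j)) - \<Lambda> (max n j))"
proof -
  have "(\<Sum>k=1..M. tail_weight \<Lambda> n k * cesaro_weight k j)
      = (\<Sum>k=max n j+1..M. (real k - real j) * (\<Lambda> (k - 1) + \<Lambda> (k + 1) - 2 * \<Lambda> k))"
  proof (rule sum.mono_neutral_cong_right)
    show "\<forall>k\<in>{1..M} - {max n j + 1..M}. tail_weight \<Lambda> n k * cesaro_weight k j = 0"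
    proof
      fix k assume "k \<in> {1..M} - {max n j + 1..M}"
      then have "k \<le> n \<or> 1 \<le> k \<and> k \<le> j" by auto
      then show "tail_weight \<Lambda> n k * cesaro_weight k j = 0"
        by (auto simp: tail_weight_def cesaro_weight_def max_def)
    qed
    fix k assume k: "k \<in> {max n j + 1..M}"
    then have jk: "j < k" "n < k" by auto
    then have "real k * cesaro_weight k j = real k - real j"
      by (simp add: cesaro_weight_def max_def field_simps)
    then show "tail_weight \<Lambda> n k * cesaro_weight k j = (real k - real j) * (\<Lambda> (k - 1) + \<Lambda> (k + 1) - 2 * \<Lambda> k)"
      using jk by (simp add: tail_weight_def mult.commute mult.left_commute)
  qed auto
  then show ?thesis using sum_second_differences[OF assms] by simp
qed

locale log_multiplier =
  fixes \<Lambda> :: "nat \<Rightarrow> real" and \<alpha> \<gamma> :: real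
  assumes \<alpha>: "0 \<le> \<alpha>" and \<gamma>: "0 < \<gamma>"
    and \<Lambda>: "\<And>k. 2 \<le> k \<Longrightarrow> \<Lambda> k = powr_log (- \<alpha>) (- \<gamma>) (real k)"
begin

definition "D1 = \<alpha> + \<gamma> / ln 2"
definition "D2 = (\<alpha> * (\<alpha> + 1) + (2 * \<alpha> + 1) * (\<gamma> / ln 2) + \<gamma> * (\<gamma> + 1) / (ln 2)\<^sup>2) * 2 powr (\<alpha> + 2)"

lemma D1_nonneg: "0 \<le> D1" using \<alpha> \<gamma> by (simp add: D1_def)

lemma D2_nonneg: "0 \<le> D2" using \<alpha> \<gamma> by (simp add: D2_def)

lemma nonneg: "2 \<le> k \<Longrightarrow> 0 \<le> \<Lambda> k"
  using \<Lambda> powr_log_nonneg by simp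

lemma antimono: "2 \<le> k \<Longrightarrow> k \<le> m \<Longrightarrow> \<Lambda> m \<le> \<Lambda> k"
  using \<Lambda>[of k] \<Lambda>[of m] powr_log_antimono[of "- \<alpha>" "- \<gamma>" "real k" "real m"] \<alpha> \<gamma> by auto

lemma le_log: "2 \<le> k \<Longrightarrow> \<Lambda> k \<le> ln (real k) powr (- \<gamma>)"
  using \<Lambda>[of k] powr_mono2'[of "- \<alpha>" 1 "real k"] \<alpha>
  by (auto simp: powr_log_def intro: mult_left_le_one_le)

lemma difference_le:
  assumes "2 \<le> k"
  shows "real k * (\<Lambda> k - \<Lambda> (k + 1)) \<le> D1 * ln (real k) powr (- \<gamma>)"
proof -
  have "\<Lambda> k - \<Lambda> (k + 1) \<le> D1 * powr_log (- \<alpha> - 1) (- \<gamma>) (real k)"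
    using powr_log_difference[of \<alpha> \<gamma> "real k"] \<alpha> \<gamma> assms \<Lambda>[of k] \<Lambda>[of "k + 1"]
    by (simp add: D1_def add.commute)
  then have "real k * (\<Lambda> k - \<Lambda> (k + 1)) \<le> real k * (D1 * powr_log (- \<alpha> - 1) (- \<gamma>) (real k))"
    by (rule mult_left_mono) simp
  also have "\<dots> = D1 * (real k * real k powr (- \<alpha> - 1)) * ln (real k) powr (- \<gamma>)"
    by (simp add: powr_log_def)
  also have "real k * real k powr (- \<alpha> - 1) = real k powr (- \<alpha>)"
    using powr_mult_base[of "real k" "- \<alpha> - 1"] by simp
  also have "D1 * real k powr (- \<alpha>) * ln (real k) powr (- \<gamma>) \<le> D1 * 1 * ln (real k) powr (- \<gamma>)"
    using assms powr_mono2'[of "- \<alpha>" 1 "real k"] \<alpha> D1_nonneg by (intro mult_right_mono mult_left_mono) auto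
  finally show ?thesis by simp
qed

lemma tail_weight_nonneg: "2 \<le> n \<Longrightarrow> 0 \<le> tail_weight \<Lambda> n k"
  using powr_log_second_difference(1)[of \<alpha> \<gamma> "real k"] \<alpha> \<gamma> \<Lambda>[of "k - 1"] \<Lambda>[of k] \<Lambda>[of "k + 1"]
  by (auto simp: tail_weight_def of_nat_diff add.commute)

lemma tail_weight_le:
  assumes n: "2 \<le> n"
  shows "tail_weight \<Lambda> n k \<le> D2 * real k powr (- \<alpha> - 1) * ln (real n) powr (- \<gamma>)"
proof (cases "n < k")
  case True
  let ?c = "\<alpha> * (\<alpha> + 1) + (2 * \<alpha> + 1) * (\<gamma> / ln 2) + \<gamma> * (\<gamma> + 1) / (ln 2)\<^sup>2"
  have c: "0 \<le> ?c" using \<alpha> \<gamma> by simp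
  have "\<Lambda> (k - 1) + \<Lambda> (k + 1) - 2 * \<Lambda> k \<le> ?c * powr_log (- \<alpha> - 2) (- \<gamma>) (real k - 1)"
    using powr_log_second_difference(2)[of \<alpha> \<gamma> "real k"] \<alpha> \<gamma> \<Lambda>[of "k - 1"] \<Lambda>[of k] \<Lambda>[of "k + 1"] True n
    by (simp add: of_nat_diff add.commute)
  \<comment> \<open>\<open>n \<le> k - 1\<close> and \<open>k / 2 \<le> k - 1\<close>\<close>
  also have "powr_log (- \<alpha> - 2) (- \<gamma>) (real k - 1) \<le> (real k / 2) powr (- \<alpha> - 2) * ln (real n) powr (- \<gamma>)"
    unfolding powr_log_def using True n \<alpha> \<gamma> by (intro mult_mono powr_mono2') auto
  also have "(real k / 2) powr (- \<alpha> - 2) = 2 powr (\<alpha> + 2) * real k powr (- \<alpha> - 2)"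
    using True by (simp add: powr_divide powr_diff powr_minus powr_add field_simps)
  finally have "\<Lambda> (k - 1) + \<Lambda> (k + 1) - 2 * \<Lambda> k
      \<le> ?c * (2 powr (\<alpha> + 2) * real k powr (- \<alpha> - 2) * ln (real n) powr (- \<gamma>))"
    using c by (simp add: mult_left_mono)
  also have "\<dots> = D2 * real k powr (- \<alpha> - 2) * ln (real n) powr (- \<gamma>)" by (simp add: D2_def)
  finally have "real k * (\<Lambda> (k - 1) + \<Lambda> (k + 1) - 2 * \<Lambda> k)
      \<le> real k * (D2 * real k powr (- \<alpha> - 2) * ln (real n) powr (- \<gamma>))" by (rule mult_left_mono) simp
  also have "\<dots> = D2 * (real k * real k powr (- \<alpha> - 2)) * ln (real n) powr (- \<gamma>)" by simp
  also have "real k * real k powr (- \<alpha> - 2) = real k powr (- \<alpha> - 1)"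
  proof -
    have "real k * real k powr (- \<alpha> - 2) = real k powr (1 + (- \<alpha> - 2))" by (rule powr_mult_base) simp
    moreover have "1 + (- \<alpha> - 2) = - \<alpha> - 1" by simp
    ultimately show ?thesis by (simp only:)
  qed
  finally show ?thesis using True by (simp add: tail_weight_def)
qed (use D2_nonneg in \<open>simp add: tail_weight_def\<close>)

lemma boundary_term_le:
  assumes "2 \<le> M"
  shows "\<bar>(real M - real j) * (\<Lambda> (M + 1) - \<Lambda> M) - \<Lambda> M\<bar> \<le> (D1 + 1) * ln (real M) powr (- \<gamma>) + real j * \<Lambda> M"
proof -
  have 1: "0 \<le> \<Lambda> M - \<Lambda> (M + 1)" "0 \<le> \<Lambda> M" "0 \<le> \<Lambda> (M + 1)" using antimono[of M "M + 1"] nonneg assms by auto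
  have "\<bar>(real M - real j) * (\<Lambda> (M + 1) - \<Lambda> M) - \<Lambda> M\<bar>
     \<le> real M * (\<Lambda> M - \<Lambda> (M + 1)) + real j * (\<Lambda> M - \<Lambda> (M + 1)) + \<Lambda> M"
  proof -
    have "(real M - real j) * (\<Lambda> (M + 1) - \<Lambda> M) - \<Lambda> M
       = real j * (\<Lambda> M - \<Lambda> (M + 1)) - real M * (\<Lambda> M - \<Lambda> (M + 1)) - \<Lambda> M" by (simp add: algebra_simps)
    moreover have "0 \<le> real j * (\<Lambda> M - \<Lambda> (M + 1))" "0 \<le> real M * (\<Lambda> M - \<Lambda> (M + 1))" using 1 by auto
    ultimately show ?thesis using 1(2) by linarith
  qed
  moreover have "real j * (\<Lambda> M - \<Lambda> (M + 1)) \<le> real j * \<Lambda> M" using 1 by (intro mult_left_mono) auto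
  moreover have "(D1 + 1) * ln (real M) powr (- \<gamma>) = D1 * ln (real M) powr (- \<gamma>) + ln (real M) powr (- \<gamma>)"
    by (simp add: distrib_right)
  ultimately show ?thesis using difference_le[OF assms] le_log[OF assms] by linarith
qed

lemma log_tendsto_0: "(\<lambda>M. ln (real M) powr (- \<gamma>)) \<longlonglongrightarrow> 0"
  using \<gamma> by (intro tendsto_neg_powr filterlim_compose[OF ln_at_top filterlim_real_sequentially]) auto

lemma tail_weight_multiplier:
  obtains m where "\<And>j. (\<lambda>M. \<Sum>k=1..M. tail_weight \<Lambda> n k * cesaro_weight k j) \<longlonglongrightarrow> m j"
    "\<And>j. n < j \<Longrightarrow> m j = \<Lambda> j"
proof -
  define m where "m j = - ((real (max n j) - real j) * (\<Lambda> (max n j + 1) - \<Lambda> (max n j)) - \<Lambda> (max n j))" for j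
  have "(\<lambda>M. \<Sum>k=1..M. tail_weight \<Lambda> n k * cesaro_weight k j) \<longlonglongrightarrow> m j" for j
  proof -
    have L0: "\<Lambda> \<longlonglongrightarrow> 0"
    proof (rule Lim_null_comparison[OF _ log_tendsto_0])
      show "\<forall>\<^sub>F M in sequentially. norm (\<Lambda> M) \<le> ln (real M) powr (- \<gamma>)"
        using eventually_ge_at_top[of 2] by eventually_elim (use nonneg le_log in auto)
    qed
    have "(\<lambda>M. (real M - real j) * (\<Lambda> (M + 1) - \<Lambda> M) - \<Lambda> M) \<longlonglongrightarrow> 0"
    proof (rule Lim_null_comparison)
      show "\<forall>\<^sub>F M in sequentially. norm ((real M - real j) * (\<Lambda> (M + 1) - \<Lambda> M) - \<Lambda> M)
          \<le> (D1 + 1) * ln (real M) powr (- \<gamma>) + real j * \<Lambda> M"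
        using eventually_ge_at_top[of 2] by eventually_elim (use boundary_term_le in auto)
      show "(\<lambda>M. (D1 + 1) * ln (real M) powr (- \<gamma>) + real j * \<Lambda> M) \<longlonglongrightarrow> 0"
        using tendsto_add[OF tendsto_mult_right_zero[OF log_tendsto_0, of "D1 + 1"] tendsto_mult_right_zero[OF L0, of "real j"]]
        by simp
    qed
    then have "(\<lambda>M. ((real M - real j) * (\<Lambda> (M + 1) - \<Lambda> M) - \<Lambda> M) + m j) \<longlonglongrightarrow> 0 + m j"
      by (intro tendsto_add tendsto_const)
    moreover have "\<forall>\<^sub>F M in sequentially. ((real M - real j) * (\<Lambda> (M + 1) - \<Lambda> M) - \<Lambda> M) + m j
       = (\<Sum>k=1..M. tail_weight \<Lambda> n k * cesaro_weight k j)"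
      using eventually_ge_at_top[of "max n j"]
      by eventually_elim (subst sum_tail_weight, auto simp: m_def)
    ultimately show ?thesis using Lim_transform_eventually by fastforce
  qed
  moreover have "m j = \<Lambda> j" if "n < j" for j using that by (simp add: m_def max_def)
  ultimately show ?thesis using that by blast
qed

lemma sum_tail_weight_le:
  assumes n: "2 \<le> n"
  shows "(\<Sum>k=1..M. tail_weight \<Lambda> n k) \<le> (D1 + 1) * ln (real n) powr (- \<gamma>)"
proof (cases "n \<le> M")
  case True
  have "(\<Sum>k=1..M. tail_weight \<Lambda> n k) = (\<Sum>k=1..M. tail_weight \<Lambda> n k * cesaro_weight k 0)"
    by (simp add: cesaro_weight_def)
  also have "\<dots> = (real M * (\<Lambda> (M + 1) - \<Lambda> M) - \<Lambda> M) - (real n * (\<Lambda> (n + 1) - \<Lambda> n) - \<Lambda> n)"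
    using True by (subst sum_tail_weight) auto
  also have "\<dots> \<le> real n * (\<Lambda> n - \<Lambda> (n + 1)) + \<Lambda> n"
  proof -
    have "real M * (\<Lambda> (M + 1) - \<Lambda> M) \<le> 0" using antimono[of M "M + 1"] n True by (intro mult_nonneg_nonpos) auto
    moreover have "real n * (\<Lambda> (n + 1) - \<Lambda> n) = - (real n * (\<Lambda> n - \<Lambda> (n + 1)))" by (simp add: algebra_simps)
    ultimately show ?thesis using nonneg[of M] n True by linarith
  qed
  also have "\<dots> \<le> D1 * ln (real n) powr (- \<gamma>) + ln (real n) powr (- \<gamma>)"
    using difference_le[OF n] le_log[OF n] by simp
  finally show ?thesis by (simp add: distrib_right)
next
  case False
  then have "(\<Sum>k=1..M. tail_weight \<Lambda> n k) = 0" by (intro sum.neutral) (auto simp: tail_weight_def)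
  then show ?thesis using D1_nonneg by simp
qed

end

text \<open>
  For \<open>q \<le> p\<close> the total mass of the weights has the order \<open>(ln n)\<^bsup>-\<gamma>\<^esup>\<close>. For \<open>p < q\<close> each weight is
  at most a multiple of \<open>(ln n)\<^bsup>-\<gamma>\<^esup> k\<^bsup>-\<alpha>-1\<^esup>\<close>, which is the size that the Sobolev inequality needs.
\<close>

lemma tail_multiplier_bounded:
  fixes p q :: real
  assumes "1 < p" "1 < q" and L: "log_multiplier \<Lambda> (max (1 / p - 1 / q) 0) \<gamma>"
  obtains C where "0 \<le> C" "\<And>(n::nat) M \<phi>. 2 \<le> n \<Longrightarrow> continuous_on UNIV \<phi> \<Longrightarrow> pint p \<phi> \<le> 1
    \<Longrightarrow> (\<integral>x. \<bar>\<Sum>k=1..M. tail_weight \<Lambda> n k * cesaro k \<phi> x\<bar> powr q \<partial>circle) \<le> C * (ln (real n) powr (- \<gamma>)) powr q"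
proof -
  interpret log_multiplier \<Lambda> "max (1 / p - 1 / q) 0" \<gamma> by (rule L)
  define D where "D = (if p < q then D2 else D1 + 1)"
  define C where "C = (if p < q then (D * (q + 2 powr (1 / p - 1 / q) / (1 / p - 1 / q) + 1)
      + D * (p / (p - 1) + 2 powr (1 / p - 1 / q) / (1 / p - 1 / q) + 1)) powr q
    else 2 * pi + D powr p)"
  have D: "0 \<le> D" using D1_nonneg D2_nonneg by (simp add: D_def)
  show ?thesis
  proof (rule that[of C])
    show "0 \<le> C" by (simp add: C_def)
    fix n :: nat and M :: nat and \<phi> assume n: "2 \<le> n" and \<phi>: "continuous_on UNIV \<phi>" "pint p \<phi> \<le> 1"
    define \<psi> where "\<psi> = ln (real n) powr (- \<gamma>)"
    have \<psi>: "0 < \<psi>" using n by (simp add: \<psi>_def)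
    define v where "v k = tail_weight \<Lambda> n k / \<psi>" for k
    have v0: "0 \<le> v k" for k unfolding v_def using \<psi> tail_weight_nonneg[OF n] by simp
    have "(\<integral>x. \<bar>\<Sum>k=1..M. v k * cesaro k \<phi> x\<bar> powr q \<partial>circle) \<le> C"
    proof (cases "p < q")
      case True
      then have a: "max (1 / p - 1 / q) 0 = 1 / p - 1 / q" using assms(1) by (simp add: max_def field_simps)
      have "v k \<le> D * real k powr (- (1 / p - 1 / q) - 1)" for k
        using tail_weight_le[OF n, of k] \<psi> True unfolding a v_def D_def \<psi>_def[symmetric]
        by (simp add: pos_divide_le_eq)
      then show ?thesis using True \<phi> v0 D assms(1) unfolding C_def
        by (simp only: if_True) (intro fejer_combination_sobolev; auto)
    next
      case False
      have I\<phi>: "integrable circle \<phi>" using \<phi>(1) by (rule integrable_circle_continuous)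
      have "(\<Sum>k=1..M. v k) \<le> D"
        using sum_tail_weight_le[OF n, of M] \<psi> False unfolding v_def D_def \<psi>_def[symmetric] sum_divide_distrib[symmetric]
        by (simp add: pos_divide_le_eq)
      then have 1: "(\<integral>x. \<bar>\<Sum>k=1..M. v k * cesaro k \<phi> x\<bar> powr p \<partial>circle) \<le> D powr p * pint p \<phi>"
        using v0 \<phi> assms(1) by (intro fejer_combination_contraction) auto
      have 2: "D powr p * pint p \<phi> \<le> D powr p * 1" using \<phi>(2) by (intro mult_left_mono) auto
      have "(\<integral>x. \<bar>\<Sum>k=1..M. v k * cesaro k \<phi> x\<bar> powr q \<partial>circle) \<le> 2 * pi + (\<integral>x. \<bar>\<Sum>k=1..M. v k * cesaro k \<phi> x\<bar> powr p \<partial>circle)"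
        using False assms I\<phi> by (intro integral_powr_exponent_le continuous_intros continuous_cesaro) auto
      then show ?thesis using 1 2 False by (simp add: C_def)
    qed
    moreover have "\<bar>\<Sum>k=1..M. tail_weight \<Lambda> n k * cesaro k \<phi> x\<bar> powr q
        = \<psi> powr q * \<bar>\<Sum>k=1..M. v k * cesaro k \<phi> x\<bar> powr q" for x
    proof -
      have "(\<Sum>k=1..M. tail_weight \<Lambda> n k * cesaro k \<phi> x) = \<psi> * (\<Sum>k=1..M. v k * cesaro k \<phi> x)"
        using \<psi> by (simp add: sum_distrib_left v_def)
      then show ?thesis using \<psi> by (simp add: abs_mult powr_mult)
    qed
    ultimately show "(\<integral>x. \<bar>\<Sum>k=1..M. tail_weight \<Lambda> n k * cesaro k \<phi> x\<bar> powr q \<partial>circle) \<le> C * (ln (real n) powr (- \<gamma>)) powr q"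
      unfolding \<psi>_def[symmetric] by (simp add: mult.commute[of C] mult_left_mono)
  qed
qed

section \<open>Approximation by trigonometric polynomials\<close>

lemma inner_cis_eq_imp_eq:
  assumes "1 \<le> k" "\<And>x. u \<bullet> cis (real k * x) = v \<bullet> cis (real k * x)"
  shows "u = v"
proof -
  have "Re u = Re v" using assms(2)[of 0] by (simp add: inner_cis)
  moreover have "Im u = Im v" using assms(2)[of "pi / 2 / real k"] assms(1) by (simp add: inner_cis)
  ultimately show ?thesis by (simp add: complex_eq_iff)
qed

lemma inner_cis_shift: "u \<bullet> cis (t - \<theta>) = (cis \<theta> * u) \<bullet> cis t"
  by (simp add: inner_cis cos_diff sin_diff algebra_simps)

lemma multiplier_class_iff:
  "f \<in> multiplier_class \<Lambda> \<beta> U \<longleftrightarrow> f \<in> Lp 1 \<and> fourier_cos f 0 = 0 \<and>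
     (\<exists>\<phi>\<in>U. \<forall>k\<ge>1. fcoef f k = \<Lambda> k *\<^sub>R (cis (\<beta> * pi / 2) * fcoef \<phi> k))"
proof -
  have "(\<forall>x. fourier_cos f k * cos (real k * x) + fourier_sin f k * sin (real k * x) =
           \<Lambda> k * (fourier_cos \<phi> k * cos (real k * x - \<beta> * pi / 2)
                + fourier_sin \<phi> k * sin (real k * x - \<beta> * pi / 2)))
     \<longleftrightarrow> fcoef f k = \<Lambda> k *\<^sub>R (cis (\<beta> * pi / 2) * fcoef \<phi> k)" (is "(\<forall>x. ?P x) \<longleftrightarrow> ?Q")
    if "1 \<le> k" for k \<phi>
  proof -
    have "?P x \<longleftrightarrow> fcoef f k \<bullet> cis (real k * x) = (\<Lambda> k *\<^sub>R (cis (\<beta> * pi / 2) * fcoef \<phi> k)) \<bullet> cis (real k * x)" for x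
      unfolding fcoef_inner_cis[symmetric] inner_cis_shift by simp
    then show ?thesis using inner_cis_eq_imp_eq[OF that] by metis
  qed
  then show ?thesis unfolding multiplier_class_def by (simp cong: conj_cong)
qed

lemma trig_in_trig_poly: "trig n u \<in> trig_poly n"
proof -
  let ?B = "{\<lambda>x. 1} \<union> (\<lambda>k x. cos (real k * x)) ` {1..n} \<union> (\<lambda>k x. sin (real k * x)) ` {1..n}"
  have "m \<le> n \<Longrightarrow> trig m u \<in> fun_vs.span ?B" for m
  proof (induction m)
    case 0
    have z: "trig 0 u = 0" by (simp add: trig_def fun_eq_iff)
    show ?case unfolding z by (rule fun_vs.span_zero)
  next
    case (Suc m)
    have m: "Suc m \<in> {1..n}" using Suc(2) by simp
    have "(\<lambda>x. cos (real (Suc m) * x)) \<in> fun_vs.span ?B"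
      by (intro fun_vs.span_base UnI1 UnI2 imageI[OF m, of "\<lambda>k x. cos (real k * x)"])
    moreover have "(\<lambda>x. sin (real (Suc m) * x)) \<in> fun_vs.span ?B"
      by (intro fun_vs.span_base UnI2 imageI[OF m, of "\<lambda>k x. sin (real k * x)"])
    ultimately have "(\<lambda>x. Re (u (Suc m)) * cos (real (Suc m) * x)) \<in> fun_vs.span ?B"
      "(\<lambda>x. Im (u (Suc m)) * sin (real (Suc m) * x)) \<in> fun_vs.span ?B"
      by (auto dest: fun_vs.span_scale)
    then have "trig m u + ((\<lambda>x. Re (u (Suc m)) * cos (real (Suc m) * x)) + (\<lambda>x. Im (u (Suc m)) * sin (real (Suc m) * x)))
       \<in> fun_vs.span ?B"
      using Suc by (intro fun_vs.span_add) auto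
    moreover have "trig (Suc m) u = trig m u + ((\<lambda>x. Re (u (Suc m)) * cos (real (Suc m) * x)) + (\<lambda>x. Im (u (Suc m)) * sin (real (Suc m) * x)))"
      by (simp add: trig_def fun_eq_iff inner_cis)
    ultimately show ?case by (simp only:)
  qed
  then show ?thesis by (simp add: trig_poly_def)
qed

lemma Lp_imp_integrable:
  assumes "f \<in> Lp p" "1 \<le> p"
  shows "integrable circle f"
  using assms by (intro integrable_of_powr[of f p]) (auto simp: Lp_def)

lemma Lp_ball_integral_le:
  assumes "\<phi> \<in> Lp_ball p" "1 \<le> p"
  shows "pint p \<phi> \<le> 1"
proof -
  let ?I = "\<integral>x. \<bar>\<phi> x\<bar> powr p \<partial>circle"
  have "ennreal (?I powr (1 / p)) \<le> 1" using assms by (simp add: Lp_ball_def Lp_norm_def split: if_splits)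
  then have "?I powr (1 / p) \<le> 1" by (simp add: ennreal_le_1)
  then have "(?I powr (1 / p)) powr p \<le> 1 powr p" using assms by (intro powr_mono2) auto
  then show ?thesis using assms by (simp add: powr_powr)
qed

lemma Lp_norm_le:
  assumes "f \<in> Lp q" "0 < q" "pint q f \<le> B powr q" "0 \<le> B"
  shows "Lp_norm q f \<le> ennreal B"
proof -
  have "pint q f powr (1 / q) \<le> (B powr q) powr (1 / q)"
    using assms by (intro powr_mono2) auto
  also have "\<dots> = B" using assms by (simp add: powr_powr)
  finally show ?thesis using assms by (simp add: Lp_norm_def ennreal_leI)
qed

text \<open>
  For the Fejer means of \<open>\<phi>\<close> in place of \<open>\<phi>\<close>, the tail multiplier is a limit of finite combinations of
  Fejer means, and it differs from \<open>\<Lambda>\<close> in the harmonics up to \<open>n\<close> only. The polynomial \<open>g\<close> collects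
  these differences. Almost everywhere convergence of a subsequence of the Fejer means of \<open>f\<close> carries
  the bound over to \<open>f - g\<close>, which thereby is seen to be in \<open>L\<^sub>q\<close>.
\<close>

theorem deviation_trig_poly_le:
  fixes p q \<beta> :: real
  assumes pq: "1 < p" "1 < q" and L: "log_multiplier \<Lambda> (max (1 / p - 1 / q) 0) \<gamma>"
  obtains C where "0 < C" "\<And>n. 2 \<le> n \<Longrightarrow>
    deviation (Lp_norm q) (multiplier_class \<Lambda> \<beta> (Lp_ball p)) (trig_poly n) \<le> ennreal (C * ln (real n) powr (- \<gamma>))"
proof -
  interpret log_multiplier \<Lambda> "max (1 / p - 1 / q) 0" \<gamma> by (rule L)
  obtain C1 where C1: "0 \<le> C1" "\<And>(n::nat) M \<phi>. 2 \<le> n \<Longrightarrow> continuous_on UNIV \<phi> \<Longrightarrow> pint p \<phi> \<le> 1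
    \<Longrightarrow> (\<integral>x. \<bar>\<Sum>k=1..M. tail_weight \<Lambda> n k * cesaro k \<phi> x\<bar> powr q \<partial>circle) \<le> C1 * (ln (real n) powr (- \<gamma>)) powr q"
    using tail_multiplier_bounded[OF pq L] by blast
  obtain C2 where C2: "0 < C2" "\<And>N u \<theta>. pint q (trig N (\<lambda>k. cis \<theta> * u k)) \<le> C2 * pint q (trig N u)"
    using rotation_bounded[OF pq(2)] by blast
  define C where "C = (C2 * C1 + 1) powr (1 / q)"
  have "0 < C2 * C1 + 1" using C1(1) C2(1) by (simp add: add_nonneg_pos)
  then have C: "0 < C" "C powr q = C2 * C1 + 1"
    using pq by (simp_all add: C_def powr_powr)
  show ?thesis
  proof (rule that[OF C(1)])
    fix n :: nat assume n: "2 \<le> n"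
    define \<psi> where "\<psi> = ln (real n) powr (- \<gamma>)"
    have \<psi>: "0 < \<psi>" using n by (simp add: \<psi>_def)
    obtain m where m: "\<And>j. (\<lambda>M. \<Sum>k=1..M. tail_weight \<Lambda> n k * cesaro_weight k j) \<longlonglongrightarrow> m j"
      "\<And>j. n < j \<Longrightarrow> m j = \<Lambda> j"
      using tail_weight_multiplier by blast
    define \<theta> where "\<theta> = \<beta> * pi / 2"
    have "\<exists>g\<in>trig_poly n. Lp_norm q (f - g) \<le> ennreal (C * \<psi>)"
      if f: "f \<in> multiplier_class \<Lambda> \<beta> (Lp_ball p)" for f
    proof -
      obtain \<phi> where \<phi>: "\<phi> \<in> Lp_ball p" "\<And>k. 1 \<le> k \<Longrightarrow> fcoef f k = \<Lambda> k *\<^sub>R (cis \<theta> * fcoef \<phi> k)"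
        and f1: "f \<in> Lp 1" "fourier_cos f 0 = 0"
        using f unfolding multiplier_class_iff \<theta>_def by blast
      have If: "integrable circle f" using f1(1) by (rule Lp_imp_integrable) simp
      have \<phi>p: "\<phi> \<in> Lp p" "fourier_cos \<phi> 0 = 0" using \<phi>(1) by (auto simp: Lp_ball_def)
      have I\<phi>: "integrable circle \<phi>" using \<phi>p(1) pq by (intro Lp_imp_integrable) auto
      define c where "c = fcoef \<phi>"
      define w where "w = tail_weight \<Lambda> n"
      \<comment> \<open>The tail multiplier applied to the \<open>N\<close>-th Fejer mean of \<open>\<phi>\<close>; \<open>R\<close> below is its rotation.\<close>
      define Q where "Q N = trig N (\<lambda>j. m j *\<^sub>R (cesaro_weight N j *\<^sub>R c j))" for N
      have Q: "pint q (Q N) \<le> C1 * \<psi> powr q" if N: "1 \<le> N" for N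
      proof -
        define \<phi>N where "\<phi>N = cesaro N \<phi>"
        have \<phi>N: "\<phi>N = trig N (\<lambda>k. cesaro_weight N k *\<^sub>R c k)"
          using cesaro_eq_trig[OF I\<phi>, of N N] \<phi>p(2) N by (auto simp: \<phi>N_def c_def)
        have cont: "continuous_on UNIV \<phi>N" unfolding \<phi>N by (intro continuous_intros)
        have "pint p \<phi>N \<le> pint p \<phi>"
          unfolding \<phi>N_def using pq N \<phi>p(1) by (intro cesaro_powr_contraction) (auto simp: Lp_def)
        also have "\<dots> \<le> 1" using \<phi>(1) pq by (intro Lp_ball_integral_le) auto
        finally have norm1: "pint p \<phi>N \<le> 1" .
        define h where "h M = trig N (\<lambda>j. (\<Sum>k=1..M. w k * cesaro_weight k j) *\<^sub>R (cesaro_weight N j *\<^sub>R c j))" for M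
        have hM: "h M x = (\<Sum>k=1..M. w k * cesaro k \<phi>N x)" for M x
        proof -
          have "cesaro k \<phi>N x = trig N (\<lambda>j. cesaro_weight k j *\<^sub>R (cesaro_weight N j *\<^sub>R c j)) x" if "1 \<le> k" for k
          proof -
            have I: "integrable circle \<phi>N" unfolding \<phi>N by simp
            have "cesaro k \<phi>N x = fourier_cos \<phi>N 0 / 2 + trig (max k N) (\<lambda>j. cesaro_weight k j *\<^sub>R fcoef \<phi>N j) x"
              by (rule cesaro_eq_trig[OF I]) (use that in auto)
            also have "\<dots> = trig (max k N) (\<lambda>j. cesaro_weight k j *\<^sub>R fcoef \<phi>N j) x" by (simp add: \<phi>N)
            also have "\<dots> = trig N (\<lambda>j. cesaro_weight k j *\<^sub>R fcoef \<phi>N j) x"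
              by (rule trig_extend) (auto simp: \<phi>N fcoef_trig')
            also have "\<dots> = trig N (\<lambda>j. cesaro_weight k j *\<^sub>R (cesaro_weight N j *\<^sub>R c j)) x"
              by (rule trig_cong) (simp add: \<phi>N fcoef_trig)
            finally show ?thesis .
          qed
          then have "(\<Sum>k=1..M. w k * cesaro k \<phi>N x)
             = (\<Sum>k=1..M. trig N (\<lambda>j. w k *\<^sub>R (cesaro_weight k j *\<^sub>R (cesaro_weight N j *\<^sub>R c j))) x)"
            by (intro sum.cong refl) (simp add: trig_scaleR del: scaleR_scaleR)
          also have "\<dots> = h M x"
            unfolding h_def trig_sum[symmetric] by (rule trig_cong) (simp add: scaleR_sum_left sum_distrib_right mult.assoc)
          finally show ?thesis ..
        qed
        show ?thesis
        proof (rule integral_powr_limit(2)[where h=h])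
          show "AE x in circle. (\<lambda>M. h M x) \<longlonglongrightarrow> Q N x"
            unfolding h_def Q_def using m(1) by (intro AE_I2 trig_tendsto tendsto_intros) (auto simp: w_def)
          show "\<forall>\<^sub>F M in sequentially. pint q (h M) \<le> C1 * \<psi> powr q"
            unfolding hM w_def \<psi>_def by (intro always_eventually allI C1(2) n cont norm1)
          show "integrable circle (\<lambda>x. \<bar>h M x\<bar> powr q)" for M
            unfolding h_def using pq by (intro integrable_trig_powr) auto
        qed (use pq C1 in \<open>auto simp: h_def Q_def\<close>)
      qed
      define R where "R N = trig N (\<lambda>j. cis \<theta> * (m j *\<^sub>R (cesaro_weight N j *\<^sub>R c j)))" for N
      have R: "pint q (R N) \<le> C2 * (C1 * \<psi> powr q)" if "1 \<le> N" for N
      proof -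
        have "pint q (R N) \<le> C2 * pint q (Q N)"
          unfolding R_def Q_def by (rule C2(2))
        also have "\<dots> \<le> C2 * (C1 * \<psi> powr q)" using C2(1) Q[OF that] by (intro mult_left_mono) auto
        finally show ?thesis .
      qed
      define g where "g = trig n (\<lambda>j. (\<Lambda> j - m j) *\<^sub>R (cis \<theta> * c j))"
      have R_eq: "R N x = cesaro N f x - trig n (\<lambda>j. cesaro_weight N j *\<^sub>R ((\<Lambda> j - m j) *\<^sub>R (cis \<theta> * c j))) x"
        if N: "n \<le> N" for N x
      proof -
        have "cesaro N f x = trig N (\<lambda>j. cesaro_weight N j *\<^sub>R fcoef f j) x"
          using cesaro_eq_trig[OF If, of N N] f1(2) N n by simp
        also have "\<dots> = trig N (\<lambda>j. cesaro_weight N j *\<^sub>R (\<Lambda> j *\<^sub>R (cis \<theta> * c j))) x"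
          by (rule trig_cong) (simp add: \<phi>(2) c_def)
        finally have "cesaro N f x - R N x = trig N (\<lambda>j. cesaro_weight N j *\<^sub>R (\<Lambda> j *\<^sub>R (cis \<theta> * c j))) x
            - trig N (\<lambda>j. cis \<theta> * (m j *\<^sub>R (cesaro_weight N j *\<^sub>R c j))) x"
          by (simp only: R_def)
        also have "\<dots> = trig N (\<lambda>j. cesaro_weight N j *\<^sub>R (\<Lambda> j *\<^sub>R (cis \<theta> * c j))
            - cis \<theta> * (m j *\<^sub>R (cesaro_weight N j *\<^sub>R c j))) x"
          by (rule trig_diff[symmetric])
        also have "\<dots> = trig N (\<lambda>j. cesaro_weight N j *\<^sub>R ((\<Lambda> j - m j) *\<^sub>R (cis \<theta> * c j))) x"
          by (rule trig_cong) (simp add: algebra_simps)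
        also have "\<dots> = trig n (\<lambda>j. cesaro_weight N j *\<^sub>R ((\<Lambda> j - m j) *\<^sub>R (cis \<theta> * c j))) x"
          by (rule trig_extend) (use N m(2) in auto)
        finally show ?thesis by simp
      qed
      obtain r where r: "strict_mono r" "AE x in circle. (\<lambda>N. cesaro (r N) f x) \<longlonglongrightarrow> f x"
        using cesaro_AE_subseq[OF If] by blast
      have rN: "N \<le> r N" for N using r(1) by (rule seq_suble)
      have lim: "AE x in circle. (\<lambda>N. R (r N) x) \<longlonglongrightarrow> f x - g x"
        using r(2)
      proof eventually_elim
        fix x assume fx: "(\<lambda>N. cesaro (r N) f x) \<longlonglongrightarrow> f x"
        have "(\<lambda>N. trig n (\<lambda>j. cesaro_weight (r N) j *\<^sub>R ((\<Lambda> j - m j) *\<^sub>R (cis \<theta> * c j))) x)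
            \<longlonglongrightarrow> trig n (\<lambda>j. 1 *\<^sub>R ((\<Lambda> j - m j) *\<^sub>R (cis \<theta> * c j))) x"
          by (intro trig_tendsto tendsto_intros LIMSEQ_subseq_LIMSEQ[OF cesaro_weight_tendsto r(1), unfolded o_def])
        then have "(\<lambda>N. cesaro (r N) f x - trig n (\<lambda>j. cesaro_weight (r N) j *\<^sub>R ((\<Lambda> j - m j) *\<^sub>R (cis \<theta> * c j))) x)
            \<longlonglongrightarrow> f x - g x"
          unfolding g_def by (intro tendsto_diff fx) simp
        moreover have "\<forall>\<^sub>F N in sequentially. cesaro (r N) f x - trig n (\<lambda>j. cesaro_weight (r N) j *\<^sub>R ((\<Lambda> j - m j) *\<^sub>R (cis \<theta> * c j))) x
           = R (r N) x"
          using eventually_ge_at_top[of n]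
        proof eventually_elim
          fix N assume "n \<le> N"
          then have "n \<le> r N" using rN[of N] by linarith
          then show "cesaro (r N) f x - trig n (\<lambda>j. cesaro_weight (r N) j *\<^sub>R ((\<Lambda> j - m j) *\<^sub>R (cis \<theta> * c j))) x = R (r N) x"
            by (simp only: R_eq)
        qed
        ultimately show "(\<lambda>N. R (r N) x) \<longlonglongrightarrow> f x - g x" by (rule Lim_transform_eventually)
      qed
      have fm: "f \<in> borel_measurable borel" "\<And>x. f (x + 2 * pi) = f x" using f1(1) by (auto simp: Lp_def)
      have B0: "0 \<le> C2 * (C1 * \<psi> powr q)" using C1 C2 by simp
      have ev: "\<forall>\<^sub>F N in sequentially. pint q (R (r N)) \<le> C2 * (C1 * \<psi> powr q)"
        using eventually_ge_at_top[of 1]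
      proof eventually_elim
        fix N :: nat assume "1 \<le> N"
        then show "pint q (R (r N)) \<le> C2 * (C1 * \<psi> powr q)" using rN[of N] by (intro R) linarith
      qed
      have meas: "R (r N) \<in> borel_measurable circle" "(\<lambda>x. f x - g x) \<in> borel_measurable circle" for N
        using fm unfolding R_def g_def by measurable
      have int: "integrable circle (\<lambda>x. \<bar>R (r N) x\<bar> powr q)" for N
        unfolding R_def using pq by (intro integrable_trig_powr) auto
      have q0: "0 < q" using pq by simp
      note res = integral_powr_limit[where h="\<lambda>N. R (r N)" and g="\<lambda>x. f x - g x", OF meas int lim ev q0 B0]
      have fg: "f - g = (\<lambda>x. f x - g x)" by (simp add: fun_eq_iff)
      have "f - g \<in> Lp q"
        unfolding Lp_def fg using res(1) fm by (auto simp: g_def trig_periodic)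
      moreover have "pint q (f - g) \<le> (C * \<psi>) powr q"
      proof -
        have "pint q (f - g) \<le> C2 * (C1 * \<psi> powr q)" using res(2) unfolding fg .
        also have "\<dots> \<le> (C2 * C1 + 1) * \<psi> powr q" by (simp add: algebra_simps)
        also have "\<dots> = (C * \<psi>) powr q" using C \<psi> by (simp add: powr_mult)
        finally show ?thesis .
      qed
      ultimately have "Lp_norm q (f - g) \<le> ennreal (C * \<psi>)"
        using pq C \<psi> by (intro Lp_norm_le) auto
      moreover have "g \<in> trig_poly n" unfolding g_def by (rule trig_in_trig_poly)
      ultimately show ?thesis by blast
    qed
    then show "deviation (Lp_norm q) (multiplier_class \<Lambda> \<beta> (Lp_ball p)) (trig_poly n) \<le> ennreal (C * ln (real n) powr (- \<gamma>))"
      unfolding deviation_def \<psi>_def[symmetric] by (intro SUP_least) (blast intro: INF_lower2)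
  qed
qed

section \<open>Polynomials orthogonal to a given subspace\<close>

text \<open>
  On polynomials with frequencies in \<open>I\<close> this is the inner product of \<open>L\<^sub>2\<close>, divided by \<open>\<pi>\<close>.
\<close>

definition coef_inner :: "nat set \<Rightarrow> (nat \<Rightarrow> complex) \<Rightarrow> (nat \<Rightarrow> complex) \<Rightarrow> real" where
  "coef_inner I u v = (\<Sum>k\<in>I. u k \<bullet> v k)"

lemma coef_inner_commute: "coef_inner I u v = coef_inner I v u"
  by (simp add: coef_inner_def inner_commute)

lemma coef_inner_diff_left: "coef_inner I (\<lambda>k. u k - v k) w = coef_inner I u w - coef_inner I v w"
  by (simp add: coef_inner_def inner_diff_left sum_subtractf)

lemma coef_inner_scaleR_left: "coef_inner I (\<lambda>k. c *\<^sub>R u k) w = c * coef_inner I u w"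
  by (simp add: coef_inner_def sum_distrib_left)

lemma coef_inner_sum_left: "coef_inner I (\<lambda>k. \<Sum>i\<in>A. u i k) w = (\<Sum>i\<in>A. coef_inner I (u i) w)"
  by (simp add: coef_inner_def inner_sum_left sum.swap[of _ I])

lemma coef_inner_cong: "(\<And>k. k \<in> I \<Longrightarrow> u k = v k) \<Longrightarrow> coef_inner I u w = coef_inner I v w"
  by (simp add: coef_inner_def)

lemma coef_inner_nonneg: "0 \<le> coef_inner I u u"
  by (simp add: coef_inner_def sum_nonneg)

definition orthonormal_system :: "nat set \<Rightarrow> (nat \<Rightarrow> complex) set \<Rightarrow> bool" where
  "orthonormal_system I E \<longleftrightarrow> finite E \<and> (\<forall>e\<in>E. \<forall>k. k \<notin> I \<longrightarrow> e k = 0) \<and>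
     (\<forall>e\<in>E. \<forall>e'\<in>E. coef_inner I e e' = (if e = e' then 1 else 0))"

text \<open>
  Elements that depend on earlier ones are dropped, so the system can be smaller than \<open>B\<close>; the last
  claim says that orthogonality to it still implies orthogonality to \<open>B\<close>.
\<close>

lemma gram_schmidt:
  assumes "finite B" and I: "finite I"
  obtains E where "orthonormal_system I E" "card E \<le> card B"
    "\<And>y b. \<lbrakk>\<And>e. e \<in> E \<Longrightarrow> coef_inner I y e = 0; b \<in> B\<rbrakk> \<Longrightarrow> coef_inner I y b = 0"
proof -
  have "\<exists>E. orthonormal_system I E \<and> card E \<le> card B \<and>
     (\<forall>y. (\<forall>e\<in>E. coef_inner I y e = 0) \<longrightarrow> (\<forall>b\<in>B. coef_inner I y b = 0))"
    using assms(1)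
  proof (induction B rule: finite_induct)
    case empty
    then show ?case by (intro exI[of _ "{}"]) (simp add: orthonormal_system_def)
  next
    case (insert b B)
    then obtain E where E: "orthonormal_system I E" "card E \<le> card B"
      "\<And>y. (\<forall>e\<in>E. coef_inner I y e = 0) \<Longrightarrow> (\<forall>b\<in>B. coef_inner I y b = 0)" by blast
    have finE: "finite E" and supp: "\<And>e k. e \<in> E \<Longrightarrow> k \<notin> I \<Longrightarrow> e k = 0"
      and orth: "\<And>e e'. e \<in> E \<Longrightarrow> e' \<in> E \<Longrightarrow> coef_inner I e e' = (if e = e' then 1 else 0)"
      using E(1) by (auto simp: orthonormal_system_def)
    define u where "u k = (if k \<in> I then b k - (\<Sum>e\<in>E. coef_inner I b e *\<^sub>R e k) else 0)" for k
    have u_inner: "coef_inner I u w = coef_inner I b w - (\<Sum>e\<in>E. coef_inner I b e * coef_inner I e w)" for w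
    proof -
      have "coef_inner I u w = coef_inner I (\<lambda>k. b k - (\<Sum>e\<in>E. coef_inner I b e *\<^sub>R e k)) w"
        by (rule coef_inner_cong) (simp add: u_def)
      then show ?thesis by (simp add: coef_inner_diff_left coef_inner_sum_left coef_inner_scaleR_left)
    qed
    have uE: "coef_inner I u e = 0" if "e \<in> E" for e
      unfolding u_inner using that finE by (simp add: orth if_distrib[of "\<lambda>x. _ * x"] sum.delta cong: if_cong sum.cong)
    show ?case
    proof (cases "coef_inner I u u = 0")
      case True
      then have u0: "u k = 0" if "k \<in> I" for k
        using that I by (simp add: coef_inner_def sum_nonneg_eq_0_iff)
      have "coef_inner I y b = 0" if "\<forall>e\<in>E. coef_inner I y e = 0" for y
      proof -
        have "coef_inner I u y = 0" using u0 by (simp add: coef_inner_def)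
        then show ?thesis using u_inner[of y] that by (simp add: coef_inner_commute[of I _ y])
      qed
      then show ?thesis using E insert.hyps by (intro exI[of _ E]) auto
    next
      case False
      then have pos: "0 < coef_inner I u u" using coef_inner_nonneg[of I u] by simp
      define e0 where "e0 k = (1 / sqrt (coef_inner I u u)) *\<^sub>R u k" for k
      have e0_inner: "coef_inner I e0 w = coef_inner I u w / sqrt (coef_inner I u u)" for w
        using coef_inner_scaleR_left[of I "1 / sqrt (coef_inner I u u)" u w] by (simp add: e0_def[abs_def])
      have e0E: "coef_inner I e0 e = 0" if "e \<in> E" for e using uE[OF that] by (simp add: e0_inner)
      have e0e0: "coef_inner I e0 e0 = 1"
        using pos by (simp add: e0_inner coef_inner_commute[of I u e0] real_div_sqrt)
      have "e0 \<notin> E" using e0E[of e0] e0e0 by auto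
      have "coef_inner I y b = 0" if "\<forall>e\<in>insert e0 E. coef_inner I y e = 0" for y
      proof -
        have "coef_inner I u y = 0" using that pos e0_inner[of y] by (simp add: coef_inner_commute[of I y e0])
        then show ?thesis using u_inner[of y] that by (simp add: coef_inner_commute[of I _ y])
      qed
      moreover have "orthonormal_system I (insert e0 E)"
      proof -
        have "coef_inner I e e0 = 0" if "e \<in> E" for e using e0E[OF that] by (simp add: coef_inner_commute)
        moreover have "e0 k = 0" if "k \<notin> I" for k using that by (simp add: e0_def u_def)
        ultimately show ?thesis
          unfolding orthonormal_system_def using finE supp orth e0E e0e0 \<open>e0 \<notin> E\<close> by auto
      qed
      ultimately show ?thesis using E insert.hyps finE \<open>e0 \<notin> E\<close>
        by (intro exI[of _ "insert e0 E"]) auto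
    qed
  qed
  then show ?thesis using that by blast
qed

text \<open>
  Here \<open>z\<close> is the projection of \<open>x\<close> to the span of the system. Its squared length is kept as a sum over
  the system, because this sum can be averaged over families of \<open>x\<close>.
\<close>

lemma orthogonal_part:
  assumes E: "orthonormal_system I E" and x: "\<And>k. k \<notin> I \<Longrightarrow> x k = 0"
  obtains y z where "\<And>k. x k = y k + z k" "\<And>k. k \<notin> I \<Longrightarrow> y k = 0" "\<And>k. k \<notin> I \<Longrightarrow> z k = 0"
    "\<And>e. e \<in> E \<Longrightarrow> coef_inner I y e = 0"
    "coef_inner I z z = (\<Sum>e\<in>E. (coef_inner I x e)\<^sup>2)"
    "coef_inner I y y = coef_inner I x x - (\<Sum>e\<in>E. (coef_inner I x e)\<^sup>2)"
proof -
  have finE: "finite E" and supp: "\<And>e k. e \<in> E \<Longrightarrow> k \<notin> I \<Longrightarrow> e k = 0"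
    and orth: "\<And>e e'. e \<in> E \<Longrightarrow> e' \<in> E \<Longrightarrow> coef_inner I e e' = (if e = e' then 1 else 0)"
    using E by (auto simp: orthonormal_system_def)
  define z where "z k = (\<Sum>e\<in>E. coef_inner I x e *\<^sub>R e k)" for k
  define y where "y k = x k - z k" for k
  have z_inner: "coef_inner I z w = (\<Sum>e\<in>E. coef_inner I x e * coef_inner I e w)" for w
    unfolding z_def[abs_def] by (simp add: coef_inner_sum_left coef_inner_scaleR_left)
  have zE: "coef_inner I z e = coef_inner I x e" if "e \<in> E" for e
    unfolding z_inner using that finE by (simp add: orth if_distrib[of "\<lambda>x. _ * x"] sum.delta cong: if_cong sum.cong)
  have y_inner: "coef_inner I y w = coef_inner I x w - coef_inner I z w" for w
    unfolding y_def[abs_def] by (rule coef_inner_diff_left)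
  have zz: "coef_inner I z z = (\<Sum>e\<in>E. (coef_inner I x e)\<^sup>2)"
    unfolding z_inner by (intro sum.cong refl) (simp add: coef_inner_commute[of I _ z] zE power2_eq_square)
  have zx: "coef_inner I z x = (\<Sum>e\<in>E. (coef_inner I x e)\<^sup>2)"
    unfolding z_inner by (intro sum.cong refl) (simp add: coef_inner_commute[of I _ x] power2_eq_square)
  have zs: "z k = 0" if "k \<notin> I" for k unfolding z_def by (rule sum.neutral) (use supp that in auto)
  then have ys: "y k = 0" if "k \<notin> I" for k using x that by (simp add: y_def)
  show ?thesis
  proof (rule that[of y z])
    show "coef_inner I y y = coef_inner I x x - (\<Sum>e\<in>E. (coef_inner I x e)\<^sup>2)"
      using zz zx y_inner[of y] y_inner[of x] y_inner[of z]
      by (simp add: coef_inner_commute[of I x y] coef_inner_commute[of I z y] coef_inner_commute[of I x z])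
  qed (use zs ys zE zz y_inner in \<open>auto simp: y_def\<close>)
qed

lemma integral_trig_square:
  assumes "I \<subseteq> {1..N}" "\<And>k. k \<notin> I \<Longrightarrow> u k = 0"
  shows "(\<integral>x. (trig N u x)\<^sup>2 \<partial>circle) = pi * coef_inner I u u"
proof -
  have "(\<integral>x. (trig N u x)\<^sup>2 \<partial>circle) = pi * (\<Sum>k=1..N. u k \<bullet> u k)"
    unfolding power2_eq_square by (rule integral_trig_mult)
  also have "(\<Sum>k=1..N. u k \<bullet> u k) = coef_inner I u u"
    unfolding coef_inner_def using assms by (intro sum.mono_neutral_right) auto
  finally show ?thesis .
qed

lemma trig_square_le:
  assumes "I \<subseteq> {1..N}" "\<And>k. k \<notin> I \<Longrightarrow> u k = 0"
  shows "(trig N u x)\<^sup>2 \<le> real N * coef_inner I u u"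
proof -
  have "(\<Sum>k=1..N. u k \<bullet> cis (real k * x))\<^sup>2 \<le> (\<Sum>k=1..N. 1\<^sup>2) * (\<Sum>k=1..N. (u k \<bullet> cis (real k * x))\<^sup>2)"
    using Cauchy_Schwarz_ineq_sum[of "\<lambda>_. 1" "\<lambda>k. u k \<bullet> cis (real k * x)" "{1..N}"] by simp
  also have "\<dots> \<le> (\<Sum>k=1..N. 1\<^sup>2) * (\<Sum>k=1..N. u k \<bullet> u k)"
  proof (intro mult_left_mono sum_mono)
    fix k
    have "(u k \<bullet> cis (real k * x))\<^sup>2 \<le> (u k \<bullet> u k) * (cis (real k * x) \<bullet> cis (real k * x))"
      by (rule Cauchy_Schwarz_ineq)
    then show "(u k \<bullet> cis (real k * x))\<^sup>2 \<le> u k \<bullet> u k" by (simp add: dot_square_norm)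
  qed (simp add: sum_nonneg)
  also have "(\<Sum>k=1..N. u k \<bullet> u k) = coef_inner I u u"
    unfolding coef_inner_def using assms by (intro sum.mono_neutral_right) auto
  finally show ?thesis by (simp add: trig_def)
qed

text \<open>
  An inequality of Nikolskii type: for \<open>r \<le> 2\<close> it amounts to Jensen's inequality, and for \<open>r > 2\<close> the excess
  power is bounded by the maximum, which is at most \<open>N\<^bsup>1/2\<^esup>\<close> times the \<open>L\<^sub>2\<close> norm of the coefficients.
\<close>

lemma integral_trig_powr_le:
  fixes r :: real
  assumes I: "I \<subseteq> {1..N}" "\<And>k. k \<notin> I \<Longrightarrow> u k = 0" and r: "1 < r" and N: "0 < N"
  shows "pint r (trig N u)
    \<le> 3 * pi * (max 1 (real N powr (r / 2 - 1)) * coef_inner I u u powr (r / 2))"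
proof (cases "coef_inner I u u = 0")
  case True
  then have "trig N u x = 0" for x using trig_square_le[of I N u, OF I] by simp
  then show ?thesis using True r by simp
next
  case False
  define d where "d = coef_inner I u u"
  have d: "0 < d" using False coef_inner_nonneg[of I u] by (simp add: d_def)
  have sq: "integrable circle (\<lambda>x. (trig N u x)\<^sup>2)"
    by (intro integrable_circle_continuous continuous_intros)
  have Ir: "integrable circle (\<lambda>x. \<bar>trig N u x\<bar> powr r)" using r by (intro integrable_trig_powr) auto
  have tsq: "\<bar>t\<bar> powr s = (t\<^sup>2) powr (s / 2)" for t s :: real
  proof -
    have "(t\<^sup>2) powr (s / 2) = (\<bar>t\<bar> powr 2) powr (s / 2)" by simp
    then show ?thesis by (simp only: powr_powr) simp
  qed
  have "pint r (trig N u)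
      \<le> (\<integral>x. (max 1 (real N powr (r / 2 - 1)) * d powr (r / 2)) * (1 + (trig N u x)\<^sup>2 / d) \<partial>circle)"
  proof (rule integral_mono[OF Ir])
    fix x
    define t where "t = (trig N u x)\<^sup>2"
    have t: "0 \<le> t" "t \<le> real N * d" unfolding t_def d_def using trig_square_le[of I N u, OF I] by auto
    have pt: "\<bar>trig N u x\<bar> powr r = t powr (r / 2)" unfolding t_def by (rule tsq)
    have scale: "t powr (r / 2) = d powr (r / 2) * (t / d) powr (r / 2)"
      using t d by (simp add: powr_divide)
    have "(t / d) powr (r / 2) \<le> max 1 (real N powr (r / 2 - 1)) * (1 + t / d)"
    proof (cases "r \<le> 2")
      case True
      have "(t / d) powr (r / 2) \<le> 1 + t / d"
      proof (cases "t / d \<le> 1")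
        case True
        then have "(t / d) powr (r / 2) \<le> 1 powr (r / 2)" using t d r by (intro powr_mono2) auto
        then show ?thesis using t d by (simp add: add_increasing2)
      next
        case False
        then have "(t / d) powr (r / 2) \<le> (t / d) powr 1" using \<open>r \<le> 2\<close> by (intro powr_mono) auto
        then show ?thesis using t d by simp
      qed
      also have "\<dots> \<le> max 1 (real N powr (r / 2 - 1)) * (1 + t / d)"
        using t d mult_right_mono[of 1 "max 1 (real N powr (r / 2 - 1))" "1 + t / d"] by simp
      finally show ?thesis .
    next
      case False
      have "(t / d) powr (r / 2) = (t / d) powr (r / 2 - 1) * (t / d)"
        using t d powr_mult_base[of "t / d" "r / 2 - 1"] by (simp add: mult.commute)
      also have "\<dots> \<le> real N powr (r / 2 - 1) * (t / d)"
        using False t d by (intro mult_right_mono powr_mono2) (auto simp: pos_divide_le_eq)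
      also have "\<dots> \<le> max 1 (real N powr (r / 2 - 1)) * (1 + t / d)"
        using t d by (intro mult_mono) auto
      finally show ?thesis .
    qed
    then have "d powr (r / 2) * (t / d) powr (r / 2) \<le> d powr (r / 2) * (max 1 (real N powr (r / 2 - 1)) * (1 + t / d))"
      by (intro mult_left_mono) auto
    then show "\<bar>trig N u x\<bar> powr r \<le> (max 1 (real N powr (r / 2 - 1)) * d powr (r / 2)) * (1 + (trig N u x)\<^sup>2 / d)"
      unfolding pt scale t_def[symmetric] by (simp only: mult_ac)
  qed (use sq in simp)
  also have "\<dots> = (max 1 (real N powr (r / 2 - 1)) * d powr (r / 2)) * (2 * pi + pi * d / d)"
    using sq by (simp add: integral_trig_square[of I N u, OF I] d_def)
  also have "\<dots> = 3 * pi * (max 1 (real N powr (r / 2 - 1)) * d powr (r / 2))"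
    using d by simp
  finally show ?thesis by (simp add: d_def)
qed

lemma integral_orthogonal_part_le:
  fixes r :: real
  assumes r: "1 < r" and N: "0 < N" and I: "I \<subseteq> {1..N}" "\<And>k. k \<notin> I \<Longrightarrow> z k = 0"
    and xyz: "\<And>k. x k = y k + z k" and X: "pint r (trig N x) \<le> X"
    and Z: "3 * pi * (max 1 (real N powr (r / 2 - 1)) * coef_inner I z z powr (r / 2)) \<le> Z"
  shows "pint r (trig N y) \<le> 2 powr r * (X + Z)"
proof -
  have Ir: "integrable circle (\<lambda>t. \<bar>trig N u t\<bar> powr r)" for u using r by (intro integrable_trig_powr) auto
  have eq: "trig N y t = trig N x t + - trig N z t" for t
    using trig_cong[of N x "\<lambda>k. y k + z k" t] xyz by (simp add: trig_add)
  have "pint r (trig N y)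
     \<le> 2 powr r * (pint r (trig N x) + (\<integral>t. \<bar>- trig N z t\<bar> powr r \<partial>circle))"
    unfolding eq using r Ir by (intro integral_powr_add_le) auto
  also have "\<dots> \<le> 2 powr r * (X + Z)"
    using X Z integral_trig_powr_le[of I N z, OF I r N] by (intro mult_left_mono add_mono) auto
  finally show ?thesis .
qed

text \<open>
  A single cosine, made orthogonal to few given vectors, stays flat: among many frequencies there is
  one that is nearly orthogonal to all of them.
\<close>

lemma flat_orthogonal_polynomial:
  assumes B: "finite B" "card B \<le> m" and N: "2 * m + 2 \<le> N"
  obtains y where "\<And>k. k \<notin> {2..N} \<Longrightarrow> y k = 0" "\<And>b. b \<in> B \<Longrightarrow> coef_inner {2..N} y b = 0"
    "1 / 2 \<le> coef_inner {2..N} y y"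
    "\<And>r. 1 < r \<Longrightarrow> real m powr (r / 2) \<le> real N \<Longrightarrow>
      pint r (trig N y) \<le> 2 powr r * (2 * pi + 3 * pi * 2 powr (r / 2))"
proof -
  let ?I = "{2..N}"
  obtain E where E: "orthonormal_system ?I E" "card E \<le> card B"
    "\<And>y b. \<lbrakk>\<And>e. e \<in> E \<Longrightarrow> coef_inner ?I y e = 0; b \<in> B\<rbrakk> \<Longrightarrow> coef_inner ?I y b = 0"
    using gram_schmidt[OF B(1), of ?I] by blast
  have finE: "finite E" and norm: "\<And>e. e \<in> E \<Longrightarrow> coef_inner ?I e e = 1"
    using E(1) by (auto simp: orthonormal_system_def)
  define x where "x j k = (if k = j then 1 else 0 :: complex)" for j k :: nat
  have x_inner: "coef_inner ?I (x j) w = Re (w j)" if "j \<in> ?I" for j w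
  proof -
    have "coef_inner ?I (x j) w = (\<Sum>k\<in>?I. if k = j then Re (w k) else 0)"
      unfolding coef_inner_def by (intro sum.cong) (auto simp: x_def inner_complex_def)
    then show ?thesis using that by (simp add: sum.delta)
  qed
  \<comment> \<open>By Bessel's inequality each \<open>e\<close> contributes at most 1 to the sum over all \<open>N - 1\<close> frequencies.\<close>
  have "\<exists>j\<in>?I. real (N - 1) * (\<Sum>e\<in>E. (coef_inner ?I (x j) e)\<^sup>2) \<le> real m"
  proof (rule ccontr)
    assume "\<not> ?thesis"
    then have less: "real m / real (N - 1) < (\<Sum>e\<in>E. (coef_inner ?I (x j) e)\<^sup>2)" if "j \<in> ?I" for j
      using that N by (auto simp: pos_divide_less_eq mult.commute not_le)
    have "real m = (\<Sum>j\<in>?I. real m / real (N - 1))" using N by simp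
    also have "\<dots> < (\<Sum>j\<in>?I. \<Sum>e\<in>E. (coef_inner ?I (x j) e)\<^sup>2)"
      using N less by (intro sum_strict_mono) auto
    also have "\<dots> = (\<Sum>e\<in>E. \<Sum>j\<in>?I. (Re (e j))\<^sup>2)"
      by (subst sum.swap) (simp add: x_inner)
    also have "\<dots> \<le> (\<Sum>e\<in>E. coef_inner ?I e e)"
      unfolding coef_inner_def by (intro sum_mono) (simp add: inner_complex_def power2_eq_square)
    also have "\<dots> = real (card E)" by (simp add: norm)
    finally show False using E(2) B(2) by simp
  qed
  then obtain j where j: "j \<in> ?I" "real (N - 1) * (\<Sum>e\<in>E. (coef_inner ?I (x j) e)\<^sup>2) \<le> real m" by blast
  obtain y z where yz: "\<And>k. x j k = y k + z k" "\<And>k. k \<notin> ?I \<Longrightarrow> y k = 0" "\<And>k. k \<notin> ?I \<Longrightarrow> z k = 0"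
    "\<And>e. e \<in> E \<Longrightarrow> coef_inner ?I y e = 0"
    "coef_inner ?I z z = (\<Sum>e\<in>E. (coef_inner ?I (x j) e)\<^sup>2)"
    "coef_inner ?I y y = coef_inner ?I (x j) (x j) - (\<Sum>e\<in>E. (coef_inner ?I (x j) e)\<^sup>2)"
    by (rule orthogonal_part[OF E(1), of "x j"]) (use j(1) in \<open>auto simp: x_def\<close>)
  define d where "d = coef_inner ?I z z"
  have d0: "0 \<le> d" unfolding d_def by (rule coef_inner_nonneg)
  have Nd: "real (N - 1) * d \<le> real m" using j(2) yz(5) by (simp add: d_def)
  have N1: "2 * real m + 1 \<le> real (N - 1)" "real N \<le> 2 * real (N - 1)" using N by (simp_all add: of_nat_diff)
  have "(2 * real m + 1) * d \<le> real (N - 1) * d" using N1 d0 by (intro mult_right_mono)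
  then have "real m * d + real m * d + d \<le> real m" using Nd by (simp add: algebra_simps)
  then have d_half: "d \<le> 1 / 2"
  proof -
    assume *: "real m * d + real m * d + d \<le> real m"
    show ?thesis
    proof (rule ccontr)
      assume "\<not> d \<le> 1 / 2"
      then have "real m * (1 / 2) \<le> real m * d" by (intro mult_left_mono) auto
      then show False using * \<open>\<not> d \<le> 1 / 2\<close> by linarith
    qed
  qed
  have dN: "d \<le> 2 * real m / real N"
  proof -
    have "real N * d \<le> 2 * real (N - 1) * d" using N1 d0 by (intro mult_right_mono)
    then have "real N * d \<le> 2 * real m" using Nd by simp
    then show ?thesis using N by (simp add: pos_le_divide_eq mult.commute)
  qed
  show ?thesis
  proof (rule that[of y])
    show "1 / 2 \<le> coef_inner ?I y y" using yz(5,6) d_half j(1) by (simp add: d_def x_inner) (simp add: x_def)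
    fix r :: real assume r: "1 < r" "real m powr (r / 2) \<le> real N"
    show "pint r (trig N y) \<le> 2 powr r * (2 * pi + 3 * pi * 2 powr (r / 2))"
    proof (rule integral_orthogonal_part_le[where x="x j" and z=z and I="?I"])
      show "pint r (trig N (x j)) \<le> 2 * pi"
      proof -
        have tx: "trig N (x j) t = cos (real j * t)" for t
        proof -
          have "trig N (x j) t = (\<Sum>k=1..N. if k = j then cos (real k * t) else 0)"
            unfolding trig_def by (intro sum.cong) (auto simp: x_def inner_cis)
          then show ?thesis using j(1) by (simp add: sum.delta)
        qed
        have "pint r (trig N (x j)) \<le> (\<integral>t. 1 \<partial>circle)"
        proof (rule integral_mono)
          fix t
          have "\<bar>cos (real j * t)\<bar> powr r \<le> 1 powr r" using r by (intro powr_mono2) auto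
          then show "\<bar>trig N (x j) t\<bar> powr r \<le> 1" by (simp add: tx)
        qed (use r in \<open>auto intro: integrable_trig_powr\<close>)
        then show ?thesis by simp
      qed
      have "max 1 (real N powr (r / 2 - 1)) * d powr (r / 2) \<le> 2 powr (r / 2)"
      proof (cases "r \<le> 2")
        case True
        have "real N powr (r / 2 - 1) \<le> real N powr 0" using True N by (intro powr_mono) auto
        then have "max 1 (real N powr (r / 2 - 1)) = 1" using N by simp
        moreover have "d powr (r / 2) \<le> 2 powr (r / 2)" using d0 d_half r by (intro powr_mono2) auto
        ultimately show ?thesis by simp
      next
        case False
        have "real N powr 0 \<le> real N powr (r / 2 - 1)" using False N by (intro powr_mono) auto
        then have "max 1 (real N powr (r / 2 - 1)) = real N powr (r / 2 - 1)" using N by simp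
        moreover have "real N powr (r / 2 - 1) * d powr (r / 2) \<le> 2 powr (r / 2)"
        proof -
          have "d powr (r / 2) \<le> (2 * real m / real N) powr (r / 2)" using d0 dN r by (intro powr_mono2) auto
          then have "real N powr (r / 2 - 1) * d powr (r / 2) \<le> real N powr (r / 2 - 1) * (2 * real m / real N) powr (r / 2)"
            by (intro mult_left_mono) auto
          also have "\<dots> = 2 powr (r / 2) * (real m powr (r / 2) / real N)"
            using N by (simp add: powr_divide powr_mult powr_diff)
          also have "\<dots> \<le> 2 powr (r / 2) * 1" using r N by (intro mult_left_mono) auto
          finally show ?thesis by simp
        qed
        ultimately show ?thesis by simp
      qed
      then show "3 * pi * (max 1 (real N powr (r / 2 - 1)) * coef_inner ?I z z powr (r / 2)) \<le> 3 * pi * 2 powr (r / 2)"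
        unfolding d_def by (intro mult_left_mono) auto
    qed (use r N yz in auto)
  qed (use yz E(3) in auto)
qed

text \<open>
  The same for translates of the Fejer kernel, which concentrate near one point: here the average is
  over the centre of concentration.
\<close>

lemma peaked_orthogonal_polynomial:
  assumes B: "finite B" "card B \<le> m" and m: "1 \<le> m" and N: "20 * m \<le> N"
  obtains y where "\<And>k. k \<notin> {2..N} \<Longrightarrow> y k = 0" "\<And>b. b \<in> B \<Longrightarrow> coef_inner {2..N} y b = 0"
    "real N / 8 \<le> coef_inner {2..N} y y"
    "\<And>r. 1 < r \<Longrightarrow> real m powr (r / 2) \<le> real N powr (r - 1) \<Longrightarrow>
      pint r (trig N y)
        \<le> 2 powr r * (2 powr r * (2 * pi + 2 * pi * 3 powr r) + 3 * pi * 3 powr (r / 2)) * real N powr (r - 1)"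
proof -
  let ?I = "{2..N}"
  have N0: "0 < N" "1 \<le> N" using N m by auto
  obtain E where E: "orthonormal_system ?I E" "card E \<le> card B"
    "\<And>y b. \<lbrakk>\<And>e. e \<in> E \<Longrightarrow> coef_inner ?I y e = 0; b \<in> B\<rbrakk> \<Longrightarrow> coef_inner ?I y b = 0"
    using gram_schmidt[OF B(1), of ?I] by blast
  have finE: "finite E" and norm: "\<And>e. e \<in> E \<Longrightarrow> coef_inner ?I e e = 1"
    and supp: "\<And>e k. e \<in> E \<Longrightarrow> k \<notin> ?I \<Longrightarrow> e k = 0"
    using E(1) by (auto simp: orthonormal_system_def)
  define a where "a k = 2 * cesaro_weight N k" for k
  have a: "0 \<le> a k" "a k \<le> 2" for k using cesaro_weight_bounds[of N k] by (auto simp: a_def)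
  define x where "x s k = (if k \<in> ?I then a k *\<^sub>R cis (real k * s) else 0)" for s k
  have x_inner: "coef_inner ?I (x s) e = trig N (\<lambda>k. a k *\<^sub>R e k) s" if "e \<in> E" for s e
  proof -
    have "trig N (\<lambda>k. a k *\<^sub>R e k) s = (\<Sum>k\<in>?I. (a k *\<^sub>R e k) \<bullet> cis (real k * s))"
      unfolding trig_def using supp[OF that] by (intro sum.mono_neutral_right) auto
    then show ?thesis unfolding coef_inner_def x_def by (simp add: inner_commute)
  qed
  have mass: "(\<integral>s. (trig N (\<lambda>k. a k *\<^sub>R e k) s)\<^sup>2 \<partial>circle) \<le> 4 * pi" if "e \<in> E" for e
  proof -
    have "(\<integral>s. (trig N (\<lambda>k. a k *\<^sub>R e k) s)\<^sup>2 \<partial>circle) = pi * coef_inner ?I (\<lambda>k. a k *\<^sub>R e k) (\<lambda>k. a k *\<^sub>R e k)"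
      by (rule integral_trig_square) (use supp[OF that] in auto)
    also have "coef_inner ?I (\<lambda>k. a k *\<^sub>R e k) (\<lambda>k. a k *\<^sub>R e k) \<le> 4 * coef_inner ?I e e"
      unfolding coef_inner_def sum_distrib_left
    proof (rule sum_mono)
      fix k
      have "a k * a k \<le> 2 * 2" using a[of k] by (intro mult_mono) auto
      then have "(a k * a k) * (e k \<bullet> e k) \<le> 4 * (e k \<bullet> e k)" by (intro mult_right_mono) auto
      then show "(a k *\<^sub>R e k) \<bullet> (a k *\<^sub>R e k) \<le> 4 * (e k \<bullet> e k)" by simp
    qed
    finally show ?thesis using norm[OF that] by simp
  qed
  \<comment> \<open>The average over \<open>s\<close> is at most \<open>2 m\<close>, by Parseval's identity for each \<open>e\<close>.\<close>
  have "\<exists>s. (\<Sum>e\<in>E. (coef_inner ?I (x s) e)\<^sup>2) \<le> 3 * real m"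
  proof (rule ccontr)
    assume "\<not> ?thesis"
    then have less: "3 * real m \<le> (\<Sum>e\<in>E. (trig N (\<lambda>k. a k *\<^sub>R e k) s)\<^sup>2)" for s
      using x_inner by (auto simp: not_le intro: less_imp_le)
    have Is: "integrable circle (\<lambda>s. (trig N (\<lambda>k. a k *\<^sub>R e k) s)\<^sup>2)" for e
      by (intro integrable_circle_continuous continuous_intros)
    have "2 * pi * (3 * real m) = (\<integral>s. 3 * real m \<partial>circle)" by simp
    also have "\<dots> \<le> (\<integral>s. (\<Sum>e\<in>E. (trig N (\<lambda>k. a k *\<^sub>R e k) s)\<^sup>2) \<partial>circle)"
      using Is less by (intro integral_mono) auto
    also have "\<dots> = (\<Sum>e\<in>E. (\<integral>s. (trig N (\<lambda>k. a k *\<^sub>R e k) s)\<^sup>2 \<partial>circle))"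
      using Is by (intro Bochner_Integration.integral_sum) auto
    also have "\<dots> \<le> (\<Sum>e\<in>E. 4 * pi)" by (intro sum_mono mass)
    also have "\<dots> \<le> 4 * pi * real m" using E(2) B(2) by simp
    finally show False using m by simp
  qed
  then obtain s where s: "(\<Sum>e\<in>E. (coef_inner ?I (x s) e)\<^sup>2) \<le> 3 * real m" by blast
  obtain y z where yz: "\<And>k. x s k = y k + z k" "\<And>k. k \<notin> ?I \<Longrightarrow> y k = 0" "\<And>k. k \<notin> ?I \<Longrightarrow> z k = 0"
    "\<And>e. e \<in> E \<Longrightarrow> coef_inner ?I y e = 0"
    "coef_inner ?I z z = (\<Sum>e\<in>E. (coef_inner ?I (x s) e)\<^sup>2)"
    "coef_inner ?I y y = coef_inner ?I (x s) (x s) - (\<Sum>e\<in>E. (coef_inner ?I (x s) e)\<^sup>2)"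
    by (rule orthogonal_part[OF E(1), of "x s"]) (auto simp: x_def)
  define d where "d = coef_inner ?I z z"
  have d0: "0 \<le> d" unfolding d_def by (rule coef_inner_nonneg)
  have dm: "d \<le> 3 * real m" using s yz(5) by (simp add: d_def)
  have xx: "real N / 2 - 2 \<le> coef_inner ?I (x s) (x s)"
  proof -
    have "N \<le> 2 * (N div 2) + 1" by simp
    then have "real N \<le> 2 * real (N div 2) + 1" by linarith
    then have "real N / 2 - 2 \<le> (\<Sum>k\<in>{2..N div 2}. 1)" using N m by (simp add: of_nat_diff)
    also have "\<dots> \<le> (\<Sum>k\<in>{2..N div 2}. a k * a k)"
    proof (rule sum_mono)
      fix k assume "k \<in> {2..N div 2}"
      then have "real k / real N \<le> 1 / 2" using N0 by (simp add: field_simps) linarith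
      moreover have "1 - real k / real N \<le> cesaro_weight N k" by (simp add: cesaro_weight_def)
      ultimately have "1 \<le> a k" unfolding a_def by linarith
      then show "1 \<le> a k * a k" using mult_mono[of 1 "a k" 1 "a k"] by simp
    qed
    also have "\<dots> \<le> (\<Sum>k\<in>?I. a k * a k)" by (rule sum_mono2) auto
    also have "\<dots> = coef_inner ?I (x s) (x s)"
      unfolding coef_inner_def by (intro sum.cong refl) (simp add: x_def dot_square_norm, simp only: power2_eq_square)
    finally show ?thesis .
  qed
  show ?thesis
  proof (rule that[of y])
    have "real (20 * m) \<le> real N" using N by (simp only: of_nat_le_iff)
    moreover have "1 \<le> real m" using m by simp
    ultimately show "real N / 8 \<le> coef_inner ?I y y" using yz(5,6) dm xx by (simp add: d_def)
    fix r :: real assume r: "1 < r" "real m powr (r / 2) \<le> real N powr (r - 1)"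
    have N1: "1 \<le> real N powr (r - 1)" using N0 r by (intro ge_one_powr_ge_zero) auto
    have "pint r (trig N y)
        \<le> 2 powr r * (2 powr r * (2 * pi * real N powr (r - 1) + 2 * pi * 3 powr r) + 3 * pi * (3 powr (r / 2) * real N powr (r - 1)))"
    proof (rule integral_orthogonal_part_le[where x="x s" and z=z and I="?I"])
      show "pint r (trig N (x s)) \<le> 2 powr r * (2 * pi * real N powr (r - 1) + 2 * pi * 3 powr r)"
      proof -
        \<comment> \<open>The kernel without its terms of frequency 0 and 1.\<close>
        define c where "c t = - (1 + a 1 * cos (t - s))" for t
        have tx: "trig N (x s) t = fejer N (t - s) + c t" for t
        proof -
          have "fejer N (t - s) = 1 + (\<Sum>k=1..N. a k * cos (real k * (t - s)))"
            unfolding fejer_expand[OF N0(1) order_refl] by (simp add: a_def sum_distrib_left mult.assoc)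
          also have "(\<Sum>k=1..N. a k * cos (real k * (t - s))) = a 1 * cos (t - s) + (\<Sum>k\<in>?I. a k * cos (real k * (t - s)))"
            using N0 by (subst sum.atLeast_Suc_atMost) (auto simp: numeral_2_eq_2)
          also have "(\<Sum>k\<in>?I. a k * cos (real k * (t - s))) = trig N (x s) t"
          proof -
            have "trig N (x s) t = (\<Sum>k\<in>?I. x s k \<bullet> cis (real k * t))"
              unfolding trig_def by (rule sum.mono_neutral_right) (auto simp: x_def)
            also have "\<dots> = (\<Sum>k\<in>?I. a k * cos (real k * (t - s)))"
              by (intro sum.cong refl) (simp add: x_def inner_cis right_diff_distrib cos_diff algebra_simps)
            finally show ?thesis ..
          qed
          finally show ?thesis by (simp add: c_def)
        qed
        have contF: "continuous_on UNIV (\<lambda>t. fejer N (t - s))" and contc: "continuous_on UNIV c"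
          unfolding c_def[abs_def] by (intro continuous_intros)+
        have Fp: "(\<integral>t. \<bar>fejer N (t - s)\<bar> powr r \<partial>circle) \<le> 2 * pi * real N powr (r - 1)"
        proof -
          have "(\<integral>t. \<bar>fejer N (t - s)\<bar> powr r \<partial>circle) \<le> (\<integral>t. real N powr (r - 1) * fejer N (s - t) \<partial>circle)"
          proof (rule integral_mono)
            show "integrable circle (\<lambda>t. \<bar>fejer N (t - s)\<bar> powr r)" using contF r by (intro integrable_powr_continuous) auto
            show "integrable circle (\<lambda>t. real N powr (r - 1) * fejer N (s - t))"
              by (intro integrable_circle_continuous continuous_intros)
            fix t
            have "\<bar>fejer N (t - s)\<bar> powr r = fejer N (t - s) powr (r - 1) * fejer N (t - s)"
              using fejer_nonneg[of N "t - s"] powr_mult_base[of "fejer N (t - s)" "r - 1"] by (simp add: mult.commute)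
            also have "\<dots> \<le> real N powr (r - 1) * fejer N (t - s)"
              using r fejer_nonneg fejer_le by (intro mult_right_mono powr_mono2) auto
            finally show "\<bar>fejer N (t - s)\<bar> powr r \<le> real N powr (r - 1) * fejer N (s - t)"
              by (simp add: fejer_minus[of N s t])
          qed
          also have "\<dots> = 2 * pi * real N powr (r - 1)" using N0 by (simp add: integral_fejer)
          finally show ?thesis .
        qed
        have cp: "pint r c \<le> 2 * pi * 3 powr r"
        proof -
          have "pint r c \<le> (\<integral>t. 3 powr r \<partial>circle)"
          proof (rule integral_mono)
            show "integrable circle (\<lambda>t. \<bar>c t\<bar> powr r)" using contc r by (intro integrable_powr_continuous) auto
            fix t
            have "\<bar>a 1 * cos (t - s)\<bar> \<le> 2 * 1" unfolding abs_mult using a[of 1] by (intro mult_mono) auto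
            then have "\<bar>c t\<bar> \<le> 3" unfolding c_def by linarith
            then show "\<bar>c t\<bar> powr r \<le> 3 powr r" using r by (intro powr_mono2) auto
          qed simp
          then show ?thesis by simp
        qed
        have "pint r (trig N (x s))
            \<le> 2 powr r * ((\<integral>t. \<bar>fejer N (t - s)\<bar> powr r \<partial>circle) + pint r c)"
          unfolding tx using r contF contc
          by (intro integral_powr_add_le integrable_powr_continuous borel_measurable_continuous_onI measurable_circleI) auto
        also have "\<dots> \<le> 2 powr r * (2 * pi * real N powr (r - 1) + 2 * pi * 3 powr r)"
          by (intro mult_left_mono add_mono Fp cp) auto
        finally show ?thesis .
      qed
      have "max 1 (real N powr (r / 2 - 1)) * (real m powr (r / 2)) \<le> real N powr (r - 1)"
      proof (cases "r \<le> 2")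
        case True
        have "real N powr (r / 2 - 1) \<le> real N powr 0" using True N0 by (intro powr_mono) auto
        then have "max 1 (real N powr (r / 2 - 1)) = 1" using N0 by simp
        then show ?thesis using r by simp
      next
        case False
        have "real N powr 0 \<le> real N powr (r / 2 - 1)" using False N0 by (intro powr_mono) auto
        then have "max 1 (real N powr (r / 2 - 1)) = real N powr (r / 2 - 1)" using N0 by simp
        moreover have "real N powr (r / 2 - 1) * real m powr (r / 2) \<le> real N powr (r - 1)"
        proof -
          have "real m powr (r / 2) \<le> real N powr (r / 2)" using N r by (intro powr_mono2) auto
          then have "real N powr (r / 2 - 1) * real m powr (r / 2) \<le> real N powr (r / 2 - 1) * real N powr (r / 2)"
            by (intro mult_left_mono) auto
          also have "\<dots> = real N powr (r - 1)" by (simp add: powr_add[symmetric])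
          finally show ?thesis .
        qed
        ultimately show ?thesis by simp
      qed
      then have "3 powr (r / 2) * (max 1 (real N powr (r / 2 - 1)) * real m powr (r / 2)) \<le> 3 powr (r / 2) * real N powr (r - 1)"
        by (intro mult_left_mono) auto
      moreover have "d powr (r / 2) \<le> (3 * real m) powr (r / 2)" using d0 dm r by (intro powr_mono2) auto
      then have "max 1 (real N powr (r / 2 - 1)) * d powr (r / 2) \<le> max 1 (real N powr (r / 2 - 1)) * (3 * real m) powr (r / 2)"
        by (intro mult_left_mono) auto
      moreover have "(3 * real m) powr (r / 2) = 3 powr (r / 2) * real m powr (r / 2)" by (simp add: powr_mult)
      ultimately have "max 1 (real N powr (r / 2 - 1)) * d powr (r / 2) \<le> 3 powr (r / 2) * real N powr (r - 1)"
        by (simp only: mult_ac)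
      then show "3 * pi * (max 1 (real N powr (r / 2 - 1)) * coef_inner ?I z z powr (r / 2)) \<le> 3 * pi * (3 powr (r / 2) * real N powr (r - 1))"
        unfolding d_def by (intro mult_left_mono) auto
    qed (use r N0 yz in auto)
    also have "\<dots> \<le> 2 powr r * (2 powr r * (2 * pi * real N powr (r - 1) + 2 * pi * 3 powr r * real N powr (r - 1)) + 3 * pi * (3 powr (r / 2) * real N powr (r - 1)))"
      using N1 by (intro mult_left_mono add_mono order_refl) auto
    also have "\<dots> = 2 powr r * (2 powr r * (2 * pi + 2 * pi * 3 powr r) + 3 * pi * 3 powr (r / 2)) * real N powr (r - 1)"
      by (simp only: distrib_left distrib_right mult.assoc)
    finally show "pint r (trig N y)
        \<le> 2 powr r * (2 powr r * (2 * pi + 2 * pi * 3 powr r) + 3 * pi * 3 powr (r / 2)) * real N powr (r - 1)" .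
  qed (use yz E(3) in auto)
qed

section \<open>Lower bound for the widths\<close>

lemma continuous_in_Lp:
  assumes "continuous_on UNIV f" "\<And>x. f (x + 2 * pi) = f x" "0 < p"
  shows "f \<in> Lp p"
  using assms integrable_powr_continuous[of f p] by (auto simp: Lp_def intro: borel_measurable_continuous_onI)

lemma trig_in_Lp: "0 < p \<Longrightarrow> trig N u \<in> Lp p"
  by (intro continuous_in_Lp continuous_intros trig_periodic)

lemma trig_poly_subset_Lp:
  assumes "0 < p"
  shows "trig_poly n \<subseteq> Lp p"
proof -
  let ?S = "{f. continuous_on UNIV f \<and> (\<forall>x. f (x + 2 * pi) = (f x :: real))}"
  have shift: "cis (real k * (x + 2 * pi)) = cis (real k * x)" for k x
  proof -
    have "cis (real k * (x + 2 * pi)) = cis (real k * x) * cis (2 * pi * real k)" by (simp add: cis_mult algebra_simps)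
    moreover have "cis (2 * pi * real k) = 1" by (rule cis_multiple_2pi) auto
    ultimately show ?thesis by simp
  qed
  have cs: "cos (real k * (x + 2 * pi)) = cos (real k * x)" "sin (real k * (x + 2 * pi)) = sin (real k * x)" for k x
    using shift[of k x] by (auto simp: complex_eq_iff)
  have "trig_poly n \<subseteq> ?S"
    unfolding trig_poly_def
  proof (rule fun_vs.span_minimal)
    show "{\<lambda>x. 1} \<union> (\<lambda>k x. cos (real k * x)) ` {1..n} \<union> (\<lambda>k x. sin (real k * x)) ` {1..n} \<subseteq> ?S"
      using cs by (auto intro!: continuous_intros)
    show "fun_vs.subspace ?S"
      by (rule fun_vs.subspaceI) (auto intro!: continuous_intros simp: plus_fun_def zero_fun_def)
  qed
  then show ?thesis using continuous_in_Lp assms by blast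
qed

lemma width_le_deviation_trig_poly:
  assumes "0 < q"
  shows "kolmogorov_width N (2 * n + 1) A (Lp q) \<le> deviation N A (trig_poly n)"
  unfolding kolmogorov_width_def
proof (rule INF_lower)
  let ?c = "(\<lambda>k x. cos (real k * x)) ` {1..n}" and ?s = "(\<lambda>k x. sin (real k * x)) ` {1..n}"
  let ?B = "{\<lambda>_::real. 1 :: real} \<union> ?c \<union> ?s"
  let ?o = "{\<lambda>_::real. 1 :: real}"
  have "card ?c \<le> n" "card ?s \<le> n"
    using card_image_le[of "{1..n}" "\<lambda>k x. cos (real k * x)"] card_image_le[of "{1..n}" "\<lambda>k x. sin (real k * x)"]
    by simp_all
  then have "card (?o \<union> ?c) + card ?s \<le> (1 + n) + n"
    using card_Un_le[of ?o ?c] by (intro add_mono order_trans[OF card_Un_le]) simp_all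
  from order_trans[OF card_Un_le this] have "card ?B \<le> (1 + n) + n" .
  also have "(1 + n) + n = 2 * n + 1" by simp
  finally have "card ?B \<le> 2 * n + 1" .
  moreover have "finite ?B" by (intro finite_UnI finite_imageI finite.insertI finite.emptyI finite_atLeastAtMost)
  ultimately have "\<exists>B. finite B \<and> card B \<le> 2 * n + 1 \<and> trig_poly n = fun_vs.span B"
    unfolding trig_poly_def by (intro exI[of _ ?B] conjI refl)
  moreover have "fun_vs.subspace (trig_poly n)" unfolding trig_poly_def by (rule fun_vs.subspace_span)
  ultimately show "trig_poly n \<in> {V. V \<subseteq> Lp q \<and> fun_vs.subspace V \<and> (\<exists>B. finite B \<and> card B \<le> 2 * n + 1 \<and> V = fun_vs.span B)}"
    using trig_poly_subset_Lp[OF assms] by blast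
qed

text \<open>
  Hoelder's inequality up to the factor 2, obtained from Young's inequality with the scaling \<open>t\<close> for
  which the term with \<open>Y\<close> is half of \<open>W\<close>.
\<close>

lemma holder_lower_bound:
  fixes h Y :: "real \<Rightarrow> real"
  assumes q: "1 < q" and r: "r = q / (q - 1)"
    and Ih: "integrable circle h" and Ihq: "integrable circle (\<lambda>x. \<bar>h x\<bar> powr q)"
    and Y: "continuous_on UNIV Y" "pint r Y \<le> Z"
    and W: "0 < W" "W \<le> (\<integral>x. h x * Y x \<partial>circle)" and Z: "0 < Z"
  shows "W / 2 / Z powr (1 / r) \<le> pint q h powr (1 / q)"
proof -
  define X where "X = pint q h"
  have "q / (q - 1) = 1 + 1 / (q - 1)" using dual_exponent(1)[OF q] q by simp
  then have r1: "1 < r" using q by (simp add: r)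
  have rq: "1 / q + 1 / r = 1" using q by (simp add: r diff_divide_distrib)
  define t where "t = (2 * Z / W) powr (1 / r)"
  have t: "0 < t" "t powr r = 2 * Z / W" using W Z r1 by (simp_all add: t_def powr_powr)
  have Iyr: "integrable circle (\<lambda>x. \<bar>Y x\<bar> powr r)" using Y r1 by (intro integrable_powr_continuous) auto
  have "W \<le> (\<integral>x. h x * Y x \<partial>circle)" by (rule W(2))
  also have "\<dots> \<le> (\<integral>x. t powr q * \<bar>h x\<bar> powr q + (1 / t) powr r * \<bar>Y x\<bar> powr r \<partial>circle)"
  proof (rule integral_mono)
    show "integrable circle (\<lambda>x. h x * Y x)" by (intro integrable_mult_continuous Ih Y)
    show "integrable circle (\<lambda>x. t powr q * \<bar>h x\<bar> powr q + (1 / t) powr r * \<bar>Y x\<bar> powr r)"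
      using Ihq Iyr by simp
    fix x
    have "h x * Y x \<le> \<bar>h x\<bar> * \<bar>Y x\<bar>" by (metis abs_ge_self abs_mult)
    also have "\<dots> = (t * \<bar>h x\<bar>) * (1 / t * \<bar>Y x\<bar>)" using t by simp
    also have "\<dots> \<le> (t * \<bar>h x\<bar>) powr q + (1 / t * \<bar>Y x\<bar>) powr r"
      using t by (intro young_powr q r1 rq) auto
    also have "\<dots> = t powr q * \<bar>h x\<bar> powr q + (1 / t) powr r * \<bar>Y x\<bar> powr r"
      using t by (simp only: powr_mult abs_ge_zero less_imp_le zero_less_divide_1_iff)
    finally show "h x * Y x \<le> t powr q * \<bar>h x\<bar> powr q + (1 / t) powr r * \<bar>Y x\<bar> powr r" .
  qed
  also have "\<dots> = t powr q * X + (1 / t) powr r * pint r Y"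
    using Ihq Iyr by (simp add: X_def)
  also have "(1 / t) powr r * pint r Y \<le> (1 / t) powr r * Z"
    using Y(2) by (intro mult_left_mono) auto
  also have "(1 / t) powr r * Z = W / 2" using t W Z by (simp add: powr_divide)
  finally have "W / 2 \<le> t powr q * X" by simp
  then have "W / 2 / t powr q \<le> X" using t by (simp add: pos_divide_le_eq mult.commute)
  then have "(W / 2 / t powr q) powr (1 / q) \<le> X powr (1 / q)"
    using W t q by (intro powr_mono2) auto
  moreover have "(W / 2 / t powr q) powr (1 / q) = (W / 2) powr (1 / q) / t"
  proof -
    have "(W / 2 / t powr q) powr (1 / q) = (W / 2) powr (1 / q) / (t powr q) powr (1 / q)"
      by (rule powr_divide)
    moreover have "(t powr q) powr (1 / q) = t" using t q by (simp add: powr_powr)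
    ultimately show ?thesis by (simp only:)
  qed
  moreover have "(W / 2) powr (1 / q) / t = W / 2 / Z powr (1 / r)"
  proof -
    have "t = Z powr (1 / r) / (W / 2) powr (1 / r)"
      using W Z unfolding t_def by (simp add: powr_divide powr_mult)
    then have "(W / 2) powr (1 / q) / t = (W / 2) powr (1 / q) * (W / 2) powr (1 / r) / Z powr (1 / r)" by simp
    also have "(W / 2) powr (1 / q) * (W / 2) powr (1 / r) = W / 2"
      unfolding powr_add[symmetric] rq using W by simp
    finally show ?thesis .
  qed
  ultimately show ?thesis by (simp add: X_def)
qed

text \<open>
  A subspace of dimension \<open>2n+1\<close> leaves room among the polynomials of degree \<open>N\<close>, a fixed power of
  \<open>n\<close>, for an annihilating \<open>y\<close> whose norms are those of a cosine, if \<open>S = 1\<close>, or of a Fejer kernel, if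
  \<open>S = N\<close>. With \<open>S\<close> as the degree of concentration both cases obey the same inequalities.
  Frequencies 0 and 1 are avoided because \<open>\<Lambda>\<close> is arbitrary there.
\<close>

lemma annihilating_polynomial:
  fixes p q :: real
  assumes p: "1 < p" and r: "1 < r"
  obtains A c C where "1 \<le> A" "0 < c" "0 < C"
    "\<And>n B S. 2 \<le> n \<Longrightarrow> finite B \<Longrightarrow> card B \<le> 2 * n + 1 \<Longrightarrow> S = 1 \<or> S = real ((100 * n) ^ A) \<Longrightarrow>
      \<exists>y. (\<forall>k. k \<notin> {2..(100 * n) ^ A} \<longrightarrow> y k = 0) \<and> (\<forall>b\<in>B. coef_inner {2..(100 * n) ^ A} y b = 0) \<and>
        c * S \<le> coef_inner {2..(100 * n) ^ A} y y \<and>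
        pint p (trig ((100 * n) ^ A) y) \<le> C * S powr (p - 1) \<and>
        pint r (trig ((100 * n) ^ A) y) \<le> C * S powr (r - 1)"
proof -
  \<comment> \<open>Powers of \<open>m\<close> such as \<open>m\<^bsup>p/2\<^esup>\<close> have to be at most \<open>N\<close> in the flat and \<open>N\<^bsup>p-1\<^esup>\<close> in the peaked case.\<close>
  define A where "A = nat \<lceil>max (max (p / 2) (r / 2)) (max (p / 2 / (p - 1)) (r / 2 / (r - 1)))\<rceil> + 1"
  have A0: "max (max (p / 2) (r / 2)) (max (p / 2 / (p - 1)) (r / 2 / (r - 1))) \<le> real A"
    unfolding A_def by linarith
  then have "p / 2 \<le> real A" "r / 2 \<le> real A" "p / 2 / (p - 1) \<le> real A" "r / 2 / (r - 1) \<le> real A"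
    by (simp_all only: max.bounded_iff)
  moreover have "1 \<le> A" by (simp add: A_def)
  ultimately have A: "1 \<le> A" "p / 2 \<le> real A" "r / 2 \<le> real A" "p / 2 \<le> real A * (p - 1)" "r / 2 \<le> real A * (r - 1)"
    using p r by (simp_all only: pos_divide_le_eq diff_gt_0_iff_gt)
  define C1 where "C1 s = 2 powr s * (2 * pi + 3 * pi * 2 powr (s / 2))" for s :: real
  define C2 where "C2 s = 2 powr s * (2 powr s * (2 * pi + 2 * pi * 3 powr s) + 3 * pi * 3 powr (s / 2))" for s :: real
  define C where "C = (C1 p + C1 r) + (C2 p + C2 r)"
  have pos: "0 < C1 s" "0 < C2 s" for s
    unfolding C1_def C2_def by (auto intro!: mult_pos_pos add_pos_pos)
  have C: "0 < C" "C1 p \<le> C" "C1 r \<le> C" "C2 p \<le> C" "C2 r \<le> C"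
    unfolding C_def using pos[of p] pos[of r] by linarith+
  show ?thesis
  proof (rule that[of A "1/8" C])
    fix n :: nat and B :: "(nat \<Rightarrow> complex) set" and S :: real
    assume n: "2 \<le> n" and B: "finite B" "card B \<le> 2 * n + 1" and S: "S = 1 \<or> S = real ((100 * n) ^ A)"
    define N where "N = (100 * n) ^ A"
    define m where "m = 2 * n + 1"
    have "(100 * n) ^ 1 \<le> N" unfolding N_def using n A(1) by (intro power_increasing) auto
    then have N100: "100 * n \<le> N" by simp
    have Nr: "real N = real (100 * n) powr real A" using n by (simp add: N_def powr_realpow)
    have m_le: "real m \<le> real (100 * n)" using n by (simp add: m_def)
    have flat: "real m powr (s / 2) \<le> real N" if "0 < s" "s / 2 \<le> real A" for s
    proof -
      have "real m powr (s / 2) \<le> real (100 * n) powr (s / 2)" using m_le that by (intro powr_mono2) auto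
      also have "\<dots> \<le> real (100 * n) powr real A" using that n by (intro powr_mono) auto
      finally show ?thesis by (simp add: Nr)
    qed
    have peaked: "real m powr (s / 2) \<le> real N powr (s - 1)" if "0 < s" "s / 2 \<le> real A * (s - 1)" for s
    proof -
      have "real m powr (s / 2) \<le> real (100 * n) powr (s / 2)" using m_le that by (intro powr_mono2) auto
      also have "\<dots> \<le> real (100 * n) powr (real A * (s - 1))" using that n by (intro powr_mono) auto
      also have "\<dots> = real N powr (s - 1)" by (simp only: Nr powr_powr)
      finally show ?thesis .
    qed
    have p0: "0 < p" "0 < r" using p r by auto
    consider "S = 1" | "S = real N" using S N_def by blast
    then show "\<exists>y. (\<forall>k. k \<notin> {2..(100 * n) ^ A} \<longrightarrow> y k = 0) \<and> (\<forall>b\<in>B. coef_inner {2..(100 * n) ^ A} y b = 0) \<and>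
        1 / 8 * S \<le> coef_inner {2..(100 * n) ^ A} y y \<and>
        pint p (trig ((100 * n) ^ A) y) \<le> C * S powr (p - 1) \<and>
        pint r (trig ((100 * n) ^ A) y) \<le> C * S powr (r - 1)"
    proof cases
      case S: 1
      obtain y where y: "\<And>k. k \<notin> {2..N} \<Longrightarrow> y k = 0" "\<And>b. b \<in> B \<Longrightarrow> coef_inner {2..N} y b = 0"
        "1 / 2 \<le> coef_inner {2..N} y y"
        "\<And>s. 1 < s \<Longrightarrow> real m powr (s / 2) \<le> real N \<Longrightarrow> pint s (trig N y) \<le> C1 s"
        unfolding C1_def
        by (rule flat_orthogonal_polynomial[of B m N]) (use B N100 n in \<open>auto simp: m_def\<close>)
      have "pint p (trig N y) \<le> C" "pint r (trig N y) \<le> C"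
        using y(4)[OF p flat[OF p0(1) A(2)]] y(4)[OF r flat[OF p0(2) A(3)]] C by linarith+
      then show ?thesis unfolding N_def[symmetric] using y(1-3) S by (intro exI[of _ y]) auto
    next
      case S: 2
      obtain y where y: "\<And>k. k \<notin> {2..N} \<Longrightarrow> y k = 0" "\<And>b. b \<in> B \<Longrightarrow> coef_inner {2..N} y b = 0"
        "real N / 8 \<le> coef_inner {2..N} y y"
        "\<And>s. 1 < s \<Longrightarrow> real m powr (s / 2) \<le> real N powr (s - 1) \<Longrightarrow>
           pint s (trig N y) \<le> C2 s * real N powr (s - 1)"
        unfolding C2_def
        by (rule peaked_orthogonal_polynomial[of B m N]) (use B N100 n in \<open>auto simp: m_def\<close>)
      have "C2 s * real N powr (s - 1) \<le> C * real N powr (s - 1)" if "C2 s \<le> C" for s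
        using that by (intro mult_right_mono) auto
      then have "pint p (trig N y) \<le> C * real N powr (p - 1)"
        "pint r (trig N y) \<le> C * real N powr (r - 1)"
        using y(4)[OF p peaked[OF p0(1) A(4)]] y(4)[OF r peaked[OF p0(2) A(5)]] C(4,5) by (blast intro: order_trans)+
      then show ?thesis unfolding N_def[symmetric] using y(1-3) S by (intro exI[of _ y]) auto
    qed
  qed (use A(1) C(1) in auto)
qed

text \<open>
  Testing the image \<open>f\<close> of the rotated polynomial \<open>y\<close> against \<open>y\<close> itself gives a sum of the
  nonnegative numbers \<open>\<Lambda> k \<bar>y k\<bar>\<^sup>2\<close>, and the smallest multiplier that occurs is of order
  \<open>N\<^bsup>-\<alpha>\<^esup> (ln n)\<^bsup>-\<gamma>\<^esup>\<close>. The power of \<open>S\<close> left over by the norms of \<open>y\<close> is \<open>S\<^bsup>1/p-1/q\<^esup>\<close>, so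
  \<open>S = N\<close> compensates \<open>N\<^bsup>-\<alpha>\<^esup>\<close> for \<open>p < q\<close>, while for \<open>q \<le> p\<close> there is nothing to compensate.
\<close>

theorem width_lower_bound:
  fixes p q \<beta> :: real
  assumes pq: "1 < p" "1 < q" and L: "log_multiplier \<Lambda> (max (1 / p - 1 / q) 0) \<gamma>"
  obtains c where "0 < c" "\<And>n. 2 \<le> n \<Longrightarrow>
    ennreal (c * ln (real n) powr (- \<gamma>))
      \<le> kolmogorov_width (Lp_norm q) (2 * n + 1) (multiplier_class \<Lambda> \<beta> (Lp_ball p)) (Lp q)"
proof -
  let ?\<alpha> = "max (1 / p - 1 / q) 0"
  interpret log_multiplier \<Lambda> ?\<alpha> \<gamma> by (rule L)
  define r where "r = q / (q - 1)"
  have "q / (q - 1) = 1 + 1 / (q - 1)" using dual_exponent(1)[OF pq(2)] pq by simp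
  then have r1: "1 < r" using pq by (simp add: r_def)
  obtain C0 where C0: "0 < C0" "\<And>N u \<theta>. pint p (trig N (\<lambda>k. cis \<theta> * u k)) \<le> C0 * pint p (trig N u)"
    using rotation_bounded[OF pq(1)] by blast
  obtain A c1 C1 where A: "1 \<le> A" and c1: "0 < c1" and C1: "0 < C1"
    and ann: "\<And>n B S. 2 \<le> n \<Longrightarrow> finite B \<Longrightarrow> card B \<le> 2 * n + 1 \<Longrightarrow> S = 1 \<or> S = real ((100 * n) ^ A) \<Longrightarrow>
      \<exists>y. (\<forall>k. k \<notin> {2..(100 * n) ^ A} \<longrightarrow> y k = 0) \<and> (\<forall>b\<in>B. coef_inner {2..(100 * n) ^ A} y b = 0) \<and>
        c1 * S \<le> coef_inner {2..(100 * n) ^ A} y y \<and>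
        pint p (trig ((100 * n) ^ A) y) \<le> C1 * S powr (p - 1) \<and>
        pint r (trig ((100 * n) ^ A) y) \<le> C1 * S powr (r - 1)"
    by (rule annihilating_polynomial[OF pq(1) r1]) (rule that; assumption)
  define c2 where "c2 = pi * (C0 * C1) powr (- 1 / p) * c1 / 2 / C1 powr (1 / r)"
  define c where "c = c2 * (8 * real A) powr (- \<gamma>)"
  have c2: "0 < c2" unfolding c2_def using C0(1) C1 c1 by simp
  have c: "0 < c" unfolding c_def using c2 A by simp
  show ?thesis
  proof (rule that[OF c])
    fix n :: nat assume n: "2 \<le> n"
    define N where "N = (100 * n) ^ A"
    define S where "S = (if p < q then real N else 1)"
    have "(100 * n) ^ 1 \<le> N" unfolding N_def using n A by (intro power_increasing) auto
    then have N2: "2 \<le> N" using n by simp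
    have S0: "0 < S" using N2 by (simp add: S_def)
    define \<theta> where "\<theta> = \<beta> * pi / 2"
    have SN: "\<Lambda> N * S powr (1 / p - 1 / q) = ln (real N) powr (- \<gamma>)"
    proof (cases "p < q")
      case True
      then have a: "?\<alpha> = 1 / p - 1 / q" using pq by (simp add: max_def field_simps)
      have "real N powr (- x) * L * real N powr x = L" for x L using N2 by (simp add: powr_minus)
      then show ?thesis using True unfolding \<Lambda>[OF N2] a powr_log_def S_def by (simp only: if_True)
    next
      case False
      then have "?\<alpha> = 0" using pq by (simp add: max_def field_simps)
      then show ?thesis using False N2 by (simp add: \<Lambda> powr_log_def S_def)
    qed
    have lnN: "(8 * real A) powr (- \<gamma>) * ln (real n) powr (- \<gamma>) \<le> ln (real N) powr (- \<gamma>)"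
    proof -
      have "ln (real N) = real A * ln (real (100 * n))" unfolding N_def of_nat_power by (rule ln_realpow)
      also have "ln (real (100 * n)) \<le> ln (real (n ^ 8))"
      proof -
        \<comment> \<open>\<open>100 n \<le> n\<^sup>8\<close> for \<open>n \<ge> 2\<close>\<close>
        have "2 ^ 7 \<le> n ^ 7" using n by (intro power_mono) auto
        then have "100 * n \<le> n ^ 7 * n" by (intro mult_right_mono) auto
        also have "\<dots> = n ^ 8" by (simp flip: power_Suc2)
        finally have "real (100 * n) \<le> real (n ^ 8)" by (rule of_nat_mono)
        then show ?thesis using n by (subst ln_le_cancel_iff) auto
      qed
      also have "ln (real (n ^ 8)) = 8 * ln (real n)" using n by (simp add: ln_realpow)
      finally have "ln (real N) \<le> 8 * real A * ln (real n)" using A by (simp add: mult_ac)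
      moreover have "0 < ln (real N)" using N2 by simp
      ultimately have "(8 * real A * ln (real n)) powr (- \<gamma>) \<le> ln (real N) powr (- \<gamma>)"
        using \<gamma> by (intro powr_mono2') auto
      then show ?thesis using n A by (simp add: powr_mult)
    qed
    have main: "ennreal (c * ln (real n) powr (- \<gamma>)) \<le> deviation (Lp_norm q) (multiplier_class \<Lambda> \<beta> (Lp_ball p)) V"
      if V: "V \<subseteq> Lp q" "V = fun_vs.span B" "finite B" "card B \<le> 2 * n + 1" for V B
    proof -
      have cB: "card (fcoef ` B) \<le> 2 * n + 1" using card_image_le[OF V(3), of fcoef] V(4) by linarith
      have "finite (fcoef ` B)" using V(3) by simp
      moreover have "S = 1 \<or> S = real ((100 * n) ^ A)" by (simp add: S_def N_def)
      ultimately obtain y where y: "\<And>k. k \<notin> {2..N} \<Longrightarrow> y k = 0" "\<And>b. b \<in> B \<Longrightarrow> coef_inner {2..N} y (fcoef b) = 0"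
        "c1 * S \<le> coef_inner {2..N} y y"
        and yp: "pint p (trig N y) \<le> C1 * S powr (p - 1)"
        and yr: "pint r (trig N y) \<le> C1 * S powr (r - 1)"
        using ann[OF n _ cB, of S] unfolding N_def[symmetric] by blast
      define Y where "Y = trig N y"
      have contY: "continuous_on UNIV Y" unfolding Y_def by (intro continuous_intros)
      have V_orth: "integrable circle g \<and> (\<integral>x. g x * Y x \<partial>circle) = 0" if "g \<in> V" for g
      proof -
        let ?T = "{g. integrable circle g \<and> (\<integral>x. g x * Y x \<partial>circle) = 0}"
        have "fun_vs.span B \<subseteq> ?T"
        proof (rule fun_vs.span_minimal)
          show "B \<subseteq> ?T"
          proof
            fix b assume b: "b \<in> B"
            then have "b \<in> V" unfolding V(2) by (rule fun_vs.span_base)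
            then have I: "integrable circle b" using V(1) pq by (intro Lp_imp_integrable[of b q]) auto
            have "(\<Sum>k=1..N. y k \<bullet> fcoef b k) = coef_inner {2..N} y (fcoef b)"
              unfolding coef_inner_def using y(1) by (intro sum.mono_neutral_right) auto
            then have "(\<integral>x. b x * Y x \<partial>circle) = 0" unfolding Y_def integral_mult_trig[OF I] using y(2)[OF b] by simp
            then show "b \<in> ?T" using I by simp
          qed
          have IY: "integrable circle (\<lambda>x. g x * Y x)" if "integrable circle g" for g
            by (rule integrable_mult_continuous[OF that contY])
          show "fun_vs.subspace ?T"
            by (rule fun_vs.subspaceI)
               (auto simp: plus_fun_def zero_fun_def distrib_right mult.assoc IY)
        qed
        then show ?thesis using that V(2) by blast
      qed
      define P where "P = C0 * (C1 * S powr (p - 1))"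
      have P: "0 < P" unfolding P_def using C0(1) C1 S0 by simp
      \<comment> \<open>The factor that brings the rotated \<open>y\<close> into the unit ball.\<close>
      define s where "s = P powr (- 1 / p)"
      have s: "0 < s" "s powr p = 1 / P"
      proof -
        have "s powr p = P powr (- 1 / p * p)" by (simp only: s_def powr_powr)
        also have "- 1 / p * p = - 1" using pq by simp
        finally show "s powr p = 1 / P" using P by (simp add: powr_minus_divide)
      qed (use P in \<open>simp add: s_def\<close>)
      define \<phi> where "\<phi> = trig N (\<lambda>k. s *\<^sub>R (cis (- \<theta>) * y k))"
      have \<phi>: "\<phi> \<in> Lp_ball p"
      proof -
        have L\<phi>: "\<phi> \<in> Lp p" unfolding \<phi>_def using pq by (intro trig_in_Lp) auto
        have "pint p \<phi> = s powr p * pint p (trig N (\<lambda>k. cis (- \<theta>) * y k))"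
          unfolding \<phi>_def trig_scaleR using s(1) by (simp add: abs_mult powr_mult)
        also have "\<dots> \<le> s powr p * P"
          unfolding P_def using C0(1) yp by (intro mult_left_mono order_trans[OF C0(2)]) auto
        also have "\<dots> = 1 powr p" using s P by simp
        finally have "Lp_norm p \<phi> \<le> ennreal 1" using pq L\<phi> by (intro Lp_norm_le) auto
        then show ?thesis using L\<phi> by (simp add: Lp_ball_def \<phi>_def)
      qed
      define f where "f = trig N (\<lambda>k. (s * \<Lambda> k) *\<^sub>R y k)"
      have f: "f \<in> multiplier_class \<Lambda> \<beta> (Lp_ball p)"
        unfolding multiplier_class_iff
      proof (intro conjI bexI[OF _ \<phi>] allI impI)
        show "f \<in> Lp 1" unfolding f_def by (rule trig_in_Lp) simp
        show "fourier_cos f 0 = 0" by (simp add: f_def)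
        fix k :: nat assume "1 \<le> k"
        moreover have "cis \<theta> * (cis (- \<theta>) * z) = z" for z by (simp add: mult.assoc[symmetric] cis_mult)
        ultimately show "fcoef f k = \<Lambda> k *\<^sub>R (cis (\<beta> * pi / 2) * fcoef \<phi> k)"
          unfolding f_def \<phi>_def \<theta>_def[symmetric] by (simp add: fcoef_trig' mult.commute[of s])
      qed
      define W where "W = pi * s * \<Lambda> N * (c1 * S)"
      define Z where "Z = C1 * S powr (r - 1)"
      have \<Lambda>N: "0 < \<Lambda> N" using N2 by (simp add: \<Lambda> powr_log_def)
      have W: "0 < W" unfolding W_def using s(1) \<Lambda>N c1 S0 by simp
      have Z: "0 < Z" unfolding Z_def using C1 S0 by simp
      have fY: "W \<le> (\<integral>x. f x * Y x \<partial>circle)"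
      proof -
        have "\<Lambda> N * coef_inner {2..N} y y \<le> (\<Sum>k\<in>{2..N}. \<Lambda> k * (y k \<bullet> y k))"
          unfolding coef_inner_def sum_distrib_left
          by (intro sum_mono mult_right_mono antimono) auto
        also have "\<dots> = (\<Sum>k=1..N. \<Lambda> k * (y k \<bullet> y k))" using y(1) by (intro sum.mono_neutral_left) auto
        finally have 1: "\<Lambda> N * coef_inner {2..N} y y \<le> (\<Sum>k=1..N. \<Lambda> k * (y k \<bullet> y k))" .
        have "(\<integral>x. f x * Y x \<partial>circle) = pi * s * (\<Sum>k=1..N. \<Lambda> k * (y k \<bullet> y k))"
          unfolding f_def Y_def integral_trig_mult by (simp add: sum_distrib_left mult_ac)
        moreover have "\<Lambda> N * (c1 * S) \<le> (\<Sum>k=1..N. \<Lambda> k * (y k \<bullet> y k))"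
          using 1 mult_left_mono[OF y(3), of "\<Lambda> N"] \<Lambda>N by linarith
        ultimately show ?thesis
          unfolding W_def using s(1) by (simp only: mult.assoc) (intro mult_left_mono; simp)
      qed
      have WZ: "c * ln (real n) powr (- \<gamma>) \<le> W / 2 / Z powr (1 / r)"
      proof -
        have e1: "s = (C0 * C1) powr (- 1 / p) * S powr (- (1 - 1 / p))"
        proof -
          have "P = (C0 * C1) * S powr (p - 1)" by (simp add: P_def)
          moreover have "(p - 1) * (- 1 / p) = - (1 - 1 / p)" using pq by (simp add: diff_divide_distrib)
          ultimately show ?thesis using C0(1) C1 unfolding s_def by (simp only: powr_mult powr_powr)
        qed
        have e2: "Z powr (1 / r) = C1 powr (1 / r) * S powr (1 / q)"
        proof -
          have "1 / r = 1 - 1 / q" using pq by (simp add: r_def diff_divide_distrib)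
          moreover have "(r - 1) * (1 / r) = 1 - 1 / r" using r1 by (simp add: diff_divide_distrib)
          ultimately have "(r - 1) * (1 / r) = 1 / q" by linarith
          then show ?thesis using C1 unfolding Z_def by (simp only: powr_mult powr_powr)
        qed
        have "W / 2 / Z powr (1 / r) = c2 * \<Lambda> N * (S powr (- (1 - 1 / p)) * S powr 1 / S powr (1 / q))"
          unfolding W_def c2_def e1 e2 using S0 by (simp add: mult_ac)
        also have "S powr (- (1 - 1 / p)) * S powr 1 / S powr (1 / q) = S powr (1 / p - 1 / q)"
          unfolding powr_add[symmetric] powr_diff[symmetric] by simp
        finally have "W / 2 / Z powr (1 / r) = c2 * ln (real N) powr (- \<gamma>)" using SN by (simp add: mult.assoc)
        moreover have "c * ln (real n) powr (- \<gamma>) \<le> c2 * ln (real N) powr (- \<gamma>)"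
          using mult_left_mono[OF lnN, of c2] c2 by (simp add: c_def mult.assoc)
        ultimately show ?thesis by simp
      qed
      have "ennreal (c * ln (real n) powr (- \<gamma>)) \<le> (INF g\<in>V. Lp_norm q (f - g))"
      proof (rule INF_greatest)
        fix g assume g: "g \<in> V"
        show "ennreal (c * ln (real n) powr (- \<gamma>)) \<le> Lp_norm q (f - g)"
        proof (cases "f - g \<in> Lp q")
          case False
          then show ?thesis by (simp add: Lp_norm_def)
        next
          case True
          have Ig: "integrable circle g" "(\<integral>x. g x * Y x \<partial>circle) = 0" using V_orth[OF g] by auto
          have If: "integrable circle f" by (simp add: f_def)
          have h: "f - g = (\<lambda>x. f x - g x)" by (simp add: fun_eq_iff)
          have "W / 2 / Z powr (1 / r) \<le> (\<integral>x. \<bar>f x - g x\<bar> powr q \<partial>circle) powr (1 / q)"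
          proof (rule holder_lower_bound[OF pq(2) r_def _ _ contY _ W _ Z])
            show "integrable circle (\<lambda>x. f x - g x)" using If Ig by simp
            show "integrable circle (\<lambda>x. \<bar>f x - g x\<bar> powr q)" using True by (simp add: Lp_def h)
            show "pint r Y \<le> Z" using yr by (simp add: Y_def Z_def)
            have "(\<integral>x. (f x - g x) * Y x \<partial>circle) = (\<integral>x. f x * Y x \<partial>circle)"
              using Ig integrable_mult_continuous[OF If contY] integrable_mult_continuous[OF Ig(1) contY]
              by (simp add: left_diff_distrib)
            then show "W \<le> (\<integral>x. (f x - g x) * Y x \<partial>circle)" using fY by simp
          qed
          then show ?thesis using True WZ by (simp add: Lp_norm_def h ennreal_leI)
        qed
      qed
      also have "\<dots> \<le> deviation (Lp_norm q) (multiplier_class \<Lambda> \<beta> (Lp_ball p)) V"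
        unfolding deviation_def by (rule SUP_upper[OF f])
      finally show ?thesis .
    qed
    show "ennreal (c * ln (real n) powr (- \<gamma>))
      \<le> kolmogorov_width (Lp_norm q) (2 * n + 1) (multiplier_class \<Lambda> \<beta> (Lp_ball p)) (Lp q)"
      unfolding kolmogorov_width_def by (rule INF_greatest) (use main in blast)
  qed
qed

theorem theorem1:
  fixes p q \<gamma> \<beta> :: real and \<Lambda> :: "nat \<Rightarrow> real"
  assumes "1 < p" and "1 < q" and "0 < \<gamma>"
    and "\<And>k. 2 \<le> k \<Longrightarrow>
      \<Lambda> k = real k powr (- max (1 / p - 1 / q) 0) * ln (real k) powr (- \<gamma>)"
  shows "same_order
    (\<lambda>n. deviation (Lp_norm q) (multiplier_class \<Lambda> \<beta> (Lp_ball p)) (trig_poly n))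
    (\<lambda>n. kolmogorov_width (Lp_norm q) (2 * n + 1) (multiplier_class \<Lambda> \<beta> (Lp_ball p)) (Lp q))"
proof -
  have L: "log_multiplier \<Lambda> (max (1 / p - 1 / q) 0) \<gamma>"
    by unfold_locales (use assms in \<open>auto simp: powr_log_def\<close>)
  let ?a = "\<lambda>n. deviation (Lp_norm q) (multiplier_class \<Lambda> \<beta> (Lp_ball p)) (trig_poly n)"
  let ?b = "\<lambda>n. kolmogorov_width (Lp_norm q) (2 * n + 1) (multiplier_class \<Lambda> \<beta> (Lp_ball p)) (Lp q)"
  obtain C where C: "0 < C" "\<And>n. 2 \<le> n \<Longrightarrow> ?a n \<le> ennreal (C * ln (real n) powr (- \<gamma>))"
    using deviation_trig_poly_le[OF assms(1,2) L] by blast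
  obtain c where c: "0 < c" "\<And>n. 2 \<le> n \<Longrightarrow> ennreal (c * ln (real n) powr (- \<gamma>)) \<le> ?b n"
    using width_lower_bound[OF assms(1,2) L] by blast
  have ba: "?b n \<le> ?a n" for n using assms(2) by (intro width_le_deviation_trig_poly) auto
  have "?a n < \<infinity> \<and> ?b n < \<infinity> \<and> ennreal 1 * ?b n \<le> ?a n \<and> ?a n \<le> ennreal (max 1 (C / c)) * ?b n" if n: "2 \<le> n" for n
  proof (intro conjI)
    show a: "?a n < \<infinity>" using C(2)[OF n] by (auto simp: le_less_trans)
    show "?b n < \<infinity>" using ba[of n] a by (rule le_less_trans)
    show "ennreal 1 * ?b n \<le> ?a n" using ba by simp
    have "?a n \<le> ennreal (C * ln (real n) powr (- \<gamma>))" by (rule C(2)[OF n])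
    also have "\<dots> \<le> ennreal (max 1 (C / c) * (c * ln (real n) powr (- \<gamma>)))"
    proof (rule ennreal_leI)
      have "C * ln (real n) powr (- \<gamma>) = C / c * (c * ln (real n) powr (- \<gamma>))" using c(1) by simp
      also have "\<dots> \<le> max 1 (C / c) * (c * ln (real n) powr (- \<gamma>))"
        using c(1) by (intro mult_right_mono) auto
      finally show "C * ln (real n) powr (- \<gamma>) \<le> max 1 (C / c) * (c * ln (real n) powr (- \<gamma>))" .
    qed
    also have "\<dots> = ennreal (max 1 (C / c)) * ennreal (c * ln (real n) powr (- \<gamma>))"
      using c(1) by (intro ennreal_mult) auto
    also have "\<dots> \<le> ennreal (max 1 (C / c)) * ?b n"
      by (intro mult_left_mono c(2) n) simp
    finally show "?a n \<le> ennreal (max 1 (C / c)) * ?b n" .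
  qed
  then have "\<forall>\<^sub>F n in sequentially. ?a n < \<infinity> \<and> ?b n < \<infinity> \<and> ennreal 1 * ?b n \<le> ?a n \<and> ?a n \<le> ennreal (max 1 (C / c)) * ?b n"
    using eventually_ge_at_top[of "2::nat"] by (rule eventually_mono[rotated])
  then show ?thesis
    unfolding same_order_def by (intro exI[of _ 1] exI[of _ "max 1 (C / c)"] conjI) simp_all
qed

end
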